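(* Let $\lambda\in\mathbb{C}$ with $|\lambda|>1$, let $\varphi\in \mathrm{Diff}^{\infty}([0,\infty))$ satisfy $\varphi(x)>x$ for all $x>0$ and be tangent to the identity to infinite order at $0$, and let $(R,\mathcal{F},J)$ be the $5$-dimensional LC Reeb component $R=\tilde R/T^{\mathbb{Z}}$ with $T(z_1,z_2,x)=(\lambda z_1+z_2,\lambda z_2,\varphi(x))$ (i.e. $\tau=1$, $\lambda=\mu$), with boundary Hopf surface $H$. Then there is an exact sequence of groups $$0\to\mathcal{S}_{\varphi,\lambda}\to\mathrm{Aut}(R,H)\xrightarrow{P}Z_\varphi\to1,$$ and $\mathrm{Aut}(R,H)\cong\mathcal{S}_{\varphi,\lambda}\rtimes Z_\varphi$, where $\eta\in Z_\varphi$ acts on $(\beta_1,\beta_2)\in\mathcal{S}_{\varphi,\lambda}$ by $(\beta_1,\beta_2)\mapsto(\beta_1\circ\eta,\beta_2\circ\eta)$. Here $\mathcal{S}_{\varphi,\lambda}$ is an infinite dimensional vector space (regarded as an additive group), and $(\beta_1,\beta_2)\in\mathcal{S}_{\varphi,\lambda}$ corresponds to the automorphism of $R$ induced by $(z_1,z_2,x)\mapsto(z_1+\beta_1(x),z_2+\beta_2(x),x)$.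
   Context: Setting. $\tilde R=(\mathbb{C}^2\times[0,\infty))\setminus\{(O,0)\}$ carries the foliation $\tilde{\mathcal F}$ with leaves $\mathbb{C}^2\times\{x\}$ ($x>0$) and $\tilde H=(\mathbb{C}^2\setminus\{O\})\times\{0\}$, with the standard complex structure on leaves. For $G(z_1,z_2)=(\lambda z_1+\tau z_2^p,\mu z_2)$ with $p$ a positive integer, $\lambda,\mu,\tau\in\mathbb{C}$, $|\lambda|\ge|\mu|>1$, $(\lambda-\mu^p)\tau=0$, put $T=G\times\varphi$. The quotient $R=\tilde R/T^{\mathbb{Z}}$ with the induced foliation $\mathcal F$ and leafwise complex structure $J$ is called an LC Reeb component; its boundary leaf $H=(\mathbb{C}^2\setminus\{O\})/G^{\mathbb{Z}}$ is a primary Hopf surface. A leafwise holomorphic smooth automorphism is a smooth diffeomorphism preserving the foliation and mapping leaves biholomorphically to leaves; $\mathrm{Aut}\,R$ is the group of these for $(R,\mathcal F,J)$, and $\mathrm{Aut}(R,H)$ is the subgroup of elements restricting to the identity on $H$ (the kernel of the restriction map $\mathrm{Aut}\,R\to\mathrm{Aut}\,H$). Each $f\in\mathrm{Aut}(R,H)$ has a unique lift to a leafwise holomorphic smooth automorphism of $\tilde R$ commuting with $T$ and equal to the identity on $\tilde H$; this lift has the form $(\xi_1(z_1,z_2,x),\xi_2(z_1,z_2,x),\eta(x))$, and $P(f)=\eta$. $Z_\varphi$ is the centralizer of $\varphi$ in $\mathrm{Diff}^\infty([0,\infty))$. $\mathcal{S}_{\varphi,\lambda}$ is the vector space of pairs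 $(\beta_1,\beta_2)$ of functions in $C^\infty([0,\infty);\mathbb{C})$ with $\beta_1(\varphi(x))=\lambda\beta_1(x)+\beta_2(x)$ and $\beta_2(\varphi(x))=\lambda\beta_2(x)$ for all $x$ (equivalently, smooth solutions on $(0,\infty)$, all of which extend smoothly and flatly to $0$). Since $\beta\mapsto\beta\circ\eta$ is a right action, the semidirect product is formed with the multiplication $(\beta,\eta)(\beta',\eta')=(\beta'+\beta\circ\eta',\,\eta\circ\eta')$. *)

theory Defs
  imports "HOL-Analysis.Analysis" "HOL-Algebra.Bij" "HOL-Algebra.Coset"
    "HOL-Library.Function_Algebras"
begin

section \<open>Smooth and holomorphic maps\<close>

text \<open>
  On an open set \<open>U\<close>, \<open>Ck_on k U f\<close> says that \<open>f\<close> is of class \<open>C^k\<close>: all iterated directional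
  derivatives up to order \<open>k\<close> exist and are continuous.
\<close>

primrec Ck_on :: "nat \<Rightarrow> 'a::euclidean_space set \<Rightarrow> ('a \<Rightarrow> 'b::real_normed_vector) \<Rightarrow> bool" where
  "Ck_on 0 U f \<longleftrightarrow> continuous_on U f"
| "Ck_on (Suc k) U f \<longleftrightarrow>
     (\<forall>x\<in>U. f differentiable (at x)) \<and> (\<forall>v. Ck_on k U (\<lambda>x. frechet_derivative f (at x) v))"

text \<open>
  Smoothness on an arbitrary subset of a Euclidean space is, as usual for manifolds with boundary,
  the local existence of smooth extensions to open sets.
\<close>

definition smooth_on :: "'a::euclidean_space set \<Rightarrow> ('a \<Rightarrow> 'b::real_normed_vector) \<Rightarrow> bool" where
  "smooth_on A f \<longleftrightarrow>
     (\<forall>a\<in>A. \<exists>U g. open U \<and> a \<in> U \<and> (\<forall>k. Ck_on k U g) \<and> (\<forall>y\<in>A \<inter> U. g y = f y))"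

text \<open>Holomorphic maps in two variables: the real derivative exists and is complex linear.\<close>

definition holomorphic2_on ::
    "(complex \<times> complex \<Rightarrow> complex \<times> complex) \<Rightarrow> (complex \<times> complex) set \<Rightarrow> bool" where
  "holomorphic2_on h U \<longleftrightarrow>
     (\<forall>z\<in>U. \<exists>D. (h has_derivative D) (at z) \<and>
        (\<forall>c v. D (c * fst v, c * snd v) = (c * fst (D v), c * snd (D v))))"


section \<open>Diffeomorphisms of the half line\<close>

text \<open>
  Elements of groups of bijections of a set are extensional functions, as in \<open>BijGroup\<close>:
  they take the value \<open>undefined\<close> outside the set.
\<close>

definition Diff_half :: "(real \<Rightarrow> real) monoid" where
  "Diff_half = BijGroup {0..}
     \<lparr>carrier := {f \<in> Bij {0..}. smooth_on {0..} f \<and> smooth_on {0..} (inv_into {0..} f)}\<rparr>"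

definition Z_centralizer :: "(real \<Rightarrow> real) \<Rightarrow> (real \<Rightarrow> real) monoid" where
  "Z_centralizer \<phi> = Diff_half
     \<lparr>carrier := {\<eta> \<in> carrier Diff_half. \<eta> \<otimes>\<^bsub>Diff_half\<^esub> \<phi> = \<phi> \<otimes>\<^bsub>Diff_half\<^esub> \<eta>}\<rparr>"

text \<open>The derivative of a function on the half line, one-sided at the boundary point.\<close>

definition half_deriv :: "(real \<Rightarrow> real) \<Rightarrow> real \<Rightarrow> real" where
  "half_deriv f x = vector_derivative f (at x within {0..})"

definition tangent_id_infinite_order :: "(real \<Rightarrow> real) \<Rightarrow> bool" where
  "tangent_id_infinite_order \<phi> \<longleftrightarrow> (\<forall>k. (half_deriv ^^ k) (\<lambda>x. \<phi> x - x) 0 = 0)"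


section \<open>The foliated manifold and its quotient\<close>

type_synonym point = "(complex \<times> complex) \<times> real"

definition Rtilde :: "point set" where
  "Rtilde = (UNIV \<times> {0..}) - {((0, 0), 0)}"

definition leaf_tilde :: "real \<Rightarrow> point set" where
  "leaf_tilde x = {u \<in> Rtilde. snd u = x}"

definition LC_T ::
    "complex \<Rightarrow> complex \<Rightarrow> complex \<Rightarrow> nat \<Rightarrow> (real \<Rightarrow> real) \<Rightarrow> point \<Rightarrow> point" where
  "LC_T lam \<mu> \<tau> p \<phi> = (\<lambda>((z1, z2), x). ((lam * z1 + \<tau> * z2 ^ p, \<mu> * z2), \<phi> x))"

text \<open>
  The projection to the quotient, sending a point to its orbit. As \<open>T\<close> is a bijection of
  \<open>Rtilde\<close>, \<open>v = T\<^sup>-\<^sup>n u\<close> is expressed as \<open>u = T\<^sup>n v\<close>.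
\<close>

definition orbit :: "(point \<Rightarrow> point) \<Rightarrow> point \<Rightarrow> point set" where
  "orbit T u = {v \<in> Rtilde. \<exists>n::nat. v = (T ^^ n) u \<or> u = (T ^^ n) v}"

text \<open>
  In the following, \<open>\<pi>\<close> is a projection from \<open>Rtilde\<close> onto \<open>X = \<pi> ` Rtilde\<close> which is to be a
  covering map preserving the foliations; it is used with \<open>\<pi> = id\<close> (so \<open>X = Rtilde\<close>) and
  with \<open>\<pi> = orbit T\<close> (so \<open>X = R\<close>). The charts of \<open>X\<close> are the local inverses of \<open>\<pi>\<close>; the leaves
  of \<open>X\<close> are the images of the sets \<open>leaf_tilde x\<close>, and the charts of their complex structures are
  the local inverses of the maps \<open>z \<mapsto> \<pi> (z, x)\<close>. Thus a map \<open>f\<close> is smooth (holomorphic on a leaf)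
  iff it is given by smooth (holomorphic) maps in such charts.
\<close>

definition smooth_map :: "(point \<Rightarrow> 'x) \<Rightarrow> ('x \<Rightarrow> 'x) \<Rightarrow> bool" where
  "smooth_map \<pi> f \<longleftrightarrow>
     (\<forall>u\<in>Rtilde. \<forall>v\<in>Rtilde. \<pi> v = f (\<pi> u) \<longrightarrow>
        (\<exists>U F. open U \<and> u \<in> U \<and> smooth_on (U \<inter> Rtilde) F \<and> F u = v \<and>
           (\<forall>u'\<in>U \<inter> Rtilde. F u' \<in> Rtilde \<and> \<pi> (F u') = f (\<pi> u'))))"

definition leaves :: "(point \<Rightarrow> 'x) \<Rightarrow> 'x set set" where
  "leaves \<pi> = {\<pi> ` leaf_tilde x | x. x \<ge> 0}"

definition holomorphic_on_leaf :: "(point \<Rightarrow> 'x) \<Rightarrow> ('x \<Rightarrow> 'x) \<Rightarrow> 'x set \<Rightarrow> bool" where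
  "holomorphic_on_leaf \<pi> f L \<longleftrightarrow>
     (\<forall>z x w y. (z, x) \<in> Rtilde \<longrightarrow> (w, y) \<in> Rtilde \<longrightarrow> \<pi> (z, x) \<in> L \<longrightarrow>
        \<pi> (w, y) = f (\<pi> (z, x)) \<longrightarrow>
        (\<exists>U h. open U \<and> z \<in> U \<and> holomorphic2_on h U \<and> h z = w \<and>
           (\<forall>z'\<in>U. (z', x) \<in> Rtilde \<and> (h z', y) \<in> Rtilde \<and> \<pi> (h z', y) = f (\<pi> (z', x)))))"

text \<open>Leafwise holomorphic smooth automorphisms.\<close>

definition Aut_fol :: "(point \<Rightarrow> 'x) \<Rightarrow> ('x \<Rightarrow> 'x) monoid" where
  "Aut_fol \<pi> = BijGroup (\<pi> ` Rtilde)
     \<lparr>carrier := {f \<in> Bij (\<pi> ` Rtilde).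
        smooth_map \<pi> f \<and> smooth_map \<pi> (inv_into (\<pi> ` Rtilde) f) \<and>
        (\<forall>L\<in>leaves \<pi>. f ` L \<in> leaves \<pi> \<and> holomorphic_on_leaf \<pi> f L \<and>
           holomorphic_on_leaf \<pi> (inv_into (\<pi> ` Rtilde) f) (f ` L))}\<rparr>"

abbreviation Aut_R :: "(point \<Rightarrow> point) \<Rightarrow> (point set \<Rightarrow> point set) monoid" where
  "Aut_R T \<equiv> Aut_fol (orbit T)"

definition boundary_leaf :: "(point \<Rightarrow> point) \<Rightarrow> point set set" where
  "boundary_leaf T = orbit T ` leaf_tilde 0"

definition Aut_RH :: "(point \<Rightarrow> point) \<Rightarrow> (point set \<Rightarrow> point set) monoid" where
  "Aut_RH T = Aut_R T
     \<lparr>carrier := {f \<in> carrier (Aut_R T). \<forall>q\<in>boundary_leaf T. f q = q}\<rparr>"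


section \<open>The homomorphism to the centralizer\<close>

definition is_lift :: "(point \<Rightarrow> point) \<Rightarrow> (point set \<Rightarrow> point set) \<Rightarrow> (point \<Rightarrow> point) \<Rightarrow> bool" where
  "is_lift T f F \<longleftrightarrow> F \<in> carrier (Aut_fol id) \<and>
     (\<forall>u\<in>Rtilde. orbit T (F u) = f (orbit T u)) \<and>
     (\<forall>u\<in>Rtilde. F (T u) = T (F u)) \<and>
     (\<forall>u\<in>leaf_tilde 0. F u = u)"

definition the_lift :: "(point \<Rightarrow> point) \<Rightarrow> (point set \<Rightarrow> point set) \<Rightarrow> (point \<Rightarrow> point)" where
  "the_lift T f = (THE F. is_lift T f F)"

definition P_hom :: "(point \<Rightarrow> point) \<Rightarrow> (point set \<Rightarrow> point set) \<Rightarrow> (real \<Rightarrow> real)" where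
  "P_hom T f = (THE \<eta>. \<eta> \<in> extensional {0..} \<and> (\<forall>u\<in>Rtilde. snd (the_lift T f u) = \<eta> (snd u)))"


section \<open>The space of solutions\<close>

text \<open>
  Functions on the half line are represented by functions on the real line vanishing on negative
  numbers (no regularity across \<open>0\<close> is implied), so that pointwise addition and scalar
  multiplication are those of the function type.
\<close>

definition S_space :: "(real \<Rightarrow> real) \<Rightarrow> complex \<Rightarrow> ((real \<Rightarrow> complex) \<times> (real \<Rightarrow> complex)) set" where
  "S_space \<phi> lam = {(\<beta>1, \<beta>2).
     smooth_on {0..} \<beta>1 \<and> smooth_on {0..} \<beta>2 \<and> (\<forall>x<0. \<beta>1 x = 0 \<and> \<beta>2 x = 0) \<and>
     (\<forall>x\<ge>0. \<beta>1 (\<phi> x) = lam * \<beta>1 x + \<beta>2 x \<and> \<beta>2 (\<phi> x) = lam * \<beta>2 x)}"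

definition S_group :: "(real \<Rightarrow> real) \<Rightarrow> complex \<Rightarrow> ((real \<Rightarrow> complex) \<times> (real \<Rightarrow> complex)) monoid" where
  "S_group \<phi> lam = \<lparr>carrier = S_space \<phi> lam, mult = (+), one = 0\<rparr>"

definition pair_scale ::
    "complex \<Rightarrow> (real \<Rightarrow> complex) \<times> (real \<Rightarrow> complex) \<Rightarrow> (real \<Rightarrow> complex) \<times> (real \<Rightarrow> complex)" where
  "pair_scale c \<beta> = (\<lambda>x. c * fst \<beta> x, \<lambda>x. c * snd \<beta> x)"

interpretation pairs: vector_space pair_scale
  by standard (auto simp: pair_scale_def fun_eq_iff algebra_simps plus_prod_def)

definition infinite_dimensional_subspace ::
    "((real \<Rightarrow> complex) \<times> (real \<Rightarrow> complex)) set \<Rightarrow> bool" where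
  "infinite_dimensional_subspace V \<longleftrightarrow>
     pairs.subspace V \<and> \<not> (\<exists>B. finite B \<and> B \<subseteq> V \<and> pairs.span B = V)"

definition S_act ::
    "(real \<Rightarrow> real) \<Rightarrow> (real \<Rightarrow> complex) \<times> (real \<Rightarrow> complex) \<Rightarrow> (real \<Rightarrow> complex) \<times> (real \<Rightarrow> complex)" where
  "S_act \<eta> \<beta> = (\<lambda>x. if 0 \<le> x then fst \<beta> (\<eta> x) else 0, \<lambda>x. if 0 \<le> x then snd \<beta> (\<eta> x) else 0)"

text \<open>The action is a right action, which dictates the form of the multiplication.\<close>

definition S_semidirect_Z :: "(real \<Rightarrow> real) \<Rightarrow> complex \<Rightarrow>
    (((real \<Rightarrow> complex) \<times> (real \<Rightarrow> complex)) \<times> (real \<Rightarrow> real)) monoid" where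
  "S_semidirect_Z \<phi> lam =
     \<lparr>carrier = S_space \<phi> lam \<times> carrier (Z_centralizer \<phi>),
      mult = (\<lambda>(\<beta>, \<eta>) (\<beta>', \<eta>'). (\<beta>' + S_act \<eta>' \<beta>, \<eta> \<otimes>\<^bsub>Z_centralizer \<phi>\<^esub> \<eta>')),
      one = (0, \<one>\<^bsub>Z_centralizer \<phi>\<^esub>)\<rparr>"

definition translation :: "(real \<Rightarrow> complex) \<times> (real \<Rightarrow> complex) \<Rightarrow> point \<Rightarrow> point" where
  "translation \<beta> = (\<lambda>((z1, z2), x). ((z1 + fst \<beta> x, z2 + snd \<beta> x), x))"

text \<open>
  The map of the quotient induced by a bijection \<open>B\<close> of \<open>Rtilde\<close> commuting with \<open>T\<close>: the image
  under \<open>B\<close> of the orbit of \<open>u\<close> is then the orbit of \<open>B u\<close>.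
\<close>

definition induced :: "(point \<Rightarrow> point) \<Rightarrow> (point \<Rightarrow> point) \<Rightarrow> point set \<Rightarrow> point set" where
  "induced T B = (\<lambda>q\<in>orbit T ` Rtilde. B ` q)"


section \<open>Short exact sequences of groups\<close>

text \<open>The library's \<open>exact_seq\<close> requires all groups to have the same element type.\<close>

definition short_exact ::
    "'a monoid \<Rightarrow> ('a \<Rightarrow> 'b) \<Rightarrow> 'b monoid \<Rightarrow> ('b \<Rightarrow> 'c) \<Rightarrow> 'c monoid \<Rightarrow> bool" where
  "short_exact A i B p C \<longleftrightarrow>
     group_hom A B i \<and> group_hom B C p \<and> inj_on i (carrier A) \<and>
     i ` carrier A = kernel B C p \<and> p ` carrier B = carrier C"

end

theory Submission
  imports Defs "HOL-Complex_Analysis.Complex_Analysis" "HOL-Real_Asymp.Real_Asymp"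
begin

text \<open>
  The covering \<open>Rtilde\<close> of \<open>R\<close> is starlike, hence simply connected, and \<open>T\<close> acts on it freely and properly
  discontinuously. So every automorphism of \<open>R\<close> that fixes the boundary leaf has exactly one lift \<open>F\<close> to
  \<open>Rtilde\<close> that is the identity on the boundary leaf, and \<open>F\<close> commutes with \<open>T\<close>
  (\<open>normalised_lift_exists\<close>, \<open>normalised_lift_unique\<close>). Being holomorphic on leaves, \<open>F\<close> has the form
  \<open>F (z, x) = (\<xi>(z, x), \<eta> x)\<close>.

  The heart of the matter is that \<open>\<xi>(z, x) = z + \<beta> x\<close>. Let \<open>G\<close> be the linear map of the leaf coordinate in \<open>T\<close>,
  a Jordan block with eigenvalue \<open>\<lambda>\<close>, and \<open>\<psi>\<close> the inverse of \<open>\<phi>\<close>. Then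
  \<open>\<xi>(z, x) = G\<^sup>n \<xi>(G\<^sup>-\<^sup>n z, \<psi>\<^sup>n x)\<close>, and \<open>\<psi>\<^sup>n x \<rightarrow> 0\<close>. Near the boundary leaf \<open>\<xi>\<close> is bounded on the unit
  sphere, so the entire function \<open>\<xi>(\<cdot>, x)\<close> grows only a little faster than \<open>|z|\<close> and is affine by the Cauchy
  estimates (\<open>affine_on_leaf\<close>). Its linear part \<open>D\<close> has conjugates \<open>G\<^sup>-\<^sup>n D G\<^sup>n\<close> that are polynomial in \<open>n\<close>
  and converge to the identity, because \<open>F\<close> is continuous and is the identity on the boundary leaf; hence \<open>D\<close> is
  the identity (\<open>translation_on_leaf\<close>). Commutation with \<open>T\<close> now says that \<open>\<beta>\<close> solves the functional equations
  of \<open>S_space\<close> and that \<open>\<eta>\<close> commutes with \<open>\<phi>\<close>.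

  Conversely, a solution \<open>\<beta>\<close> vanishes at \<open>0\<close>, so each pair \<open>(\<beta>, \<eta>)\<close> with \<open>\<eta>\<close> in the centralizer gives an
  automorphism, and composition is the multiplication of the semidirect product. This identifies \<open>Aut(R, H)\<close>
  with the semidirect product (\<open>skew_aut_iso\<close>), and the exact sequence is the obvious one.

  That there are many solutions is shown for \<open>\<beta>\<^sub>2 = 0\<close>: a bump function \<open>h\<close> with support in the fundamental domain
  \<open>[1, \<phi> 1]\<close> of \<open>\<phi>\<close> yields the solution \<open>\<beta>\<^sub>1(x) = \<Sum>\<^sub>n \<lambda>\<^sup>-\<^sup>n h(\<phi>\<^sup>n x)\<close> of \<open>\<beta>\<^sub>1 \<circ> \<phi> = \<lambda> \<beta>\<^sub>1\<close> on \<open>(0, \<infinity>)\<close>. It is flat at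
  \<open>0\<close>: each derivative of \<open>\<beta>\<^sub>1\<close> solves an equation of the same kind up to lower order terms, and near \<open>0\<close>, where
  \<open>\<phi>'\<close> is close to \<open>1\<close>, one backward step along an orbit of \<open>\<phi>\<close> contracts it by nearly \<open>1 / |\<lambda>|\<close>
  (\<open>Ck_on_flat_extension\<close>).
\<close>

section \<open>Calculus of maps of class C^k\<close>

lemma Ck_on_cong_imp:
  assumes "open U" "\<And>x. x \<in> U \<Longrightarrow> f x = g x" "Ck_on k U f"
  shows "Ck_on k U g"
  using assms
proof (induction k arbitrary: f g)
  case 0
  then show ?case using continuous_on_cong by auto
next
  case (Suc k)
  have der: "(g has_derivative frechet_derivative f (at x)) (at x)" if "x \<in> U" for x
  proof (rule has_derivative_transform_within_open[OF _ Suc.prems(1) that])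
    show "(f has_derivative frechet_derivative f (at x)) (at x)"
      using Suc.prems(3) that by (simp add: frechet_derivative_works[symmetric])
  qed (use Suc.prems in auto)
  then have "frechet_derivative g (at x) = frechet_derivative f (at x)" if "x \<in> U" for x
    using frechet_derivative_at that by metis
  moreover have "Ck_on k U (\<lambda>x. frechet_derivative f (at x) v)" for v
    using Suc.prems(3) by simp
  ultimately have "Ck_on k U (\<lambda>x. frechet_derivative g (at x) v)" for v
    using Suc.IH[OF Suc.prems(1)] by (metis (no_types, lifting))
  then show ?case
    using der by (auto simp: differentiable_def)
qed

lemma Ck_on_SucI:
  assumes "open U"
    and "\<And>x. x \<in> U \<Longrightarrow> (f has_derivative f' x) (at x)"
    and "\<And>v. Ck_on k U (\<lambda>x. f' x v)"
  shows "Ck_on (Suc k) U f"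
proof -
  have "f' x v = frechet_derivative f (at x) v" if "x \<in> U" for x v
    using assms(2)[OF that] frechet_derivative_at by metis
  then have "Ck_on k U (\<lambda>x. frechet_derivative f (at x) v)" for v
    using Ck_on_cong_imp[OF assms(1) _ assms(3)[of v]] by auto
  then show ?thesis
    using assms(2) by (auto simp: differentiable_def)
qed

lemma Ck_on_Suc_has_derivative:
  assumes "Ck_on (Suc k) U f" "x \<in> U"
  shows "(f has_derivative frechet_derivative f (at x)) (at x)"
  using assms by (simp add: frechet_derivative_works[symmetric])

lemma Ck_on_subset: "Ck_on k U f \<Longrightarrow> V \<subseteq> U \<Longrightarrow> Ck_on k V f"
  by (induction k arbitrary: f) (auto intro: continuous_on_subset)

lemma Ck_on_imp_continuous_on: "Ck_on k U f \<Longrightarrow> continuous_on U f"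
  by (cases k) (auto intro!: continuous_at_imp_continuous_on differentiable_imp_continuous_within)

lemma Ck_on_SucD: "Ck_on (Suc k) U f \<Longrightarrow> Ck_on k U f"
proof (induction k arbitrary: f)
  case 0
  then show ?case using Ck_on_imp_continuous_on[of "Suc 0"] by simp
next
  case (Suc k)
  then show ?case by (metis Ck_on.simps(2))
qed

lemma Ck_on_Union:
  assumes "\<And>U. U \<in> \<U> \<Longrightarrow> open U" "\<And>U. U \<in> \<U> \<Longrightarrow> Ck_on k U f"
  shows "Ck_on k (\<Union>\<U>) f"
  using assms(2)
proof (induction k arbitrary: f)
  case 0
  then show ?case using assms(1) continuous_on_open_Union[of \<U> f] by simp
qed auto

lemma Ck_on_local:
  assumes "\<And>x. x \<in> U \<Longrightarrow> \<exists>V. open V \<and> x \<in> V \<and> Ck_on k V f"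
  shows "Ck_on k U f"
  by (rule Ck_on_subset[OF Ck_on_Union[of "{V. open V \<and> Ck_on k V f}"]]) (use assms in blast)+

lemma Ck_on_const: "open U \<Longrightarrow> Ck_on k U (\<lambda>x. c)"
proof (induction k arbitrary: c)
  case (Suc k)
  show ?case by (rule Ck_on_SucI[where f'="\<lambda>x v. 0"]) (use Suc in auto)
qed simp

lemma Ck_on_bounded_linear_compose:
  assumes L: "bounded_linear L" and U: "open U"
  shows "Ck_on k U f \<Longrightarrow> Ck_on k U (\<lambda>x. L (f x))"
proof (induction k arbitrary: f)
  case 0
  then show ?case using L by (simp add: linear_continuous_on_compose bounded_linear.linear bounded_linear.continuous_on)
next
  case (Suc k)
  show ?case
  proof (rule Ck_on_SucI[OF U])
    show "((\<lambda>x. L (f x)) has_derivative (\<lambda>v. L (frechet_derivative f (at x) v))) (at x)"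
      if "x \<in> U" for x
      using bounded_linear.has_derivative[OF L Ck_on_Suc_has_derivative[OF Suc.prems that]] .
  qed (use Suc in auto)
qed

lemma Ck_on_add:
  assumes U: "open U"
  shows "Ck_on k U f \<Longrightarrow> Ck_on k U g \<Longrightarrow> Ck_on k U (\<lambda>x. f x + g x)"
proof (induction k arbitrary: f g)
  case (Suc k)
  show ?case
  proof (rule Ck_on_SucI[OF U])
    show "((\<lambda>x. f x + g x) has_derivative
        (\<lambda>v. frechet_derivative f (at x) v + frechet_derivative g (at x) v)) (at x)"
      if "x \<in> U" for x
      by (intro has_derivative_add Ck_on_Suc_has_derivative) (use Suc.prems that in auto)
  qed (use Suc in auto)
qed (simp add: continuous_on_add)

lemma Ck_on_sum:
  assumes "open U" "\<And>i. i \<in> I \<Longrightarrow> Ck_on k U (f i)"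
  shows "Ck_on k U (\<lambda>x. \<Sum>i\<in>I. f i x)"
  using assms(2)
  by (induction I rule: infinite_finite_induct) (auto intro!: Ck_on_const Ck_on_add assms(1))

lemma Ck_on_bilinear:
  assumes B: "bounded_bilinear B" and U: "open U"
  shows "Ck_on k U f \<Longrightarrow> Ck_on k U g \<Longrightarrow> Ck_on k U (\<lambda>x. B (f x) (g x))"
proof (induction k arbitrary: f g)
  case 0
  then show ?case using bounded_bilinear.continuous_on[OF B] by simp
next
  case (Suc k)
  show ?case
  proof (rule Ck_on_SucI[OF U])
    show "((\<lambda>x. B (f x) (g x)) has_derivative
        (\<lambda>v. B (f x) (frechet_derivative g (at x) v) + B (frechet_derivative f (at x) v) (g x))) (at x)"
      if "x \<in> U" for x
      by (intro bounded_bilinear.FDERIV[OF B] Ck_on_Suc_has_derivative) (use Suc.prems that in auto)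
    show "Ck_on k U (\<lambda>x. B (f x) (frechet_derivative g (at x) v) + B (frechet_derivative f (at x) v) (g x))" for v
      by (intro Ck_on_add[OF U] Suc.IH Ck_on_SucD[OF Suc.prems(1)] Ck_on_SucD[OF Suc.prems(2)])
         (use Suc.prems in auto)
  qed
qed

lemma Ck_on_bounded_linear:
  assumes "bounded_linear L" "open U"
  shows "Ck_on k U L"
proof (cases k)
  case 0
  then show ?thesis using assms by (simp add: linear_continuous_on)
next
  case (Suc n)
  show ?thesis unfolding Suc
    by (rule Ck_on_SucI[where f'="\<lambda>x. L"])
       (use assms in \<open>auto intro: bounded_linear_imp_has_derivative Ck_on_const\<close>)
qed

text \<open>
  The outer function has a single real variable, so that its derivative in the direction \<open>t\<close> is
  \<open>t\<close> times its derivative in the direction \<open>1\<close>; this makes the induction on \<open>k\<close> go through with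
  the product rule alone.
\<close>

lemma Ck_on_compose:
  fixes f :: "real \<Rightarrow> 'b::real_normed_vector" and g :: "'a::euclidean_space \<Rightarrow> real"
  assumes U: "open U" and V: "open V" and gV: "g ` U \<subseteq> V"
  shows "Ck_on k V f \<Longrightarrow> Ck_on k U g \<Longrightarrow> Ck_on k U (\<lambda>x. f (g x))"
proof (induction k arbitrary: f)
  case 0
  then show ?case using continuous_on_compose2 gV by auto
next
  case (Suc k)
  show ?case
  proof (rule Ck_on_SucI[OF U])
    show "((\<lambda>x. f (g x)) has_derivative
        (\<lambda>v. frechet_derivative g (at x) v *\<^sub>R frechet_derivative f (at (g x)) 1)) (at x)"
      if "x \<in> U" for x
    proof -
      have df: "(f has_derivative frechet_derivative f (at (g x))) (at (g x))"
        using Suc.prems(1) that gV by (intro Ck_on_Suc_has_derivative) auto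
      have eq: "(\<lambda>v. frechet_derivative g (at x) v *\<^sub>R frechet_derivative f (at (g x)) 1) =
          (\<lambda>v. frechet_derivative f (at (g x)) (frechet_derivative g (at x) v))"
        by (simp only: linear_scale[OF has_derivative_linear[OF df], symmetric] real_scaleR_def mult_1_right)
      show ?thesis
        unfolding eq by (rule has_derivative_compose[OF Ck_on_Suc_has_derivative[OF Suc.prems(2) that] df])
    qed
    show "Ck_on k U (\<lambda>x. frechet_derivative g (at x) v *\<^sub>R frechet_derivative f (at (g x)) 1)" for v
    proof (intro Ck_on_bilinear[OF bounded_bilinear_scaleR U])
      show "Ck_on k U (\<lambda>x. frechet_derivative f (at (g x)) 1)"
        by (rule Suc.IH) (use Suc.prems Ck_on_SucD in auto)
    qed (use Suc.prems in auto)
  qed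
qed

lemma Ck_on_affine_compose:
  assumes L: "bounded_linear L" and U: "open U" and V: "open V" and "(\<lambda>x. c + L x) ` U \<subseteq> V"
  shows "Ck_on k V f \<Longrightarrow> Ck_on k U (\<lambda>x. f (c + L x))"
proof (induction k arbitrary: f)
  case 0
  have "continuous_on U (\<lambda>x. c + L x)"
    by (intro continuous_intros linear_continuous_on L)
  then show ?case using 0 continuous_on_compose2 assms(4) by auto
next
  case (Suc k)
  show ?case
  proof (rule Ck_on_SucI[OF U])
    show "((\<lambda>x. f (c + L x)) has_derivative (\<lambda>v. frechet_derivative f (at (c + L x)) (L v))) (at x)"
      if "x \<in> U" for x
    proof (rule has_derivative_compose[of "\<lambda>x. c + L x" L])
      show "((\<lambda>x. c + L x) has_derivative L) (at x)"
        using has_derivative_add[OF has_derivative_const[of c] bounded_linear_imp_has_derivative[OF L]]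
        by simp
    qed (rule Ck_on_Suc_has_derivative[OF Suc.prems], use assms(4) that in auto)
  qed (use Suc in auto)
qed


lemma Ck_on_Suc_real:
  fixes f :: "real \<Rightarrow> 'b::real_normed_vector"
  assumes U: "open U" and der: "\<And>x. x \<in> U \<Longrightarrow> (f has_vector_derivative f' x) (at x)"
    and "Ck_on k U f'"
  shows "Ck_on (Suc k) U f"
  by (rule Ck_on_SucI[OF U, of f "\<lambda>x t. t *\<^sub>R f' x"])
    (use der assms(3) Ck_on_bounded_linear_compose[OF bounded_linear_scaleR_right U] in
      \<open>auto simp: has_vector_derivative_def\<close>)

lemma Ck_on_Suc_has_vector_derivative:
  fixes f :: "real \<Rightarrow> 'b::real_normed_vector"
  assumes "Ck_on (Suc k) U f" "x \<in> U"
  shows "(f has_vector_derivative frechet_derivative f (at x) 1) (at x)"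
proof -
  have der: "(f has_derivative frechet_derivative f (at x)) (at x)"
    using assms by (rule Ck_on_Suc_has_derivative)
  have "frechet_derivative f (at x) = (\<lambda>t. t *\<^sub>R frechet_derivative f (at x) 1)"
    by (simp only: linear_scale[OF has_derivative_linear[OF der], symmetric] real_scaleR_def mult_1_right)
  then show ?thesis
    using der unfolding has_vector_derivative_def by argo
qed

section \<open>Smoothness on subsets\<close>

lemma smooth_onE:
  assumes "smooth_on A f" "a \<in> A"
  obtains U g where "open U" "a \<in> U" "\<forall>k. Ck_on k U g" "\<forall>y. y \<in> A \<longrightarrow> y \<in> U \<longrightarrow> g y = f y"
proof -
  have "\<exists>U g. open U \<and> a \<in> U \<and> (\<forall>k. Ck_on k U g) \<and> (\<forall>y\<in>A \<inter> U. g y = f y)"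
    using assms unfolding smooth_on_def by (rule bspec)
  then obtain U g where "open U \<and> a \<in> U \<and> (\<forall>k. Ck_on k U g) \<and> (\<forall>y\<in>A \<inter> U. g y = f y)"
    by (elim exE) (rule that)
  then show thesis
    by (intro that[of U g]) simp_all
qed

lemma smooth_onI_local:
  assumes "\<And>a. a \<in> A \<Longrightarrow>
    \<exists>U g. open U \<and> a \<in> U \<and> (\<forall>k. Ck_on k U g) \<and> (\<forall>y. y \<in> A \<longrightarrow> y \<in> U \<longrightarrow> g y = f y)"
  shows "smooth_on A f"
  using assms unfolding smooth_on_def Ball_def Int_iff imp_conjL by simp

lemma smooth_onI:
  assumes "open U" "A \<subseteq> U" "\<And>k. Ck_on k U f"
  shows "smooth_on A f"
  by (rule smooth_onI_local, rule exI[of _ U], rule exI[of _ f]) (use assms in auto)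

lemma smooth_on_cong:
  assumes "smooth_on A f" "\<And>x. x \<in> A \<Longrightarrow> f x = g x"
  shows "smooth_on A g"
proof (rule smooth_onI_local)
  fix a assume "a \<in> A"
  with assms(1) obtain U h where "open U" "a \<in> U" "\<forall>k. Ck_on k U h" "\<forall>y. y \<in> A \<longrightarrow> y \<in> U \<longrightarrow> h y = f y"
    by (rule smooth_onE) (rule that)
  then show "\<exists>U h. open U \<and> a \<in> U \<and> (\<forall>k. Ck_on k U h) \<and> (\<forall>y. y \<in> A \<longrightarrow> y \<in> U \<longrightarrow> h y = g y)"
    using assms(2) by (intro exI[of _ U] exI[of _ h]) auto
qed

lemma smooth_on_local:
  assumes "\<And>a. a \<in> A \<Longrightarrow> \<exists>U. open U \<and> a \<in> U \<and> smooth_on (A \<inter> U) f"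
  shows "smooth_on A f"
proof (rule smooth_onI_local)
  fix a assume a: "a \<in> A"
  then obtain U where U: "open U" "a \<in> U" "smooth_on (A \<inter> U) f" using assms by blast
  then have "a \<in> A \<inter> U" using a by blast
  with U(3) obtain V g where "open V" "a \<in> V" "\<forall>k. Ck_on k V g"
      "\<forall>y. y \<in> A \<inter> U \<longrightarrow> y \<in> V \<longrightarrow> g y = f y"
    by (rule smooth_onE) (rule that)
  then show "\<exists>U h. open U \<and> a \<in> U \<and> (\<forall>k. Ck_on k U h) \<and> (\<forall>y. y \<in> A \<longrightarrow> y \<in> U \<longrightarrow> h y = f y)"
    using U Ck_on_subset[of _ V g "U \<inter> V"]
    by (intro exI[of _ "U \<inter> V"] exI[of _ g]) auto
qed

lemma smooth_on_subset:
  assumes "smooth_on A f" "B \<subseteq> A"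
  shows "smooth_on B f"
proof (rule smooth_onI_local)
  fix a assume "a \<in> B"
  then have "a \<in> A" using assms(2) by blast
  with assms(1) obtain U g where "open U" "a \<in> U" "\<forall>k. Ck_on k U g" "\<forall>y. y \<in> A \<longrightarrow> y \<in> U \<longrightarrow> g y = f y"
    by (rule smooth_onE) (rule that)
  then show "\<exists>U g. open U \<and> a \<in> U \<and> (\<forall>k. Ck_on k U g) \<and> (\<forall>y. y \<in> B \<longrightarrow> y \<in> U \<longrightarrow> g y = f y)"
    using assms(2) by (intro exI[of _ U] exI[of _ g]) auto
qed

lemma smooth_on_imp_continuous_on:
  assumes "smooth_on A f"
  shows "continuous_on A f"
  unfolding continuous_on_eq_continuous_within
proof
  fix a assume a: "a \<in> A"
  with assms obtain U g where U: "open U" "a \<in> U" "\<forall>k. Ck_on k U g"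
      "\<forall>y. y \<in> A \<longrightarrow> y \<in> U \<longrightarrow> g y = f y"
    by (rule smooth_onE) (rule that)
  have "continuous_on U g" using U(3)[rule_format] by (rule Ck_on_imp_continuous_on)
  then have "continuous (at a) g" using U by (simp add: continuous_on_eq_continuous_at)
  then have "continuous (at a within A) g" by (rule continuous_at_imp_continuous_at_within)
  then show "continuous (at a within A) f"
  proof (rule continuous_transform_within_openin[of _ _ _ "A \<inter> U"])
    show "openin (top_of_set A) (A \<inter> U)" using U(1) by (simp add: openin_open_Int)
  qed (use a U in auto)
qed

lemma smooth_on_bounded_linear_compose:
  assumes "smooth_on A f" "bounded_linear L"
  shows "smooth_on A (\<lambda>x. L (f x))"
proof (rule smooth_onI_local)
  fix a assume "a \<in> A"
  with assms(1) obtain U g where "open U" "a \<in> U" "\<forall>k. Ck_on k U g"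
      "\<forall>y. y \<in> A \<longrightarrow> y \<in> U \<longrightarrow> g y = f y"
    by (rule smooth_onE) (rule that)
  then show "\<exists>U g. open U \<and> a \<in> U \<and> (\<forall>k. Ck_on k U g) \<and> (\<forall>y. y \<in> A \<longrightarrow> y \<in> U \<longrightarrow> g y = L (f y))"
    using Ck_on_bounded_linear_compose[OF assms(2), of U _ g]
    by (intro exI[of _ U] exI[of _ "\<lambda>x. L (g x)"]) auto
qed

lemma smooth_on_add:
  assumes "smooth_on A f1" "smooth_on A f2"
  shows "smooth_on A (\<lambda>x. f1 x + f2 x)"
proof (rule smooth_onI_local)
  fix a assume a: "a \<in> A"
  obtain U1 g1 where 1: "open U1" "a \<in> U1" "\<forall>k. Ck_on k U1 g1"
      "\<forall>y. y \<in> A \<longrightarrow> y \<in> U1 \<longrightarrow> g1 y = f1 y"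
    using assms(1) a by (rule smooth_onE) (rule that)
  obtain U2 g2 where 2: "open U2" "a \<in> U2" "\<forall>k. Ck_on k U2 g2"
      "\<forall>y. y \<in> A \<longrightarrow> y \<in> U2 \<longrightarrow> g2 y = f2 y"
    using assms(2) a by (rule smooth_onE) (rule that)
  have "Ck_on k (U1 \<inter> U2) (\<lambda>x. g1 x + g2 x)" for k
    by (intro Ck_on_add open_Int 1 2 Ck_on_subset[OF 1(3)[rule_format]] Ck_on_subset[OF 2(3)[rule_format]]) auto
  then show "\<exists>U g. open U \<and> a \<in> U \<and> (\<forall>k. Ck_on k U g) \<and>
      (\<forall>y. y \<in> A \<longrightarrow> y \<in> U \<longrightarrow> g y = f1 y + f2 y)"
    using 1 2 by (intro exI[of _ "U1 \<inter> U2"] exI[of _ "\<lambda>x. g1 x + g2 x"]) auto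
qed

lemma smooth_on_const: "smooth_on A (\<lambda>x. c)"
  by (rule smooth_onI[of UNIV]) (auto intro: Ck_on_const)

lemma smooth_on_bounded_linear: "bounded_linear L \<Longrightarrow> smooth_on A L"
  by (rule smooth_onI[of UNIV]) (auto intro: Ck_on_bounded_linear)

lemma smooth_on_Pair:
  assumes "smooth_on A f" "smooth_on A g"
  shows "smooth_on A (\<lambda>x. (f x, g x))"
proof -
  have "smooth_on A (\<lambda>x. (f x, 0) + (0, g x))"
    using smooth_on_bounded_linear_compose[of A f "\<lambda>y. (y, 0)"]
      smooth_on_bounded_linear_compose[of A g "\<lambda>y. (0, y)"] assms
    by (intro smooth_on_add) (auto simp: bounded_linear_Pair)
  then show ?thesis by simp
qed

lemma smooth_on_compose:
  fixes f :: "real \<Rightarrow> 'b::real_normed_vector" and g :: "'a::euclidean_space \<Rightarrow> real"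
  assumes f: "smooth_on B f" and g: "smooth_on A g" and gB: "g ` A \<subseteq> B"
  shows "smooth_on A (\<lambda>x. f (g x))"
proof (rule smooth_onI_local)
  fix a assume a: "a \<in> A"
  obtain U1 g1 where 1: "open U1" "a \<in> U1" "\<forall>k. Ck_on k U1 g1"
      "\<forall>y. y \<in> A \<longrightarrow> y \<in> U1 \<longrightarrow> g1 y = g y"
    using g a by (rule smooth_onE) (rule that)
  have "g a \<in> B" using gB a by blast
  with f obtain U2 f2 where 2: "open U2" "g a \<in> U2" "\<forall>k. Ck_on k U2 f2"
      "\<forall>y. y \<in> B \<longrightarrow> y \<in> U2 \<longrightarrow> f2 y = f y"
    by (rule smooth_onE) (rule that)
  let ?W = "U1 \<inter> g1 -` U2"
  have "continuous_on U1 g1"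
    using 1(3)[rule_format] by (rule Ck_on_imp_continuous_on)
  then have W: "open ?W"
    using continuous_open_preimage[OF _ 1(1) 2(1)] by simp
  have "Ck_on k ?W (\<lambda>x. f2 (g1 x))" for k
    by (rule Ck_on_compose[OF W 2(1) _ 2(3)[rule_format] Ck_on_subset[OF 1(3)[rule_format]]]) auto
  moreover have "a \<in> ?W" using 1 2 a by auto
  moreover have "f2 (g1 y) = f (g y)" if "y \<in> A" "y \<in> ?W" for y
    using 1(4)[rule_format, of y] 2(4)[rule_format, of "g y"] gB that by auto
  ultimately show "\<exists>U h. open U \<and> a \<in> U \<and> (\<forall>k. Ck_on k U h) \<and>
      (\<forall>y. y \<in> A \<longrightarrow> y \<in> U \<longrightarrow> h y = f (g y))"
    using W by (intro exI[of _ ?W] exI[of _ "\<lambda>x. f2 (g1 x)"] conjI allI impI) simp_all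
qed

lemma smooth_on_affine_compose:
  assumes f: "smooth_on B f" and L: "bounded_linear L" and A: "(\<lambda>x. c + L x) ` A \<subseteq> B"
  shows "smooth_on A (\<lambda>x. f (c + L x))"
proof (rule smooth_onI_local)
  fix a assume "a \<in> A"
  then have "c + L a \<in> B" using A by blast
  with f obtain U g where 1: "open U" "c + L a \<in> U" "\<forall>k. Ck_on k U g"
      "\<forall>y. y \<in> B \<longrightarrow> y \<in> U \<longrightarrow> g y = f y"
    by (rule smooth_onE) (rule that)
  let ?W = "(\<lambda>x. c + L x) -` U"
  have "continuous_on UNIV (\<lambda>x. c + L x)"
    by (intro continuous_intros linear_continuous_on L)
  then have W: "open ?W"
    using 1(1) open_vimage by blast
  have "Ck_on k ?W (\<lambda>x. g (c + L x))" for k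
    by (rule Ck_on_affine_compose[OF L W 1(1) _ 1(3)[rule_format]]) auto
  moreover have "g (c + L y) = f (c + L y)" if "y \<in> A" "y \<in> ?W" for y
    using 1(4)[rule_format, of "c + L y"] A that by auto
  moreover have "a \<in> ?W" using 1(2) by simp
  ultimately show "\<exists>U h. open U \<and> a \<in> U \<and> (\<forall>k. Ck_on k U h) \<and>
      (\<forall>y. y \<in> A \<longrightarrow> y \<in> U \<longrightarrow> h y = f (c + L y))"
    using W by (intro exI[of _ ?W] exI[of _ "\<lambda>x. g (c + L x)"] conjI allI impI) simp_all
qed

lemma smooth_on_imp_Ck_on:
  assumes "smooth_on A f" "open U" "U \<subseteq> A"
  shows "Ck_on k U f"
proof (rule Ck_on_local)
  fix x assume "x \<in> U"
  then have "x \<in> A" using assms(3) by blast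
  with assms(1) obtain V g where V: "open V" "x \<in> V" "\<forall>k. Ck_on k V g" "\<forall>y. y \<in> A \<longrightarrow> y \<in> V \<longrightarrow> g y = f y"
    by (rule smooth_onE) (rule that)
  have "Ck_on k (U \<inter> V) g"
    using Ck_on_subset V(3) by blast
  then have "Ck_on k (U \<inter> V) f"
    by (rule Ck_on_cong_imp[rotated -1]) (use V assms in auto)
  then show "\<exists>V. open V \<and> x \<in> V \<and> Ck_on k V f"
    using V(1,2) assms(2) \<open>x \<in> U\<close> by (intro exI[of _ "U \<inter> V"]) auto
qed

section \<open>Dynamics of the holonomy diffeomorphism\<close>

locale Reeb_data =
  fixes lam :: complex and \<phi> :: "real \<Rightarrow> real"
  assumes lam: "norm lam > 1"
    and phi_Diff: "\<phi> \<in> carrier Diff_half"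
    and phi_gt: "\<And>x. x > 0 \<Longrightarrow> \<phi> x > x"
    and phi_tangent: "tangent_id_infinite_order \<phi>"
begin

definition \<psi> :: "real \<Rightarrow> real" where "\<psi> = inv_into {0..} \<phi>"

lemma lam_nonzero: "lam \<noteq> 0"
  using lam by auto

lemma phi_bij: "bij_betw \<phi> {0..} {0..}"
  and phi_smooth: "smooth_on {0..} \<phi>"
  and psi_smooth: "smooth_on {0..} \<psi>"
  using phi_Diff by (auto simp: Diff_half_def Bij_def \<psi>_def)

lemma phi_nonneg: "x \<ge> 0 \<Longrightarrow> \<phi> x \<ge> 0"
  using phi_bij by (auto simp: bij_betw_def)

lemma psi_nonneg: "x \<ge> 0 \<Longrightarrow> \<psi> x \<ge> 0"
  using bij_betw_inv_into[OF phi_bij] unfolding \<psi>_def by (auto simp: bij_betw_def)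

lemma psi_phi: "x \<ge> 0 \<Longrightarrow> \<psi> (\<phi> x) = x"
  using phi_bij unfolding \<psi>_def by (simp add: bij_betw_inv_into_left)

lemma phi_psi: "x \<ge> 0 \<Longrightarrow> \<phi> (\<psi> x) = x"
  using phi_bij unfolding \<psi>_def by (simp add: bij_betw_inv_into_right)

lemma phi_0: "\<phi> 0 = 0"
proof -
  have "\<psi> 0 \<ge> 0" "\<phi> (\<psi> 0) = 0" using psi_nonneg phi_psi by auto
  then show ?thesis using phi_gt[of "\<psi> 0"] by (cases "\<psi> 0 = 0") auto
qed

lemma phi_pos: "x > 0 \<Longrightarrow> \<phi> x > 0"
  using phi_gt[of x] by linarith

lemma psi_pos: "x > 0 \<Longrightarrow> \<psi> x > 0"
  using psi_nonneg[of x] phi_psi[of x] phi_0 by (cases "\<psi> x = 0") auto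

lemma psi_lt: "x > 0 \<Longrightarrow> \<psi> x < x"
  using phi_gt[OF psi_pos] phi_psi by fastforce

lemma continuous_phi: "continuous_on {0..} \<phi>" and continuous_psi: "continuous_on {0..} \<psi>"
  using phi_smooth psi_smooth smooth_on_imp_continuous_on by blast+

lemma phi_strict_mono:
  assumes "0 \<le> x" "x < y"
  shows "\<phi> x < \<phi> y"
proof (rule ccontr)
  assume "\<not> \<phi> x < \<phi> y"
  then have le: "\<phi> y \<le> \<phi> x" by simp
  have "continuous_on {0..x} \<phi>" using continuous_phi by (rule continuous_on_subset) auto
  then obtain z where z: "0 \<le> z" "z \<le> x" "\<phi> z = \<phi> y"
    using IVT'[of \<phi> 0 "\<phi> y" x] le assms phi_0 phi_nonneg by auto
  then have "z = y" using psi_phi[of z] psi_phi[of y] assms by auto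
  then show False using z assms by simp
qed

lemma psi_strict_mono:
  assumes "0 \<le> x" "x < y"
  shows "\<psi> x < \<psi> y"
proof (rule ccontr)
  assume "\<not> \<psi> x < \<psi> y"
  then have "\<phi> (\<psi> y) \<le> \<phi> (\<psi> x)"
    using phi_strict_mono[of "\<psi> y" "\<psi> x"] psi_nonneg[of y] assms by (cases "\<psi> y = \<psi> x") auto
  then show False using assms phi_psi by simp
qed

lemma phi_pow_pos: "x > 0 \<Longrightarrow> (\<phi> ^^ n) x > 0" and psi_pow_pos: "x > 0 \<Longrightarrow> (\<psi> ^^ n) x > 0"
  by (induction n) (auto intro: phi_pos psi_pos)

lemma phi_pow_nonneg: "x \<ge> 0 \<Longrightarrow> (\<phi> ^^ n) x \<ge> 0" and psi_pow_nonneg: "x \<ge> 0 \<Longrightarrow> (\<psi> ^^ n) x \<ge> 0"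
  by (induction n) (auto intro: phi_nonneg psi_nonneg)

lemma phi_psi_pow: "x \<ge> 0 \<Longrightarrow> (\<phi> ^^ n) ((\<psi> ^^ n) x) = x"
  by (induction n arbitrary: x) (simp_all add: funpow_swap1[of \<psi>] psi_nonneg phi_psi)

lemma phi_pow_strict_mono: "0 \<le> x \<Longrightarrow> x < y \<Longrightarrow> (\<phi> ^^ n) x < (\<phi> ^^ n) y"
  by (induction n) (auto intro!: phi_strict_mono phi_pow_nonneg)

lemma psi_pow_strict_mono: "0 \<le> x \<Longrightarrow> x < y \<Longrightarrow> (\<psi> ^^ n) x < (\<psi> ^^ n) y"
  by (induction n) (auto intro!: psi_strict_mono psi_pow_nonneg)

text \<open>The orbit decreases to a fixed point of \<open>\<psi>\<close>, and \<open>0\<close> is the only one.\<close>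

lemma psi_pow_tendsto_0:
  assumes "x > 0"
  shows "(\<lambda>n. (\<psi> ^^ n) x) \<longlonglongrightarrow> 0"
proof -
  let ?s = "\<lambda>n. (\<psi> ^^ n) x"
  have dec: "decseq ?s"
    using psi_lt[OF psi_pow_pos[OF assms]] by (intro decseq_SucI) (simp add: less_imp_le)
  obtain l where l: "?s \<longlonglongrightarrow> l" "\<And>n. l \<le> ?s n"
    using decseq_convergent[OF dec, of 0] psi_pow_pos[OF assms] less_imp_le by blast
  have "0 \<le> l"
    using LIMSEQ_le_const[OF l(1), of 0] psi_pow_pos[OF assms] less_imp_le by blast
  have "(\<lambda>n. \<psi> (?s n)) \<longlonglongrightarrow> \<psi> l"
    using continuous_on_tendsto_compose[OF continuous_psi l(1)] \<open>0 \<le> l\<close> psi_pow_nonneg assms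
    by (simp add: less_imp_le)
  moreover have "(\<lambda>n. \<psi> (?s n)) \<longlonglongrightarrow> l"
    using LIMSEQ_Suc[OF l(1)] by simp
  ultimately have "\<psi> l = l" using LIMSEQ_unique by blast
  then have "l = 0" using psi_lt[of l] \<open>0 \<le> l\<close> by force
  then show ?thesis using l(1) by simp
qed

lemma psi_pow_eventually_less:
  assumes "x > 0" "c > 0"
  shows "\<exists>N. \<forall>n\<ge>N. (\<psi> ^^ n) x < c"
  using order_tendstoD(2)[OF psi_pow_tendsto_0[OF assms(1)] assms(2)]
  unfolding eventually_sequentially .

lemma phi_pow_eventually_greater:
  assumes "x > 0" "c > 0"
  shows "\<exists>N. \<forall>n\<ge>N. (\<phi> ^^ n) x > c"
proof -
  obtain N where N: "\<forall>n\<ge>N. (\<psi> ^^ n) c < x"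
    using psi_pow_eventually_less[OF assms(2,1)] by blast
  have "(\<phi> ^^ n) x > c" if "n \<ge> N" for n
  proof -
    have "(\<phi> ^^ n) ((\<psi> ^^ n) c) < (\<phi> ^^ n) x"
      using N assms that by (intro phi_pow_strict_mono psi_pow_nonneg) auto
    then show ?thesis using phi_psi_pow assms by simp
  qed
  then show ?thesis by blast
qed

text \<open>
  Smoothness at the boundary point means that \<open>\<phi>\<close> extends smoothly across \<open>0\<close>; the flatness argument
  differentiates the extension.
\<close>

lemma phi_local_extension:
  obtains g \<epsilon> where "\<epsilon> > 0" "\<forall>k. Ck_on k {-\<epsilon><..<\<epsilon>} g" "\<forall>x. 0 \<le> x \<longrightarrow> x < \<epsilon> \<longrightarrow> g x = \<phi> x"
    "(g has_vector_derivative 1) (at 0)"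
proof -
  have "(0::real) \<in> {0..}" by simp
  with phi_smooth obtain U g where U: "open U" "0 \<in> U" "\<forall>k. Ck_on k U g"
      "\<forall>y. y \<in> {0..} \<longrightarrow> y \<in> U \<longrightarrow> g y = \<phi> y"
    by (rule smooth_onE) (rule that)
  obtain \<epsilon> where \<epsilon>: "\<epsilon> > 0" "ball 0 \<epsilon> \<subseteq> U"
    using U(1,2) open_contains_ball by blast
  have ball: "ball 0 \<epsilon> = {-\<epsilon><..<\<epsilon>}" by (auto simp: dist_real_def)
  define D where "D = frechet_derivative g (at 0) 1"
  have gD: "(g has_vector_derivative D) (at 0)"
    unfolding D_def using Ck_on_Suc_has_vector_derivative[of 0 U g 0] U by auto
  then have "((\<lambda>x. g x - x) has_vector_derivative D - 1) (at 0 within {0..})"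
    using has_vector_derivative_diff[OF has_vector_derivative_at_within[OF gD] has_vector_derivative_id]
    by simp
  then have "((\<lambda>x. \<phi> x - x) has_vector_derivative D - 1) (at 0 within {0..})"
    by (rule has_vector_derivative_transform_within[OF _ \<epsilon>(1)])
       (use U \<epsilon> in \<open>auto simp: dist_real_def subset_iff\<close>)
  then have "half_deriv (\<lambda>x. \<phi> x - x) 0 = D - 1"
    unfolding half_deriv_def
    by (rule vector_derivative_within[rotated])
       (use at_within_Ici_at_right[of "0::real"] trivial_limit_at_right_real[of "0::real"] in auto)
  moreover have "half_deriv (\<lambda>x. \<phi> x - x) 0 = 0"
    using phi_tangent unfolding tangent_id_infinite_order_def by (auto dest: spec[of _ 1])
  ultimately have "D = 1" by simp
  show thesis
  proof (rule that[OF \<epsilon>(1)])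
    show "\<forall>k. Ck_on k {-\<epsilon><..<\<epsilon>} g"
      by (intro allI, rule Ck_on_subset[of _ U]) (use U(3) \<epsilon>(2) ball in auto)
    show "\<forall>x. 0 \<le> x \<longrightarrow> x < \<epsilon> \<longrightarrow> g x = \<phi> x"
      using U(4) \<epsilon>(1,2) unfolding ball subset_iff by simp
    show "(g has_vector_derivative 1) (at 0)"
      using gD \<open>D = 1\<close> by simp
  qed
qed


section \<open>Flatness of solutions at the boundary\<close>

text \<open>
  One step of the equation contracts \<open>u\<close> by the factor \<open>r\<close>, and points near \<open>0\<close> need many steps to
  reach a fixed fundamental domain \<open>[d, \<phi> d]\<close>, on which \<open>u\<close> is bounded.
\<close>

lemma tendsto_0_of_contraction:
  fixes u m w :: "real \<Rightarrow> complex"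
  assumes cont: "continuous_on {0<..} u"
    and "\<delta> > 0" and eq: "\<And>x. 0 < x \<Longrightarrow> x < \<delta> \<Longrightarrow> u x = m x * u (\<phi> x) + w x"
    and m: "\<And>x. 0 < x \<Longrightarrow> x < \<delta> \<Longrightarrow> norm (m x) \<le> r" and "0 \<le> r" "r < 1"
    and w: "(w \<longlongrightarrow> 0) (at_right 0)"
  shows "(u \<longlongrightarrow> 0) (at_right 0)"
proof (rule tendstoI)
  fix e :: real assume "e > 0"
  define \<epsilon> where "\<epsilon> = e / 3"
  have \<epsilon>: "\<epsilon> > 0" using \<open>e > 0\<close> by (simp add: \<epsilon>_def)
  have "eventually (\<lambda>x. norm (w x) < \<epsilon> * (1 - r)) (at_right 0)"
    using tendstoD[OF w, of "\<epsilon> * (1 - r)"] \<epsilon> \<open>r < 1\<close> by simp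
  then obtain b where b: "b > 0" "\<And>x. 0 < x \<Longrightarrow> x < b \<Longrightarrow> norm (w x) < \<epsilon> * (1 - r)"
    unfolding eventually_at_right_field by auto
  define d where "d = min b \<delta> / 2"
  have d: "0 < d" "d < b" "d < \<delta>" using b \<open>\<delta> > 0\<close> by (auto simp: d_def)
  have "compact (u ` {d..\<phi> d})"
    using d by (intro compact_continuous_image continuous_on_subset[OF cont]) auto
  then obtain M where "\<forall>y\<in>u ` {d..\<phi> d}. norm y \<le> M"
    using compact_imp_bounded bounded_iff by blast
  then have M: "\<And>x. x \<in> {d..\<phi> d} \<Longrightarrow> norm (u x) \<le> M" by blast
  have M0: "M \<ge> 0" using order_trans[OF norm_ge_zero[of "u d"] M[of d]] phi_gt[OF d(1)] by auto
  have bound: "norm (u x) \<le> r ^ n * M + \<epsilon>" if "0 < x" "(\<phi> ^^ n) x \<in> {d..\<phi> d}" for n x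
    using that
  proof (induction n arbitrary: x)
    case 0
    then show ?case using M[of x] \<epsilon> by auto
  next
    case (Suc n)
    have "\<phi> ((\<phi> ^^ n) x) \<le> \<phi> d" using Suc.prems by simp
    then have le: "(\<phi> ^^ n) x \<le> d"
      using phi_strict_mono[of d "(\<phi> ^^ n) x"] d by force
    have "x \<le> (\<phi> ^^ n) x"
    proof (induction n)
      case (Suc n)
      then show ?case using phi_gt[OF phi_pow_pos[OF \<open>0 < x\<close>, of n]] by simp
    qed simp
    then have xd: "x \<le> d" using le by linarith
    have "(\<phi> ^^ n) (\<phi> x) \<in> {d..\<phi> d}" using Suc.prems by (simp add: funpow_swap1)
    then have IH: "norm (u (\<phi> x)) \<le> r ^ n * M + \<epsilon>"
      using Suc.IH phi_pos Suc.prems by blast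
    have "norm (u x) \<le> norm (m x) * norm (u (\<phi> x)) + norm (w x)"
      using eq[of x] Suc.prems xd d norm_triangle_ineq[of "m x * u (\<phi> x)" "w x"] by (simp add: norm_mult)
    also have "\<dots> \<le> r * (r ^ n * M + \<epsilon>) + \<epsilon> * (1 - r)"
      using b(2)[of x] m[of x] IH Suc.prems xd d \<open>0 \<le> r\<close> by (intro add_mono mult_mono) auto
    also have "\<dots> = r ^ Suc n * M + \<epsilon>" by (simp add: algebra_simps)
    finally show ?case .
  qed
  have "(\<lambda>n. r ^ n * M) \<longlonglongrightarrow> 0"
    using LIMSEQ_power_zero[of r] \<open>0 \<le> r\<close> \<open>r < 1\<close> by (intro tendsto_mult_left_zero) auto
  then have "eventually (\<lambda>n. r ^ n * M < \<epsilon>) sequentially"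
    using order_tendstoD(2) \<epsilon> by blast
  then obtain N where N: "r ^ N * M < \<epsilon>" by (auto simp: eventually_sequentially)
  have "norm (u x) < e" if x: "0 < x" "x < (\<psi> ^^ N) d" for x
  proof -
    let ?P = "\<lambda>n. (\<phi> ^^ n) x \<ge> d"
    have ex: "\<exists>n. ?P n" using phi_pow_eventually_greater[OF x(1) d(1)] by (auto intro: less_imp_le)
    define n where "n = (LEAST n. ?P n)"
    have n: "?P n" unfolding n_def using ex by (rule LeastI_ex)
    have "N < n"
    proof (rule ccontr)
      assume "\<not> N < n"
      then obtain j where j: "N = n + j" using le_Suc_ex[of n N] by auto
      have "(\<phi> ^^ n) x < (\<phi> ^^ n) ((\<psi> ^^ N) d)" using x by (intro phi_pow_strict_mono) auto
      also have "\<dots> = (\<psi> ^^ j) d"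
        using phi_psi_pow[of "(\<psi> ^^ j) d" n] psi_pow_nonneg d by (simp add: j funpow_add)
      also have "\<dots> \<le> d"
      proof (induction j)
        case (Suc j)
        then show ?case using psi_lt[OF psi_pow_pos[OF d(1), of j]] by simp
      qed simp
      finally show False using n by simp
    qed
    then obtain n' where n': "n = Suc n'" by (cases n) auto
    then have "\<not> ?P n'" using not_less_Least[of n' ?P] by (simp add: n_def[symmetric])
    then have "(\<phi> ^^ n) x < \<phi> d"
      using phi_strict_mono[of "(\<phi> ^^ n') x" d] phi_pow_nonneg[of x n'] x by (simp add: n')
    then have "norm (u x) \<le> r ^ n * M + \<epsilon>" using bound n x by auto
    also have "\<dots> \<le> r ^ N * M + \<epsilon>"
      using \<open>N < n\<close> \<open>0 \<le> r\<close> \<open>r < 1\<close> M0 by (intro add_mono mult_right_mono power_decreasing) auto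
    also have "\<dots> < e" using N \<open>e > 0\<close> by (simp add: \<epsilon>_def)
    finally show ?thesis .
  qed
  then show "eventually (\<lambda>x. dist (u x) 0 < e) (at_right 0)"
    unfolding eventually_at_right_field
    by (intro exI[of _ "(\<psi> ^^ N) d"]) (simp add: psi_pow_pos[OF d(1)])
qed

end

text \<open>By the mean value inequality, the limit of \<open>u'\<close> at \<open>0\<close> is the derivative of \<open>u\<close> at \<open>0\<close>.\<close>

lemma has_vector_derivative_0_of_limit:
  fixes u :: "real \<Rightarrow> 'a::real_normed_vector"
  assumes "0 < d" and zero: "\<And>x. -d < x \<Longrightarrow> x \<le> 0 \<Longrightarrow> u x = 0"
    and u0: "(u \<longlongrightarrow> 0) (at_right 0)"
    and der: "\<And>x. 0 < x \<Longrightarrow> x < d \<Longrightarrow> (u has_vector_derivative u' x) (at x)"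
    and lim: "(u' \<longlongrightarrow> 0) (at_right 0)"
  shows "(u has_vector_derivative 0) (at 0)"
  unfolding has_vector_derivative_def has_derivative_at_alt
proof (intro conjI allI impI)
  fix e :: real assume e: "e > 0"
  have "eventually (\<lambda>x. norm (u' x) < e) (at_right 0)"
    using tendstoD[OF lim e] by simp
  then obtain b where b: "b > 0" "\<And>x. 0 < x \<Longrightarrow> x < b \<Longrightarrow> norm (u' x) < e"
    unfolding eventually_at_right_field by auto
  define c where "c = min b d"
  have uz: "u 0 = 0" using zero \<open>0 < d\<close> by simp
  have "norm (u y) \<le> e * y" if y: "0 < y" "y < c" for y
  proof -
    have "continuous_on {0..y} u"
      unfolding continuous_on_eq_continuous_within
    proof
      fix x assume x: "x \<in> {0..y}"
      show "continuous (at x within {0..y}) u"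
      proof (cases "x = 0")
        case True
        then show ?thesis
          unfolding continuous_within using u0 uz y
          by (simp add: at_within_Icc_at_right)
      next
        case False
        then have "(u has_vector_derivative u' x) (at x)" using der x y by (auto simp: c_def)
        then show ?thesis using has_vector_derivative_continuous continuous_at_imp_continuous_at_within by blast
      qed
    qed
    then have "norm (u y - u 0) \<le> e * y - e * 0"
    proof (rule differentiable_bound_general[OF y(1), where f'=u' and \<phi>'="\<lambda>_. e"])
      show "(u has_vector_derivative u' x) (at x)" if "0 < x" "x < y" for x
        using der that y by (auto simp: c_def)
      show "((*) e has_vector_derivative e) (at x)" for x
        by (auto intro!: derivative_eq_intros)
      show "norm (u' x) \<le> e" if "0 < x" "x < y" for x
        using b(2)[of x] that y by (auto simp: c_def)
    qed (intro continuous_intros)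
    then show ?thesis using uz by simp
  qed
  then have "norm (u y - u 0 - (y - 0) *\<^sub>R 0) \<le> e * norm (y - 0)" if "norm (y - 0) < c" for y
    using that zero[of y] uz e by (cases "y \<le> 0") (auto simp: c_def mult_nonneg_nonpos)
  then show "\<exists>d>0. \<forall>y. norm (y - 0) < d \<longrightarrow> norm (u y - u 0 - (y - 0) *\<^sub>R 0) \<le> e * norm (y - 0)"
    using b(1) \<open>0 < d\<close> by (intro exI[of _ c]) (auto simp: c_def)
qed auto

context Reeb_data
begin

lemma tendsto_0_of_equation:
  fixes u m w :: "real \<Rightarrow> complex"
  assumes u: "continuous_on {0<..} u" and d: "d > 0"
    and m: "continuous_on {-d<..<d} m" "norm (m 0) < 1"
    and w: "continuous_on {-d<..<d} w" "w 0 = 0"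
    and eq: "\<And>x. 0 < x \<Longrightarrow> x < d \<Longrightarrow> u x = m x * u (\<phi> x) + w x"
  shows "(u \<longlongrightarrow> 0) (at_right 0)"
proof -
  define r where "r = (1 + norm (m 0)) / 2"
  have r: "norm (m 0) < r" "r < 1" "0 \<le> r"
    using m(2) norm_ge_zero[of "m 0"] unfolding r_def by (simp_all add: field_simps del: norm_ge_zero)
  have "isCont m 0" "isCont w 0"
    using m(1) w(1) d by (auto simp: continuous_on_eq_continuous_at)
  then have "(m \<longlongrightarrow> m 0) (at_right 0)" and wlim: "(w \<longlongrightarrow> 0) (at_right 0)"
    using w(2) by (auto simp: isCont_def filterlim_at_split)
  then have "eventually (\<lambda>x. norm (m x) < r) (at_right 0)"
    using order_tendstoD(2)[OF tendsto_norm] r(1) by blast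
  then obtain b where b: "b > 0" "\<And>x. 0 < x \<Longrightarrow> x < b \<Longrightarrow> norm (m x) < r"
    unfolding eventually_at_right_field by auto
  show ?thesis
  proof (rule tendsto_0_of_contraction[OF u, of "min b d" m w r])
    show "norm (m x) \<le> r" if "0 < x" "x < min b d" for x
      using b(2)[of x] that by simp
  qed (use b(1) d r wlim eq in auto)
qed

text \<open>
  The extension of \<open>u\<close> by \<open>0\<close> is as smooth as the inhomogeneity \<open>w\<close>. Differentiating the equation
  gives \<open>u' = (m \<phi>') (u' \<circ> \<phi>) + (m' (u \<circ> \<phi>) + w')\<close>, an equation of the same kind: the new factor
  still has modulus less than \<open>1\<close> at \<open>0\<close> because \<open>\<phi>'(0) = 1\<close>. So the induction on \<open>k\<close> applies to \<open>u'\<close>,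
  and only the continuity of \<open>u\<close> at \<open>0\<close> needs an argument of its own.
\<close>

lemma Ck_on_flat_extension:
  fixes u m w :: "real \<Rightarrow> complex"
  assumes "\<And>j. Ck_on j {0<..} u" "\<And>x. x \<le> 0 \<Longrightarrow> u x = 0" "d > 0"
    and "\<And>j. Ck_on j {-d<..<d} m" "norm (m 0) < 1"
    and "Ck_on k {-d<..<d} w" "\<And>x. -d < x \<Longrightarrow> x \<le> 0 \<Longrightarrow> w x = 0"
    and "\<And>x. 0 < x \<Longrightarrow> x < d \<Longrightarrow> u x = m x * u (\<phi> x) + w x"
  shows "\<exists>d>0. Ck_on k {-d<..<d} u"
proof -
  obtain g \<epsilon> where \<epsilon>: "\<epsilon> > 0" and g_all: "\<forall>k. Ck_on k {-\<epsilon><..<\<epsilon>} g"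
    and g\<phi>_all: "\<forall>x. 0 \<le> x \<longrightarrow> x < \<epsilon> \<longrightarrow> g x = \<phi> x" and g': "(g has_vector_derivative 1) (at 0)"
    by (rule phi_local_extension) (rule that)
  note g = g_all[rule_format] and g\<phi> = g\<phi>_all[rule_format]
  have g0: "g 0 = 0" using g\<phi>[of 0] \<epsilon> phi_0 by simp
  let ?D = "\<lambda>f x. frechet_derivative f (at x) (1::real)"
  have Dg0: "?D g 0 = 1"
    using vector_derivative_unique_at[OF Ck_on_Suc_has_vector_derivative[OF g, of 0] g'] \<epsilon> by simp
  show ?thesis
    using assms
  proof (induction k arbitrary: u m w d)
    case 0
    have "(u \<longlongrightarrow> 0) (at_right 0)"
      using 0(3,5,7,8) 0(1)[of 0] 0(4)[of 0] 0(6) by (intro tendsto_0_of_equation[of u d m w]) auto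
    moreover have "(u \<longlongrightarrow> 0) (at_left 0)"
    proof (rule tendsto_eventually)
      show "eventually (\<lambda>x. u x = 0) (at_left 0)"
        using 0(2) by (auto simp: eventually_at_filter)
    qed
    ultimately have "isCont u 0"
      using 0(2)[of 0] by (simp add: isCont_def filterlim_at_split)
    moreover have "isCont u x" if "x > 0" for x
      using 0(1)[of 0] that by (simp add: continuous_on_eq_continuous_at)
    moreover have "isCont u x" if "x < 0" for x
    proof -
      have "continuous_on {..<0} u" using 0(2) by (auto intro: continuous_on_eq[OF continuous_on_const])
      then show ?thesis using that by (simp add: continuous_on_eq_continuous_at)
    qed
    ultimately have "continuous_on {-1<..<1} u"
      by (intro continuous_at_imp_continuous_on) (metis linorder_neqE_linordered_idom)
    then show ?case by (intro exI[of _ 1]) simp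
  next
    case (Suc k)
    note u = Suc.prems(1) and u0 = Suc.prems(2) and d = Suc.prems(3) and m = Suc.prems(4)
      and m0 = Suc.prems(5) and w = Suc.prems(6) and w0 = Suc.prems(7) and eq = Suc.prems(8)
    have "\<exists>d1>0. Ck_on k {-d1<..<d1} u"
      by (rule Suc.IH[of u d m w]) (fact u u0 d m m0 Ck_on_SucD[OF w] w0 eq)+
    then obtain d1 where d1: "d1 > 0" "Ck_on k {-d1<..<d1} u"
      by (elim exE conjE) (rule that)
    have "isCont g 0" using has_vector_derivative_continuous[OF g'] .
    then obtain e1 where e1: "e1 > 0" "\<And>x. \<bar>x\<bar> < e1 \<Longrightarrow> \<bar>g x\<bar> < d1"
      unfolding continuous_at_eps_delta using d1(1) g0 by (auto simp: dist_real_def)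
    have "(g has_real_derivative 1) (at 0)"
      using g' by (simp add: has_real_derivative_iff_has_vector_derivative)
    then obtain e2 where e2: "e2 > 0" "\<And>h. 0 < h \<Longrightarrow> h < e2 \<Longrightarrow> g (0 - h) < g 0"
      using has_real_derivative_pos_inc_left[of g 1 0 UNIV] by auto
    define e where "e = Min {d, \<epsilon>, e1, e2}"
    have e: "e > 0" "e \<le> d" "e \<le> \<epsilon>" "e \<le> e1" "e \<le> e2"
      using d \<epsilon> e1(1) e2(1) by (auto simp: e_def)
    have ed: "{-e<..<e} \<subseteq> {-d<..<d}" and ee: "{-e<..<e} \<subseteq> {-\<epsilon><..<\<epsilon>}"
      using e by auto
    \<comment> \<open>The extension \<open>g\<close> is increasing at \<open>0\<close>, so the extended \<open>u \<circ> g\<close> vanishes to the left of \<open>0\<close> as well.\<close>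
    have g_le: "g x \<le> 0" if "-e < x" "x \<le> 0" for x
      using e2(2)[of "-x"] that e g0 by (cases "x = 0") auto
    have du: "(u has_vector_derivative ?D u x) (at x)" if "x > 0" for x
      using Ck_on_Suc_has_vector_derivative[OF u] that by simp
    have dm: "(m has_vector_derivative ?D m x) (at x)" if "x \<in> {-d<..<d}" for x
      using Ck_on_Suc_has_vector_derivative[OF m] that by blast
    have dw: "(w has_vector_derivative ?D w x) (at x)" if "x \<in> {-d<..<d}" for x
      using Ck_on_Suc_has_vector_derivative[OF w] that by blast
    have dg: "(g has_vector_derivative ?D g x) (at x)" if "x \<in> {-\<epsilon><..<\<epsilon>}" for x
      using Ck_on_Suc_has_vector_derivative[OF g] that by blast
    define u1 where "u1 = (\<lambda>x. if x > 0 then ?D u x else 0)"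
    define m1 where "m1 = (\<lambda>x. m x * complex_of_real (?D g x))"
    define w1 where "w1 = (\<lambda>x. ?D m x * u (g x) + ?D w x)"
    have u1: "Ck_on j {0<..} u1" for j
    proof (rule Ck_on_cong_imp)
      show "Ck_on j {0<..} (?D u)" using u[of "Suc j"] by simp
    qed (auto simp: u1_def)
    have m1: "Ck_on j {-e<..<e} m1" for j
      unfolding m1_def
    proof (intro Ck_on_bilinear[OF bounded_bilinear_mult] Ck_on_bounded_linear_compose[OF bounded_linear_of_real])
      show "Ck_on j {-e<..<e} m" using Ck_on_subset[OF m ed] .
      have "Ck_on j {-\<epsilon><..<\<epsilon>} (?D g)" using g[of "Suc j"] by simp
      then show "Ck_on j {-e<..<e} (?D g)" using Ck_on_subset ee by blast
    qed auto
    have w1: "Ck_on k {-e<..<e} w1"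
      unfolding w1_def
    proof (intro Ck_on_add Ck_on_bilinear[OF bounded_bilinear_mult])
      have "Ck_on k {-d<..<d} (?D m)" using m[of "Suc k"] by simp
      then show "Ck_on k {-e<..<e} (?D m)" using Ck_on_subset ed by blast
      have "Ck_on k {-d<..<d} (?D w)" using w by simp
      then show "Ck_on k {-e<..<e} (?D w)" using Ck_on_subset ed by blast
      show "Ck_on k {-e<..<e} (\<lambda>x. u (g x))"
      proof (rule Ck_on_compose[OF _ _ _ d1(2)])
        show "g ` {-e<..<e} \<subseteq> {-d1<..<d1}"
        proof (intro image_subsetI)
          fix x assume "x \<in> {-e<..<e}"
          then have "\<bar>x\<bar> < e1" using e by auto
          then show "g x \<in> {-d1<..<d1}" using e1(2)[of x] by auto
        qed
        show "Ck_on k {-e<..<e} g" using Ck_on_subset[OF g ee] .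
      qed auto
    qed auto
    \<comment> \<open>The derivative of \<open>w\<close> is computed from the left, where \<open>w\<close> vanishes; this includes \<open>x = 0\<close>.\<close>
    have Dw: "?D w x = 0" if x: "-e < x" "x \<le> 0" for x
    proof (rule vector_derivative_unique_within[of x "{-d<..x}"])
      have "-d < x" using x e by simp
      then show "at x within {-d<..x} \<noteq> bot"
        by (simp add: trivial_limit_within islimpt_greaterThanLessThan2[THEN islimpt_subset])
      show "(w has_vector_derivative ?D w x) (at x within {-d<..x})"
        by (rule has_vector_derivative_at_within[OF dw]) (use x e in auto)
      show "(w has_vector_derivative 0) (at x within {-d<..x})"
        by (rule has_vector_derivative_transform[OF _ _ has_vector_derivative_const])
           (use x w0 e in auto)
    qed
    have w1_0: "w1 x = 0" if "-e < x" "x \<le> 0" for x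
      using Dw[OF that] u0[OF g_le[OF that]] by (simp add: w1_def)
    have eq1: "u1 x = m1 x * u1 (\<phi> x) + w1 x" if x: "0 < x" "x < e" for x
    proof -
      have gx: "g x = \<phi> x" "\<phi> x > 0" using g\<phi> x e phi_pos by auto
      have "x \<in> {-\<epsilon><..<\<epsilon>}" "g x > 0" using x e gx by auto
      then have ug: "((\<lambda>y. u (g y)) has_vector_derivative ?D g x *\<^sub>R ?D u (g x)) (at x)"
        using vector_diff_chain_at[OF dg du] by (simp only: o_def)
      have "x \<in> {-d<..<d}" using x e by auto
      then have "((\<lambda>y. m y * u (g y) + w y) has_vector_derivative
          (m x * (?D g x *\<^sub>R ?D u (g x)) + ?D m x * u (g x)) + ?D w x) (at x)"
        by (intro has_vector_derivative_add has_vector_derivative_mult ug dm dw)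
      then have "(u has_vector_derivative
          (m x * (?D g x *\<^sub>R ?D u (g x)) + ?D m x * u (g x)) + ?D w x) (at x)"
      proof (rule has_vector_derivative_transform_within_open[of _ _ _ "{0<..<e}"])
        show "m y * u (g y) + w y = u y" if "y \<in> {0<..<e}" for y
          using eq[of y] g\<phi>[of y] that e by simp
      qed (use x in auto)
      then have "?D u x = (m x * (?D g x *\<^sub>R ?D u (g x)) + ?D m x * u (g x)) + ?D w x"
        using vector_derivative_unique_at du x by blast
      then show ?thesis
        using x gx by (simp add: u1_def m1_def w1_def scaleR_conv_of_real)
    qed
    have u1_0: "u1 x = 0" if "x \<le> 0" for x using that by (simp add: u1_def)
    have m1_0: "norm (m1 0) < 1" using m0 by (simp add: m1_def Dg0)
    have "\<exists>d2>0. Ck_on k {-d2<..<d2} u1"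
      by (rule Suc.IH[of u1 e m1 w1]) (fact u1 u1_0 e(1) m1 m1_0 w1 w1_0 eq1)+
    then obtain d2 where d2: "d2 > 0" "Ck_on k {-d2<..<d2} u1"
      by (elim exE conjE) (rule that)
    have ulim: "(u \<longlongrightarrow> 0) (at_right 0)"
      using d m0 w0[of 0] eq u[of 0] m[of 0] Ck_on_imp_continuous_on[OF w]
      by (intro tendsto_0_of_equation[of u d m w]) auto
    have "isCont u1 0"
      using Ck_on_imp_continuous_on[OF d2(2)] d2(1) by (simp add: continuous_on_eq_continuous_at)
    then have u1lim: "(u1 \<longlongrightarrow> 0) (at_right 0)"
      by (simp add: isCont_def filterlim_at_split u1_def)
    have "Ck_on (Suc k) {-d2<..<d2} u"
    proof (rule Ck_on_Suc_real[OF _ _ d2(2)])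
      fix x assume x: "x \<in> {-d2<..<d2}"
      consider "x < 0" | "x = 0" | "x > 0" by linarith
      then show "(u has_vector_derivative u1 x) (at x)"
      proof cases
        case 1
        have "(u has_vector_derivative 0) (at x)"
          by (rule has_vector_derivative_transform_within_open[OF has_vector_derivative_const, of "{..<0}"])
             (use 1 u0 in auto)
        then show ?thesis using 1 by (simp add: u1_def)
      next
        case 2
        have "(u has_vector_derivative 0) (at 0)"
          by (rule has_vector_derivative_0_of_limit[of 1 u u1])
             (use u0 ulim u1lim du in \<open>auto simp: u1_def\<close>)
        then show ?thesis using 2 by (simp add: u1_def)
      next
        case 3
        then show ?thesis using du by (simp add: u1_def)
      qed
    qed simp
    then show ?case using d2(1) by blast
  qed
qed

text \<open>
  The neighbourhoods of \<open>0\<close> obtained above shrink as \<open>k\<close> grows, but off \<open>0\<close> the function is smooth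
  anyway, so each of them can be enlarged to the whole line.
\<close>

lemma smooth_of_equation:
  fixes u :: "real \<Rightarrow> complex"
  assumes u: "\<And>k. Ck_on k {0<..} u" and u0: "\<And>x. x \<le> 0 \<Longrightarrow> u x = 0"
    and eq: "\<And>x. x > 0 \<Longrightarrow> u (\<phi> x) = lam * u x"
  shows "Ck_on k UNIV u"
proof -
  have "\<exists>d>0. Ck_on k {-d<..<d} u"
  proof (rule Ck_on_flat_extension[of u 1 "\<lambda>_. inverse lam" k "\<lambda>_. 0"])
    show "u x = inverse lam * u (\<phi> x) + 0" if "0 < x" for x
      using eq[OF that] lam_nonzero by simp
    show "norm (inverse lam) < 1"
      using lam by (simp add: norm_inverse inverse_less_1_iff)
  qed (use u u0 in \<open>auto intro: Ck_on_const\<close>)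
  then obtain d where d: "d > 0" "Ck_on k {-d<..<d} u" by blast
  have neg: "Ck_on k {..<0} u"
    by (rule Ck_on_cong_imp[OF _ _ Ck_on_const[of _ _ 0]]) (use u0 in auto)
  show ?thesis
  proof (rule Ck_on_local)
    fix x :: real
    consider "x < 0" | "x = 0" | "x > 0" by linarith
    then show "\<exists>V. open V \<and> x \<in> V \<and> Ck_on k V u"
    proof cases
      case 1
      then show ?thesis by (intro exI[of _ "{..<0}"]) (simp add: neg)
    next
      case 2
      then show ?thesis using d by (intro exI[of _ "{-d<..<d}"]) simp
    next
      case 3
      then show ?thesis by (intro exI[of _ "{0<..}"]) (simp add: u)
    qed
  qed
qed

end

section \<open>The space of solutions is infinite dimensional\<close>

text \<open>
  The derivative of \<open>exp (-1/x) / x^n\<close> is a combination of functions of the same form, so smoothness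
  follows by induction for the whole family at once.
\<close>

definition flat_exp :: "nat \<Rightarrow> real \<Rightarrow> real" where
  "flat_exp n x = (if x > 0 then exp (- inverse x) * inverse x ^ n else 0)"

lemma flat_exp_tendsto_0: "(flat_exp n \<longlongrightarrow> 0) (at_right 0)"
proof -
  have "((\<lambda>x::real. inverse x ^ n / exp (inverse x)) \<longlongrightarrow> 0) (at_right 0)"
    using filterlim_compose[OF tendsto_power_div_exp_0 filterlim_inverse_at_top_right] .
  moreover have "eventually (\<lambda>x. inverse x ^ n / exp (inverse x) = flat_exp n x) (at_right 0)"
    by (auto simp: flat_exp_def eventually_at_filter exp_minus field_simps)
  ultimately show ?thesis
    by (rule Lim_transform_eventually)
qed

lemma flat_exp_has_vector_derivative:
  "(flat_exp n has_vector_derivative (flat_exp (n + 2) x - real n * flat_exp (n + 1) x)) (at x)"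
proof -
  let ?f' = "\<lambda>x. flat_exp (n + 2) x - real n * flat_exp (n + 1) x"
  have pos: "(flat_exp n has_vector_derivative ?f' x) (at x)" if "x > 0" for x
  proof -
    have "((\<lambda>x. exp (- inverse x) * inverse x ^ n) has_real_derivative ?f' x) (at x)"
      using that
      by (cases n) (auto intro!: derivative_eq_intros
          simp: flat_exp_def power2_eq_square algebra_simps divide_inverse, metis One_nat_def power_eq_if)
    then have "((\<lambda>x. exp (- inverse x) * inverse x ^ n) has_vector_derivative ?f' x) (at x)"
      by (simp add: has_real_derivative_iff_has_vector_derivative)
    then show ?thesis
      by (rule has_vector_derivative_transform_within_open[of _ _ _ "{0<..}"])
         (use that in \<open>auto simp: flat_exp_def\<close>)
  qed
  consider "x < 0" | "x = 0" | "x > 0" by linarith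
  then show ?thesis
  proof cases
    case 1
    have "(flat_exp n has_vector_derivative 0) (at x)"
      by (rule has_vector_derivative_transform_within_open[OF has_vector_derivative_const, of "{..<0}"])
         (use 1 in \<open>auto simp: flat_exp_def\<close>)
    then show ?thesis using 1 by (simp add: flat_exp_def)
  next
    case 2
    have "(?f' \<longlongrightarrow> 0 - real n * 0) (at_right 0)"
      by (intro tendsto_diff tendsto_mult tendsto_const flat_exp_tendsto_0)
    then have "(flat_exp n has_vector_derivative 0) (at 0)"
      by (intro has_vector_derivative_0_of_limit[of 1 _ ?f'] flat_exp_tendsto_0)
         (use pos in \<open>auto simp: flat_exp_def\<close>)
    then show ?thesis using 2 by (simp add: flat_exp_def)
  next
    case 3
    then show ?thesis by (rule pos)
  qed
qed

lemma Ck_on_flat_exp: "Ck_on k UNIV (flat_exp n)"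
proof (induction k arbitrary: n)
  case 0
  have "isCont (flat_exp n) x" for x
    by (rule has_vector_derivative_continuous[OF flat_exp_has_vector_derivative])
  then show ?case by (simp add: continuous_at_imp_continuous_on)
next
  case (Suc k)
  show ?case
  proof (rule Ck_on_Suc_real[OF open_UNIV flat_exp_has_vector_derivative])
    have "Ck_on k UNIV (\<lambda>x. flat_exp (n + 2) x + (- real n) * flat_exp (n + 1) x)"
      by (intro Ck_on_add Ck_on_bilinear[OF bounded_bilinear_mult] Ck_on_const Suc open_UNIV)
    then show "Ck_on k UNIV (\<lambda>x. flat_exp (n + 2) x - real n * flat_exp (n + 1) x)"
      by (simp only: minus_mult_left[symmetric] add_uminus_conv_diff)
  qed
qed

lemma Ck_on_power: "Ck_on k UNIV (\<lambda>x::real. x ^ n)"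
proof (induction n)
  case 0
  then show ?case by (simp add: Ck_on_const del: Ck_on.simps)
next
  case (Suc n)
  then show ?case
    using Ck_on_bilinear[OF bounded_bilinear_mult open_UNIV Ck_on_bounded_linear[OF bounded_linear_ident open_UNIV]]
    by (simp del: Ck_on.simps)
qed

context Reeb_data
begin

lemma Ck_on_phi_pow: "Ck_on k {0<..} (\<phi> ^^ n)" and Ck_on_psi_pow: "Ck_on k {0<..} (\<psi> ^^ n)"
proof -
  have *: "Ck_on k {0<..} (f ^^ n)" if "smooth_on {0..} f" "\<And>x. x > 0 \<Longrightarrow> f x > 0" for f :: "real \<Rightarrow> real"
  proof (induction n)
    case 0
    then show ?case by (simp add: id_def Ck_on_bounded_linear[OF bounded_linear_ident] del: Ck_on.simps)
  next
    case (Suc n)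
    have "(f ^^ n) x > 0" if "x > 0" for x
      by (induction n) (use that \<open>\<And>x. x > 0 \<Longrightarrow> f x > 0\<close> in auto)
    then have "(f ^^ n) ` {0<..} \<subseteq> {0<..}" by auto
    moreover have "Ck_on k {0<..} f" by (rule smooth_on_imp_Ck_on[OF that(1)]) auto
    ultimately show ?case
      using Ck_on_compose[of "{0<..}" "{0<..}" "f ^^ n" k f] Suc by (simp add: o_def del: Ck_on.simps)
  qed
  show "Ck_on k {0<..} (\<phi> ^^ n)" using * phi_smooth phi_pos by blast
  show "Ck_on k {0<..} (\<psi> ^^ n)" using * psi_smooth psi_pos by blast
qed

text \<open>
  A function supported in the fundamental domain \<open>(1, \<phi> 1)\<close> is spread over the half line by the
  equation. Both series are locally finite on \<open>(0, \<infinity>)\<close>; smoothness at \<open>0\<close> is the flatness result.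
\<close>

lemma solution_extending:
  fixes h :: "real \<Rightarrow> complex"
  assumes h: "\<And>k. Ck_on k UNIV h" and supp: "\<And>x. h x \<noteq> 0 \<Longrightarrow> 1 < x \<and> x < \<phi> 1"
  obtains \<beta> where "smooth_on {0..} \<beta>" "\<forall>x\<le>0. \<beta> x = 0" "\<forall>x\<ge>0. \<beta> (\<phi> x) = lam * \<beta> x"
    "\<forall>x. 1 < x \<longrightarrow> x < \<phi> 1 \<longrightarrow> \<beta> x = h x"
proof -
  \<comment> \<open>The solution is the sum of \<open>\<lambda>\<^sup>-\<^sup>n h (\<phi>\<^sup>n x)\<close> over all integers \<open>n\<close>, split into \<open>n \<ge> 0\<close> and \<open>n < 0\<close>.\<close>
  define a where "a = (\<lambda>n x. inverse lam ^ n * h ((\<phi> ^^ n) x))"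
  define b where "b = (\<lambda>n x. lam ^ Suc n * h ((\<psi> ^^ Suc n) x))"
  define \<beta> where "\<beta> = (\<lambda>x. if x > 0 then (\<Sum>n. a n x) + (\<Sum>n. b n x) else 0)"
  have a_fin: "\<exists>N. \<forall>n\<ge>N. \<forall>x\<ge>c. a n x = 0" if c: "c > 0" for c
  proof -
    obtain N where N: "\<forall>n\<ge>N. (\<phi> ^^ n) c > \<phi> 1"
      using phi_pow_eventually_greater[OF c phi_pos[OF zero_less_one]] by blast
    have "a n x = 0" if "n \<ge> N" "x \<ge> c" for n x
    proof -
      have "(\<phi> ^^ n) x \<ge> (\<phi> ^^ n) c"
        using phi_pow_strict_mono[of c x n] that c by (cases "x = c") auto
      then have "h ((\<phi> ^^ n) x) = 0" using N that supp by force
      then show ?thesis by (simp add: a_def)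
    qed
    then show ?thesis by blast
  qed
  have b_fin: "\<exists>N. \<forall>n\<ge>N. \<forall>x. 0 < x \<longrightarrow> x \<le> c \<longrightarrow> b n x = 0" if c: "c > 0" for c
  proof -
    obtain N where N: "\<forall>n\<ge>N. (\<psi> ^^ n) c < 1"
      using psi_pow_eventually_less[OF c zero_less_one] by blast
    have "b n x = 0" if "n \<ge> N" "0 < x" "x \<le> c" for n x
    proof -
      have "(\<psi> ^^ Suc n) x \<le> (\<psi> ^^ Suc n) c"
        using psi_pow_strict_mono[of x c "Suc n"] that c by (cases "x = c") auto
      moreover have "(\<psi> ^^ Suc n) c < 1" using N that le_SucI by blast
      ultimately have "h ((\<psi> ^^ Suc n) x) = 0" using supp by force
      then show ?thesis by (simp add: b_def)
    qed
    then show ?thesis by blast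
  qed
  have a_sum: "summable (\<lambda>n. a n x)" and b_sum: "summable (\<lambda>n. b n x)" if pos: "x > 0" for x
  proof -
    obtain N where "\<forall>n\<ge>N. a n x = 0" using a_fin[OF pos] by blast
    then show "summable (\<lambda>n. a n x)" by (intro summable_finite[of "{..<N}"]) auto
    obtain N where "\<forall>n\<ge>N. b n x = 0" using b_fin[OF pos] pos by blast
    then show "summable (\<lambda>n. b n x)" by (intro summable_finite[of "{..<N}"]) auto
  qed
  have zero: "\<forall>x\<le>0. \<beta> x = 0" by (simp add: \<beta>_def)
  have eq: "\<beta> (\<phi> x) = lam * \<beta> x" if x: "x > 0" for x
  proof -
    have "a n (\<phi> x) = lam * a (Suc n) x" for n
      using lam_nonzero by (simp add: a_def funpow_swap1)
    then have "(\<Sum>n. a n (\<phi> x)) = lam * (\<Sum>n. a (Suc n) x)"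
      using suminf_mult[of "\<lambda>n. a (Suc n) x" lam] summable_Suc_iff[of "\<lambda>n. a n x"] a_sum[OF x] by simp
    then have A: "(\<Sum>n. a n (\<phi> x)) = lam * ((\<Sum>n. a n x) - h x)"
      using suminf_split_head[OF a_sum[OF x]] by (simp add: a_def)
    have "b (Suc n) (\<phi> x) = lam * b n x" for n
      using x by (simp add: b_def funpow_swap1 psi_phi)
    then have "(\<Sum>n. b (Suc n) (\<phi> x)) = lam * (\<Sum>n. b n x)"
      using b_sum[OF x] by (simp add: suminf_mult)
    moreover have "b 0 (\<phi> x) = lam * h x" using x by (simp add: b_def psi_phi)
    ultimately have "(\<Sum>n. b n (\<phi> x)) = lam * (\<Sum>n. b n x) + lam * h x"
      using suminf_split_head[OF b_sum[OF phi_pos[OF x]]] by (simp add: algebra_simps)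
    with A show ?thesis
      using x phi_pos[OF x] by (simp add: \<beta>_def algebra_simps)
  qed
  have eq0: "\<forall>x\<ge>0. \<beta> (\<phi> x) = lam * \<beta> x"
  proof (intro allI impI)
    fix x :: real assume "x \<ge> 0"
    then show "\<beta> (\<phi> x) = lam * \<beta> x"
      using eq[of x] zero phi_0 by (cases "x = 0") auto
  qed
  have ext: "\<beta> x = h x" if x: "1 < x" "x < \<phi> 1" for x
  proof -
    have "a n x = 0" if "n \<noteq> 0" for n
    proof -
      obtain m where m: "n = Suc m" using \<open>n \<noteq> 0\<close> by (cases n) auto
      have "\<phi> 1 < \<phi> x" using phi_strict_mono[of 1 x] x by simp
      also have "\<phi> x \<le> (\<phi> ^^ n) x"
        unfolding m
      proof (induction m)
        case (Suc m)
        then show ?case using phi_gt[OF phi_pow_pos[of x "Suc m"]] x by simp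
      qed simp
      finally have "h ((\<phi> ^^ n) x) = 0" using supp by force
      then show ?thesis by (simp add: a_def)
    qed
    then have "(\<Sum>n. a n x) = h x"
      using suminf_finite[of "{0}" "\<lambda>n. a n x"] by (simp add: a_def)
    moreover have "b n x = 0" for n
    proof -
      have "(\<psi> ^^ Suc n) x \<le> \<psi> x"
      proof (induction n)
        case (Suc n)
        then show ?case using psi_lt[OF psi_pow_pos[of x "Suc n"]] x by simp
      qed simp
      also have "\<psi> x < 1" using psi_strict_mono[of x "\<phi> 1"] psi_phi[of 1] x by simp
      finally have "h ((\<psi> ^^ Suc n) x) = 0" using supp by force
      then show ?thesis by (simp add: b_def)
    qed
    ultimately show ?thesis using x by (simp add: \<beta>_def)
  qed
  have smooth_pos: "Ck_on k {0<..} \<beta>" for k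
  proof (rule Ck_on_local)
    fix x :: real assume "x \<in> {0<..}"
    then have x: "x > 0" by simp
    obtain N1 where N1: "\<forall>n\<ge>N1. \<forall>y\<ge>x/2. a n y = 0" using a_fin[of "x/2"] x by auto
    obtain N2 where N2: "\<forall>n\<ge>N2. \<forall>y. 0 < y \<longrightarrow> y \<le> 2*x \<longrightarrow> b n y = 0" using b_fin[of "2*x"] x by auto
    let ?V = "{x/2<..<2*x}"
    have sub: "?V \<subseteq> {0<..}" using x by auto
    have "Ck_on k ?V (\<lambda>y. (\<Sum>n<N1. a n y) + (\<Sum>n<N2. b n y))"
      unfolding a_def b_def
      by (intro Ck_on_add Ck_on_sum Ck_on_bilinear[OF bounded_bilinear_mult] Ck_on_const
          Ck_on_compose[OF _ open_UNIV _ h] Ck_on_subset[OF Ck_on_phi_pow sub]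
          Ck_on_subset[OF Ck_on_psi_pow sub] open_greaterThanLessThan subset_UNIV)
    then have "Ck_on k ?V \<beta>"
    proof (rule Ck_on_cong_imp[rotated -1])
      fix y assume y: "y \<in> ?V"
      have "(\<Sum>n. a n y) = (\<Sum>n<N1. a n y)"
        using N1 y by (intro suminf_finite) auto
      moreover have "(\<Sum>n. b n y) = (\<Sum>n<N2. b n y)"
        using N2 y x by (intro suminf_finite) auto
      ultimately show "(\<Sum>n<N1. a n y) + (\<Sum>n<N2. b n y) = \<beta> y"
        using y x by (simp add: \<beta>_def)
    qed simp
    then show "\<exists>V. open V \<and> x \<in> V \<and> Ck_on k V \<beta>"
      using x by (intro exI[of _ ?V]) simp
  qed
  have "smooth_on {0..} \<beta>"
    by (rule smooth_onI[OF open_UNIV subset_UNIV smooth_of_equation[OF smooth_pos]])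
       (use zero eq in auto)
  then show thesis
    using that zero eq0 ext by blast
qed

lemma solution_of_monomial:
  obtains \<beta> where "(\<beta>, 0) \<in> S_space \<phi> lam"
    "\<forall>x. 1 < x \<longrightarrow> x < \<phi> 1 \<longrightarrow> \<beta> x = complex_of_real (x ^ j * (flat_exp 0 (x - 1) * flat_exp 0 (\<phi> 1 - x)))"
proof -
  let ?h = "\<lambda>x. complex_of_real (x ^ j * (flat_exp 0 (x - 1) * flat_exp 0 (\<phi> 1 - x)))"
  have 1: "Ck_on k UNIV (\<lambda>x. flat_exp 0 (x - 1))" for k
    using Ck_on_affine_compose[OF bounded_linear_ident open_UNIV open_UNIV subset_UNIV Ck_on_flat_exp, of k 0 "-1"]
    by (simp del: Ck_on.simps)
  have 2: "Ck_on k UNIV (\<lambda>x. flat_exp 0 (\<phi> 1 - x))" for k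
    using Ck_on_affine_compose[OF bounded_linear_minus[OF bounded_linear_ident] open_UNIV open_UNIV subset_UNIV
        Ck_on_flat_exp, of k 0 "\<phi> 1"]
    by (simp del: Ck_on.simps)
  have h: "Ck_on k UNIV ?h" for k
    by (intro Ck_on_bounded_linear_compose[OF bounded_linear_of_real] Ck_on_bilinear[OF bounded_bilinear_mult]
        Ck_on_power 1 2 open_UNIV)
  have supp: "1 < x \<and> x < \<phi> 1" if "?h x \<noteq> 0" for x
    using that by (auto simp: flat_exp_def split: if_splits)
  obtain \<beta> where "smooth_on {0..} \<beta>" "\<forall>x\<le>0. \<beta> x = 0" "\<forall>x\<ge>0. \<beta> (\<phi> x) = lam * \<beta> x"
    "\<forall>x. 1 < x \<longrightarrow> x < \<phi> 1 \<longrightarrow> \<beta> x = ?h x"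
    by (rule solution_extending[of ?h]) (rule h, rule supp, assumption, rule that)
  then show thesis
    by (intro that[of \<beta>]) (auto simp: S_space_def zero_fun_def smooth_on_const)
qed

lemma S_space_subspace: "pairs.subspace (S_space \<phi> lam)"
proof (rule pairs.subspaceI)
  show "0 \<in> S_space \<phi> lam"
    by (auto simp: S_space_def zero_prod_def zero_fun_def smooth_on_const)
  show "a + b \<in> S_space \<phi> lam" if "a \<in> S_space \<phi> lam" "b \<in> S_space \<phi> lam" for a b
    using that smooth_on_add
    by (auto simp: S_space_def plus_prod_def plus_fun_def algebra_simps split: prod.splits)
  show "pair_scale c a \<in> S_space \<phi> lam" if "a \<in> S_space \<phi> lam" for c a
    using that smooth_on_bounded_linear_compose[OF _ bounded_linear_mult_right[of c]]
    by (auto simp: S_space_def pair_scale_def algebra_simps split: prod.splits)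
qed

text \<open>
  Multiplying the bump function by the monomials gives linearly independent functions on \<open>(1, \<phi> 1)\<close>,
  because a polynomial with infinitely many zeros vanishes.
\<close>

lemma S_space_infinite_dimensional: "infinite_dimensional_subspace (S_space \<phi> lam)"
  unfolding infinite_dimensional_subspace_def
proof (intro conjI notI S_space_subspace)
  assume "\<exists>B. finite B \<and> B \<subseteq> S_space \<phi> lam \<and> pairs.span B = S_space \<phi> lam"
  then obtain B where B: "finite B" "pairs.span B = S_space \<phi> lam" by blast
  let ?b = "\<lambda>x. flat_exp 0 (x - 1) * flat_exp 0 (\<phi> 1 - x)"
  have "\<forall>j. \<exists>\<beta>. (\<beta>, 0) \<in> S_space \<phi> lam \<and>
      (\<forall>x. 1 < x \<longrightarrow> x < \<phi> 1 \<longrightarrow> \<beta> x = complex_of_real (x ^ j * ?b x))"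
    using solution_of_monomial by metis
  then obtain f where f: "\<And>j. (f j, 0) \<in> S_space \<phi> lam"
      and fx: "\<And>j x. 1 < x \<Longrightarrow> x < \<phi> 1 \<Longrightarrow> f j x = complex_of_real (x ^ j * ?b x)"
    by metis
  have b: "?b x \<noteq> 0" if "1 < x" "x < \<phi> 1" for x
    using that by (simp add: flat_exp_def)
  let ?g = "\<lambda>j. (f j, 0 :: real \<Rightarrow> complex)"
  obtain x0 where x0: "1 < x0" "x0 < \<phi> 1" using dense phi_gt[of 1] by auto
  have inj: "inj ?g"
  proof (rule injI)
    fix i j assume "?g i = ?g j"
    then have "f i x0 = f j x0" by simp
    then have "complex_of_real (x0 ^ i) = complex_of_real (x0 ^ j)" using fx[OF x0] b[OF x0] by simp
    then have "x0 ^ i = x0 ^ j" by (simp only: of_real_eq_iff)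
    then show "i = j" using power_inject_exp[OF x0(1)] by simp
  qed
  define n where "n = card B"
  have "\<not> pairs.dependent (?g ` {..n})"
  proof (rule pairs.independent_if_scalars_zero)
    fix c y assume sum0: "(\<Sum>x\<in>?g ` {..n}. pair_scale (c x) x) = 0" and y: "y \<in> ?g ` {..n}"
    have "(\<Sum>i\<le>n. pair_scale (c (?g i)) (?g i)) = 0"
      using sum0 inj by (subst (asm) sum.reindex) (auto simp: inj_on_def)
    then have fst0: "fst (\<Sum>i\<le>n. pair_scale (c (?g i)) (?g i)) x = 0" for x by simp
    have fst_sum: "fst (\<Sum>i\<le>k. pair_scale (c (?g i)) (?g i)) x = (\<Sum>i\<le>k. c (?g i) * f i x)" for k x
      by (induction k) (simp_all add: pair_scale_def)
    have "(\<Sum>i\<le>n. c (?g i) * complex_of_real x ^ i) = 0" if x: "1 < x" "x < \<phi> 1" for x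
    proof -
      have "(\<Sum>i\<le>n. c (?g i) * complex_of_real x ^ i) * complex_of_real (?b x)
          = (\<Sum>i\<le>n. c (?g i) * f i x)"
        unfolding sum_distrib_right by (rule sum.cong) (simp_all add: fx[OF x])
      also have "\<dots> = 0" using fst0 fst_sum by simp
      finally show ?thesis using b[OF x] by simp
    qed
    then have "complex_of_real ` {1<..<\<phi> 1} \<subseteq> {z. (\<Sum>i\<le>n. c (?g i) * z ^ i) = 0}" by auto
    moreover have "infinite (complex_of_real ` {1<..<\<phi> 1})"
      using phi_gt[of 1] by (subst finite_image_iff) (auto simp: inj_on_def)
    ultimately have "infinite {z. (\<Sum>i\<le>n. c (?g i) * z ^ i) = 0}"
      using finite_subset by blast
    then have "\<forall>i\<le>n. c (?g i) = 0" using polyfun_finite_roots[of "\<lambda>i. c (?g i)" n] by blast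
    then show "c y = 0" using y by auto
  qed simp
  moreover have "?g ` {..n} \<subseteq> pairs.span B" using f B(2) by auto
  ultimately have "card (?g ` {..n}) \<le> card B"
    using pairs.independent_span_bound[OF B(1)] by blast
  moreover have "card (?g ` {..n}) = Suc n"
    using inj by (subst card_image) (auto simp: inj_on_def)
  ultimately show False by (simp add: n_def)
qed

end

section \<open>The action of the deck transformations\<close>

lemma mem_Rtilde: "((z1, z2), x) \<in> Rtilde \<longleftrightarrow> x \<ge> 0 \<and> (x = 0 \<longrightarrow> z1 \<noteq> 0 \<or> z2 \<noteq> 0)"
  by (auto simp: Rtilde_def)

lemma snd_Rtilde_nonneg: "u \<in> Rtilde \<Longrightarrow> snd u \<ge> 0"
  by (auto simp: Rtilde_def)

text \<open>
  The common form of the deck transformations and of the normalised lifts of automorphisms; the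
  coefficient \<open>d\<close> accommodates the Jordan blocks of the powers of \<open>T\<close>. As the form is stable under
  composition, the smoothness and holomorphy of all local lifts can be checked on it once.
\<close>

definition fibred_affine :: "(point \<Rightarrow> point) \<Rightarrow> bool" where
  "fibred_affine \<Phi> \<longleftrightarrow> (\<exists>a d b1 b2 c. smooth_on {0..} b1 \<and> smooth_on {0..} b2 \<and> smooth_on {0..} c \<and>
     c ` {0..} \<subseteq> {0..} \<and>
     (\<forall>z1 z2 x. x \<ge> 0 \<longrightarrow> \<Phi> ((z1, z2), x) = ((a * z1 + d * z2 + b1 x, a * z2 + b2 x), c x)))"

lemma fibred_affineI:
  assumes "smooth_on {0..} b1" "smooth_on {0..} b2" "smooth_on {0..} c" "\<And>x. x \<ge> 0 \<Longrightarrow> c x \<ge> 0"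
    and "\<And>z1 z2 x. x \<ge> 0 \<Longrightarrow> \<Phi> ((z1, z2), x) = ((a * z1 + d * z2 + b1 x, a * z2 + b2 x), c x)"
  shows "fibred_affine \<Phi>"
  unfolding fibred_affine_def
  by (rule exI[of _ a], rule exI[of _ d], rule exI[of _ b1], rule exI[of _ b2], rule exI[of _ c])
     (use assms in auto)

lemma fibred_affine_id: "fibred_affine (\<lambda>u. u)"
  by (rule fibred_affineI[of "\<lambda>_. 0" "\<lambda>_. 0" "\<lambda>x. x" _ 1 0])
     (auto intro: smooth_on_const smooth_on_bounded_linear)

lemma fibred_affine_comp:
  assumes "fibred_affine \<Phi>" "fibred_affine \<Psi>"
  shows "fibred_affine (\<lambda>u. \<Phi> (\<Psi> u))"
proof -
  obtain a d b1 b2 c where 1: "smooth_on {0..} b1" "smooth_on {0..} b2" "smooth_on {0..} c"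
     "c ` {0..} \<subseteq> {0..}"
     "\<And>z1 z2 x. x \<ge> 0 \<Longrightarrow> \<Phi> ((z1, z2), x) = ((a * z1 + d * z2 + b1 x, a * z2 + b2 x), c x)"
    using assms(1) unfolding fibred_affine_def by blast
  obtain a' d' b1' b2' c' where 2: "smooth_on {0..} b1'" "smooth_on {0..} b2'" "smooth_on {0..} c'"
     "c' ` {0..} \<subseteq> {0..}"
     "\<And>z1 z2 x. x \<ge> 0 \<Longrightarrow> \<Psi> ((z1, z2), x) = ((a' * z1 + d' * z2 + b1' x, a' * z2 + b2' x), c' x)"
    using assms(2) unfolding fibred_affine_def by blast
  have lin: "smooth_on {0..} (\<lambda>x. k * f x)" if "smooth_on {0..} f" for k :: complex and f :: "real \<Rightarrow> complex"
    using smooth_on_bounded_linear_compose[OF that bounded_linear_mult_right[of k]] .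
  show ?thesis
  proof (rule fibred_affineI[of "\<lambda>x. a * b1' x + d * b2' x + b1 (c' x)" "\<lambda>x. a * b2' x + b2 (c' x)"
        "\<lambda>x. c (c' x)" _ "a * a'" "a * d' + d * a'"])
    show "\<Phi> (\<Psi> ((z1, z2), x)) = ((a * a' * z1 + (a * d' + d * a') * z2 +
        (a * b1' x + d * b2' x + b1 (c' x)), a * a' * z2 + (a * b2' x + b2 (c' x))), c (c' x))"
      if "x \<ge> 0" for z1 z2 x
      using 1(5)[of "c' x"] 2(5)[OF that] 2(4) that by (auto simp: algebra_simps)
    show "smooth_on {0..} (\<lambda>x. a * b1' x + d * b2' x + b1 (c' x))"
      by (intro smooth_on_add lin smooth_on_compose[OF _ 2(3,4)] 1(1) 2(1,2))
    show "smooth_on {0..} (\<lambda>x. a * b2' x + b2 (c' x))"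
      by (intro smooth_on_add lin smooth_on_compose[OF _ 2(3,4)] 1(2) 2(2))
    show "smooth_on {0..} (\<lambda>x. c (c' x))"
      by (rule smooth_on_compose[OF 1(3) 2(3,4)])
    show "c (c' x) \<ge> 0" if "x \<ge> 0" for x
      using 1(4) 2(4) that by (simp add: image_subset_iff)
  qed
qed

lemma fibred_affine_funpow:
  assumes "fibred_affine \<Phi>"
  shows "fibred_affine (\<Phi> ^^ n)"
proof (induction n)
  case 0
  then show ?case using fibred_affine_id by (simp add: id_def)
next
  case (Suc n)
  then show ?case using fibred_affine_comp[OF assms] by (simp add: o_def)
qed

lemma bounded_linear_coordinates:
  "bounded_linear (\<lambda>u::point. fst (fst u))" "bounded_linear (\<lambda>u::point. snd (fst u))"
  by (rule bounded_linear_fst_comp bounded_linear_snd_comp bounded_linear_fst)+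

lemma fibred_affine_smooth:
  assumes "fibred_affine \<Phi>"
  shows "smooth_on Rtilde \<Phi>"
proof -
  obtain a d b1 b2 c where 1: "smooth_on {0..} b1" "smooth_on {0..} b2" "smooth_on {0..} c"
     "c ` {0..} \<subseteq> {0..}"
     "\<And>z1 z2 x. x \<ge> 0 \<Longrightarrow> \<Phi> ((z1, z2), x) = ((a * z1 + d * z2 + b1 x, a * z2 + b2 x), c x)"
    using assms unfolding fibred_affine_def by blast
  have snd: "smooth_on Rtilde (snd :: point \<Rightarrow> real)"
    by (rule smooth_on_bounded_linear[OF bounded_linear_snd])
  have img: "snd ` Rtilde \<subseteq> {0..}" using snd_Rtilde_nonneg by auto
  have lin: "smooth_on Rtilde (\<lambda>u. k * f u)" if "bounded_linear f" for k :: complex and f :: "point \<Rightarrow> complex"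
    using smooth_on_bounded_linear[OF bounded_linear_compose[OF bounded_linear_mult_right that]] .
  have "smooth_on Rtilde (\<lambda>u. ((a * fst (fst u) + d * snd (fst u) + b1 (snd u), a * snd (fst u) + b2 (snd u)), c (snd u)))"
    by (intro smooth_on_Pair smooth_on_add lin bounded_linear_coordinates
        smooth_on_compose[OF _ snd img] 1(1,2,3))
  then show ?thesis
    by (rule smooth_on_cong) (use 1(5) in \<open>auto simp: Rtilde_def\<close>)
qed

lemma fibred_affine_continuous: "fibred_affine \<Phi> \<Longrightarrow> continuous_on Rtilde \<Phi>"
  using fibred_affine_smooth smooth_on_imp_continuous_on by blast

lemma fibred_affine_slice:
  assumes "fibred_affine \<Phi>" "x \<ge> 0"
  shows "holomorphic2_on (\<lambda>z. fst (\<Phi> (z, x))) U" "snd (\<Phi> (z, x)) = snd (\<Phi> (w, x))"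
proof -
  obtain a d b1 b2 c where 1:
     "\<And>z1 z2 x. x \<ge> 0 \<Longrightarrow> \<Phi> ((z1, z2), x) = ((a * z1 + d * z2 + b1 x, a * z2 + b2 x), c x)"
    using assms unfolding fibred_affine_def by blast
  have eq: "(\<lambda>z. fst (\<Phi> (z, x))) = (\<lambda>z. (a * fst z + d * snd z + b1 x, a * snd z + b2 x))"
    using 1[OF assms(2)] by (auto simp: fun_eq_iff)
  show "holomorphic2_on (\<lambda>z. fst (\<Phi> (z, x))) U"
    unfolding holomorphic2_on_def eq
  proof (intro ballI exI conjI allI)
    fix z :: "complex \<times> complex"
    show "((\<lambda>z. (a * fst z + d * snd z + b1 x, a * snd z + b2 x)) has_derivative
        (\<lambda>v. (a * fst v + d * snd v, a * snd v))) (at z)"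
      by (auto intro!: derivative_eq_intros)
  qed (auto simp: algebra_simps)
  show "snd (\<Phi> (z, x)) = snd (\<Phi> (w, x))"
    using 1[OF assms(2)] by (cases z; cases w) simp
qed

text \<open>
  For such a map the local lifts demanded in \<^const>\<open>smooth_map\<close> and \<^const>\<open>holomorphic_on_leaf\<close> are
  restrictions of global ones.
\<close>

definition has_fibred_affine_lifts :: "(point \<Rightarrow> 'x) \<Rightarrow> ('x \<Rightarrow> 'x) \<Rightarrow> bool" where
  "has_fibred_affine_lifts \<pi> f \<longleftrightarrow> (\<forall>u\<in>Rtilde. \<forall>v\<in>Rtilde. \<pi> v = f (\<pi> u) \<longrightarrow>
     (\<exists>\<Phi>. fibred_affine \<Phi> \<and> \<Phi> u = v \<and> (\<forall>w\<in>Rtilde. \<Phi> w \<in> Rtilde \<and> \<pi> (\<Phi> w) = f (\<pi> w))))"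

lemma has_fibred_affine_lifts_smooth_map:
  assumes "has_fibred_affine_lifts \<pi> f"
  shows "smooth_map \<pi> f"
  unfolding smooth_map_def
proof (intro ballI impI)
  fix u v assume "u \<in> Rtilde" "v \<in> Rtilde" "\<pi> v = f (\<pi> u)"
  then obtain \<Phi> where \<Phi>: "fibred_affine \<Phi>" "\<Phi> u = v" "\<forall>w\<in>Rtilde. \<Phi> w \<in> Rtilde \<and> \<pi> (\<Phi> w) = f (\<pi> w)"
    using assms unfolding has_fibred_affine_lifts_def by blast
  show "\<exists>U F. open U \<and> u \<in> U \<and> smooth_on (U \<inter> Rtilde) F \<and> F u = v \<and>
      (\<forall>u'\<in>U \<inter> Rtilde. F u' \<in> Rtilde \<and> \<pi> (F u') = f (\<pi> u'))"
    using \<Phi> fibred_affine_smooth by (intro exI[of _ UNIV] exI[of _ \<Phi>]) simp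
qed

lemma open_Rtilde_slice: "open {z. (z, x) \<in> Rtilde}"
proof -
  have "{z. (z, x) \<in> Rtilde} = (if x > 0 then UNIV else if x = 0 then UNIV - {(0, 0)} else {})"
    by (auto simp: Rtilde_def)
  then show ?thesis by (simp add: open_delete)
qed

lemma has_fibred_affine_lifts_holomorphic:
  assumes "has_fibred_affine_lifts \<pi> f"
  shows "holomorphic_on_leaf \<pi> f L"
  unfolding holomorphic_on_leaf_def
proof (intro allI impI)
  fix z x w y assume zx: "(z, x) \<in> Rtilde" and wy: "(w, y) \<in> Rtilde" "\<pi> (w, y) = f (\<pi> (z, x))"
  then obtain \<Phi> where \<Phi>: "fibred_affine \<Phi>" "\<Phi> (z, x) = (w, y)"
      "\<forall>w\<in>Rtilde. \<Phi> w \<in> Rtilde \<and> \<pi> (\<Phi> w) = f (\<pi> w)"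
    using assms unfolding has_fibred_affine_lifts_def by blast
  have x: "x \<ge> 0" using snd_Rtilde_nonneg[OF zx] by simp
  have y: "(fst (\<Phi> (z', x)), y) = \<Phi> (z', x)" for z'
    using fibred_affine_slice(2)[OF \<Phi>(1) x, of z' z] \<Phi>(2) by (metis prod.collapse snd_conv)
  show "\<exists>U h. open U \<and> z \<in> U \<and> holomorphic2_on h U \<and> h z = w \<and>
      (\<forall>z'\<in>U. (z', x) \<in> Rtilde \<and> (h z', y) \<in> Rtilde \<and> \<pi> (h z', y) = f (\<pi> (z', x)))"
    using zx \<Phi>(2,3) fibred_affine_slice(1)[OF \<Phi>(1) x] open_Rtilde_slice
    by (intro exI[of _ "{z. (z, x) \<in> Rtilde}"] exI[of _ "\<lambda>z. fst (\<Phi> (z, x))"]) (auto simp: y)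
qed

context Reeb_data
begin

definition T :: "point \<Rightarrow> point" where "T = LC_T lam lam 1 1 \<phi>"

definition T_inv :: "point \<Rightarrow> point" where
  "T_inv = (\<lambda>((z1, z2), x). ((inverse lam * z1 + (- (inverse lam)\<^sup>2) * z2, inverse lam * z2), \<psi> x))"

lemma T_apply: "T ((z1, z2), x) = ((lam * z1 + z2, lam * z2), \<phi> x)"
  by (simp add: T_def LC_T_def)

lemma T_inv_apply:
  "T_inv ((z1, z2), x) = ((inverse lam * z1 + (- (inverse lam)\<^sup>2) * z2, inverse lam * z2), \<psi> x)"
  by (simp add: T_inv_def)

lemma fibred_affine_T: "fibred_affine T"
  by (rule fibred_affineI[of "\<lambda>_. 0" "\<lambda>_. 0" \<phi> _ lam 1])
     (auto intro: smooth_on_const phi_smooth phi_nonneg simp: T_apply)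

lemma fibred_affine_T_inv: "fibred_affine T_inv"
  by (rule fibred_affineI[of "\<lambda>_. 0" "\<lambda>_. 0" \<psi> _ "inverse lam" "- (inverse lam)\<^sup>2"])
     (auto intro: smooth_on_const psi_smooth psi_nonneg simp: T_inv_apply)

lemma T_inv_T: "u \<in> Rtilde \<Longrightarrow> T_inv (T u) = u"
proof -
  assume u: "u \<in> Rtilde"
  obtain z1 z2 x where eq: "u = ((z1, z2), x)" by (metis prod.exhaust)
  show ?thesis
    using snd_Rtilde_nonneg[OF u] lam_nonzero unfolding eq T_apply T_inv_apply
    by (simp add: psi_phi field_simps power2_eq_square)
qed

lemma T_T_inv: "u \<in> Rtilde \<Longrightarrow> T (T_inv u) = u"
proof -
  assume u: "u \<in> Rtilde"
  obtain z1 z2 x where eq: "u = ((z1, z2), x)" by (metis prod.exhaust)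
  show ?thesis
    using snd_Rtilde_nonneg[OF u] lam_nonzero unfolding eq T_apply T_inv_apply
    by (simp add: phi_psi field_simps power2_eq_square)
qed

lemma T_mem: "u \<in> Rtilde \<Longrightarrow> T u \<in> Rtilde"
proof -
  assume u: "u \<in> Rtilde"
  obtain z1 z2 x where eq: "u = ((z1, z2), x)" by (metis prod.exhaust)
  show "T u \<in> Rtilde"
    using u lam_nonzero phi_pos[of x] phi_nonneg[of x] unfolding eq T_apply mem_Rtilde by fastforce
qed

lemma T_inv_mem: "u \<in> Rtilde \<Longrightarrow> T_inv u \<in> Rtilde"
proof -
  assume u: "u \<in> Rtilde"
  obtain z1 z2 x where eq: "u = ((z1, z2), x)" by (metis prod.exhaust)
  show "T_inv u \<in> Rtilde"
    using u lam_nonzero psi_pos[of x] psi_nonneg[of x] unfolding eq T_inv_apply mem_Rtilde by fastforce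
qed

definition Tz :: "int \<Rightarrow> point \<Rightarrow> point" where
  "Tz n = (if 0 \<le> n then T ^^ nat n else T_inv ^^ nat (- n))"

lemma fibred_affine_Tz: "fibred_affine (Tz n)"
  by (simp add: Tz_def fibred_affine_funpow fibred_affine_T fibred_affine_T_inv)

lemma T_pow_mem: "u \<in> Rtilde \<Longrightarrow> (T ^^ n) u \<in> Rtilde"
  by (induction n) (auto intro: T_mem)

lemma T_inv_pow_mem: "u \<in> Rtilde \<Longrightarrow> (T_inv ^^ n) u \<in> Rtilde"
  by (induction n) (auto intro: T_inv_mem)

lemma Tz_mem: "u \<in> Rtilde \<Longrightarrow> Tz n u \<in> Rtilde"
  by (simp add: Tz_def T_pow_mem T_inv_pow_mem)

lemma Tz_0: "Tz 0 u = u"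
  by (simp add: Tz_def)

lemma Tz_of_nat: "Tz (int n) = T ^^ n"
  by (simp add: Tz_def)

lemma Tz_plus_1:
  assumes u: "u \<in> Rtilde"
  shows "Tz (n + 1) u = T (Tz n u)"
proof (cases "n \<ge> 0")
  case True
  then show ?thesis by (simp add: Tz_def nat_add_distrib)
next
  case False
  define k where "k = nat (- n - 1)"
  have n: "n = - int (Suc k)" using False by (simp add: k_def)
  have "T (Tz n u) = (T_inv ^^ k) u"
    using T_T_inv[OF T_inv_pow_mem[OF u, of k]] by (simp add: n Tz_def nat_add_distrib)
  also have "\<dots> = Tz (n + 1) u" by (cases k) (simp_all add: n Tz_def nat_add_distrib)
  finally show ?thesis by simp
qed

lemma Tz_minus_1: "u \<in> Rtilde \<Longrightarrow> Tz (n - 1) u = T_inv (Tz n u)"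
  using Tz_plus_1[of u "n - 1"] T_inv_T[OF Tz_mem, of u "n - 1"] by simp

lemma Tz_add:
  assumes u: "u \<in> Rtilde"
  shows "Tz (m + n) u = Tz m (Tz n u)"
proof (induction m rule: int_induct[of _ 0])
  case base
  show ?case by (simp add: Tz_0)
next
  case (step1 i)
  then show ?case
    using Tz_plus_1[OF u, of "i + n"] Tz_plus_1[OF Tz_mem[OF u], of i n] by (simp add: algebra_simps)
next
  case (step2 i)
  then show ?case
    using Tz_minus_1[OF u, of "i + n"] Tz_minus_1[OF Tz_mem[OF u], of i n] by (simp add: algebra_simps)
qed

lemma orbit_eq_range:
  assumes u: "u \<in> Rtilde"
  shows "orbit T u = range (\<lambda>n. Tz n u)"
proof (intro equalityI subsetI)
  fix v assume "v \<in> orbit T u"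
  then obtain n where v: "v \<in> Rtilde" and "v = (T ^^ n) u \<or> u = (T ^^ n) v"
    by (auto simp: orbit_def)
  then consider "v = Tz (int n) u" | "u = Tz (int n) v" by (auto simp: Tz_of_nat)
  then show "v \<in> range (\<lambda>n. Tz n u)"
  proof cases
    case 2
    then have "Tz (- int n) u = v" using Tz_add[OF v, of "- int n" "int n"] by (simp add: Tz_0)
    then show ?thesis by blast
  qed blast
next
  fix v assume "v \<in> range (\<lambda>n. Tz n u)"
  then obtain n where v: "v = Tz n u" by blast
  have mem: "v \<in> Rtilde" using v Tz_mem u by simp
  show "v \<in> orbit T u"
  proof (cases "n \<ge> 0")
    case True
    then have "v = (T ^^ nat n) u" using v by (simp add: Tz_def)
    then show ?thesis using mem by (auto simp: orbit_def)
  next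
    case False
    then have "u = Tz (- n) v" using v Tz_add[OF u, of "- n" n] by (simp add: Tz_0)
    then have "u = (T ^^ nat (- n)) v" using False by (simp add: Tz_def)
    then show ?thesis using mem by (auto simp: orbit_def)
  qed
qed

lemma orbit_eq_iff:
  assumes "u \<in> Rtilde" "v \<in> Rtilde"
  shows "orbit T u = orbit T v \<longleftrightarrow> (\<exists>n. v = Tz n u)"
proof
  assume "orbit T u = orbit T v"
  moreover have "v \<in> orbit T v" using orbit_eq_range[OF assms(2)] Tz_0[of v] by (metis rangeI)
  ultimately show "\<exists>n. v = Tz n u" using orbit_eq_range[OF assms(1)] by auto
next
  assume "\<exists>n. v = Tz n u"
  then obtain n where v: "v = Tz n u" by blast
  have "range (\<lambda>m. Tz m v) = range (\<lambda>m. Tz (m + n) u)" using Tz_add[OF assms(1)] v by simp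
  also have "\<dots> = (\<lambda>m. Tz m u) ` range (\<lambda>m. m + n)" by (simp only: image_image)
  also have "range (\<lambda>m. m + n) = UNIV" by (rule surjI[of _ "\<lambda>m. m - n"]) simp
  finally show "orbit T u = orbit T v" using orbit_eq_range assms by simp
qed

lemma orbit_Tz: "u \<in> Rtilde \<Longrightarrow> orbit T (Tz n u) = orbit T u"
  using orbit_eq_iff Tz_mem by metis

lemma orbit_T: "u \<in> Rtilde \<Longrightarrow> orbit T (T u) = orbit T u"
  using orbit_Tz[of u 1] Tz_plus_1[of u 0] Tz_0 by simp

text \<open>
  Because of the Jordan block, \<open>T\<close> need not expand the usual norm of the leaf coordinate; giving the
  second coordinate a large weight repairs this. With the weight \<open>w = 2 / (|\<lambda>| - 1)\<close> and the factor
  \<open>\<rho> = (|\<lambda>| + 1) / 2\<close> one has \<open>\<rho> w = |\<lambda>| w - 1\<close>, so the growth of the second coordinate exactly covers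
  what \<open>|\<lambda> z\<^sub>1 + z\<^sub>2|\<close> can lose.
\<close>

definition leaf_norm :: "complex \<times> complex \<Rightarrow> real" where
  "leaf_norm z = norm (fst z) + 2 / (norm lam - 1) * norm (snd z)"

definition expansion :: real where "expansion = (norm lam + 1) / 2"

lemma expansion_gt_1: "expansion > 1"
  using lam by (simp add: expansion_def)

lemma leaf_norm_nonneg: "leaf_norm z \<ge> 0"
  using lam by (simp add: leaf_norm_def)

lemma leaf_norm_pos: "z \<noteq> (0, 0) \<Longrightarrow> leaf_norm z > 0"
  using lam by (cases z) (auto simp: leaf_norm_def add_pos_nonneg add_nonneg_pos)

lemma leaf_norm_T: "leaf_norm (fst (T u)) \<ge> expansion * leaf_norm (fst u)"
proof -
  obtain z1 z2 x where u: "u = ((z1, z2), x)" by (metis prod.exhaust)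
  have "norm (lam * z1) \<le> norm (lam * z1 + z2) + norm z2"
    using norm_triangle_ineq4[of "lam * z1 + z2" z2] by simp
  then have 1: "norm (lam * z1 + z2) \<ge> norm lam * norm z1 - norm z2" by (simp add: norm_mult)
  have "expansion * norm z1 \<le> norm lam * norm z1"
    using lam by (intro mult_right_mono) (auto simp: expansion_def)
  moreover have "expansion * (2 / (norm lam - 1) * norm z2) = 2 / (norm lam - 1) * (norm lam * norm z2) - norm z2"
    using lam by (simp add: expansion_def field_simps)
  ultimately show ?thesis
    using 1 unfolding u T_apply leaf_norm_def by (simp add: norm_mult distrib_left)
qed

lemma leaf_norm_T_pow: "leaf_norm (fst ((T ^^ Suc k) u)) \<ge> expansion * leaf_norm (fst u)"
proof (induction k)
  case 0
  then show ?case using leaf_norm_T by simp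
next
  case (Suc k)
  have "leaf_norm (fst ((T ^^ Suc k) u)) \<le> expansion * leaf_norm (fst ((T ^^ Suc k) u))"
    using expansion_gt_1 leaf_norm_nonneg mult_right_mono[of 1 expansion] by simp
  then show ?case using leaf_norm_T[of "(T ^^ Suc k) u"] Suc by simp
qed

lemma snd_T_pow: "snd ((T ^^ k) u) = (\<phi> ^^ k) (snd u)"
proof (induction k)
  case (Suc k)
  have "snd (T v) = \<phi> (snd v)" for v by (simp add: T_def LC_T_def split: prod.splits)
  then show ?case using Suc by simp
qed simp

lemma continuous_leaf_norm: "continuous_on UNIV (\<lambda>u::point. leaf_norm (fst u))"
  unfolding leaf_norm_def by (intro continuous_intros)

text \<open>
  Proper discontinuity: away from \<open>z = 0\<close> the adapted norm of the leaf coordinate is expanded, and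
  where \<open>x > 0\<close> the transverse coordinate is moved by \<open>\<phi>\<close>.
\<close>

lemma properly_discontinuous:
  assumes v: "v \<in> Rtilde"
  obtains W where "open W" "v \<in> W" "\<forall>w\<in>W \<inter> Rtilde. \<forall>k>0. (T ^^ k) w \<notin> W"
proof -
  obtain z x where vzx: "v = (z, x)" by fastforce
  show thesis
  proof (cases "z = (0, 0)")
    case False
    define n where "n = leaf_norm z"
    have n: "n > 0" using leaf_norm_pos[OF False] by (simp add: n_def)
    \<comment> \<open>A shell \<open>(a, \<rho> a)\<close> around \<open>n\<close>; expansion by at least \<open>\<rho>\<close> leaves it.\<close>
    define a where "a = n * (2 / (1 + expansion))"
    have a: "a < n" "n < expansion * a" "a > 0"
      using n expansion_gt_1 by (auto simp: a_def field_simps)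
    define W where "W = (\<lambda>u::point. leaf_norm (fst u)) -` {a<..<expansion * a}"
    have "open W"
      unfolding W_def by (intro open_vimage open_greaterThanLessThan continuous_leaf_norm)
    moreover have "v \<in> W" using a by (simp add: W_def vzx n_def)
    moreover have "(T ^^ k) w \<notin> W" if "w \<in> W" "k > 0" for w k
    proof -
      obtain j where k: "k = Suc j" using \<open>k > 0\<close> by (cases k) auto
      have "expansion * a < expansion * leaf_norm (fst w)"
        using that expansion_gt_1 by (simp add: W_def)
      then show ?thesis using leaf_norm_T_pow[of w j] unfolding k W_def by auto
    qed
    ultimately show thesis using that by blast
  next
    case True
    then have x: "x > 0" using v by (auto simp: vzx Rtilde_def)
    \<comment> \<open>Any \<open>a\<close> strictly between \<open>\<psi> x\<close> and \<open>x\<close> satisfies \<open>a < x < \<phi> a\<close>.\<close>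
    define a where "a = (\<psi> x + x) / 2"
    have a: "\<psi> x < a" "a < x" "a > 0" using psi_lt[OF x] psi_pos[OF x] by (auto simp: a_def)
    then have "x < \<phi> a" using phi_strict_mono[of "\<psi> x" a] phi_psi[of x] psi_nonneg[of x] x by simp
    define W where "W = (snd :: point \<Rightarrow> real) -` {a<..<\<phi> a}"
    have "open W"
      unfolding W_def by (intro open_vimage open_greaterThanLessThan continuous_on_snd continuous_on_id)
    moreover have "v \<in> W" using a \<open>x < \<phi> a\<close> by (simp add: W_def vzx)
    moreover have "(T ^^ k) w \<notin> W" if "w \<in> W" "k > 0" for w k
    proof -
      obtain j where k: "k = Suc j" using \<open>k > 0\<close> by (cases k) auto
      have w: "snd w > a" using that by (simp add: W_def)
      have "\<phi> a < \<phi> (snd w)" using phi_strict_mono a w by simp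
      also have "\<phi> (snd w) \<le> (\<phi> ^^ Suc j) (snd w)"
      proof (induction j)
        case (Suc j)
        then show ?case using phi_gt[OF phi_pow_pos[of "snd w" "Suc j"]] w a by simp
      qed simp
      finally show ?thesis unfolding k W_def using snd_T_pow[of "Suc j" w] by simp
    qed
    ultimately show thesis using that by blast
  qed
qed

text \<open>Two maps into such a neighbourhood that lift the same map to the quotient are equal.\<close>

lemma orbit_injective_neighbourhood:
  assumes "v \<in> Rtilde"
  obtains W where "open W" "v \<in> W"
    "\<forall>a\<in>W \<inter> Rtilde. \<forall>b\<in>W \<inter> Rtilde. orbit T a = orbit T b \<longrightarrow> a = b"
proof -
  obtain W where W: "open W" "v \<in> W" "\<forall>w\<in>W \<inter> Rtilde. \<forall>k>0. (T ^^ k) w \<notin> W"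
    using assms by (rule properly_discontinuous) (rule that)
  have "a = b" if a: "a \<in> W" "a \<in> Rtilde" and b: "b \<in> W" "b \<in> Rtilde" and eq: "orbit T a = orbit T b" for a b
  proof -
    obtain n where n: "b = Tz n a" using orbit_eq_iff a b eq by blast
    consider "n = 0" | "n > 0" | "n < 0" by linarith
    then show ?thesis
    proof cases
      case 1
      then show ?thesis using n by (simp add: Tz_0)
    next
      case 2
      then have "b = (T ^^ nat n) a" "nat n > 0" using n by (auto simp: Tz_def)
      then show ?thesis using W(3) a b by blast
    next
      case 3
      have "a = Tz (- n) b" using n Tz_add[OF a(2), of "- n" n] by (simp add: Tz_0)
      then have "a = (T ^^ nat (- n)) b" "nat (- n) > 0" using 3 by (auto simp: Tz_def)
      then show ?thesis using W(3) a b by blast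
    qed
  qed
  then show thesis using that[OF W(1,2)] by blast
qed

lemma Tz_free:
  assumes "u \<in> Rtilde" "Tz m u = Tz n u"
  shows "m = n"
proof -
  have *: "False" if "i < j" "Tz i u = Tz j u" for i j
  proof -
    have "Tz i u \<in> Rtilde" using Tz_mem assms by blast
    then obtain W where W: "Tz i u \<in> W" "\<forall>w\<in>W \<inter> Rtilde. \<forall>k>0. (T ^^ k) w \<notin> W"
      by (rule properly_discontinuous) (rule that)
    have "(T ^^ nat (j - i)) (Tz i u) = Tz i u"
      using Tz_add[OF assms(1), of "j - i" i] that by (simp add: Tz_def[of "j - i"])
    then show False using W \<open>Tz i u \<in> Rtilde\<close> that(1) by (metis IntI zero_less_nat_eq diff_gt_0_iff_gt)
  qed
  then show ?thesis using *[of m n] *[of n m] assms(2) by (cases m n rule: linorder_cases) auto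
qed

end

section \<open>Lifting automorphisms to the universal covering\<close>

lemma leaf_tilde_0: "leaf_tilde 0 = (UNIV - {(0, 0)}) \<times> {0}"
  by (auto simp: leaf_tilde_def Rtilde_def)

lemma leaf_tilde_subset: "leaf_tilde x \<subseteq> Rtilde"
  by (auto simp: leaf_tilde_def)

lemma connected_leaf_tilde_0: "connected (leaf_tilde 0)"
proof -
  have "connected (- {(0, 0) :: complex \<times> complex})"
    by (rule connected_punctured_universe) simp
  then show ?thesis
    unfolding leaf_tilde_0 by (intro connected_Times) (auto simp: Compl_eq_Diff_UNIV)
qed

text \<open>
  The missing point lies on the boundary of the half space, so no segment from the interior point
  \<open>(0, 1)\<close> passes through it on the way to another point. Hence \<open>Rtilde\<close> is simply connected.
\<close>

lemma starlike_Rtilde: "starlike Rtilde"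
  unfolding starlike_def
proof (intro bexI ballI subsetI)
  show "((0, 0), 1) \<in> Rtilde" by (simp add: Rtilde_def)
  fix u v assume u: "u \<in> Rtilde" and "v \<in> closed_segment ((0, 0), 1) u"
  then obtain t where t: "0 \<le> t" "t \<le> 1" "v = (1 - t) *\<^sub>R ((0, 0), 1) + t *\<^sub>R u"
    unfolding closed_segment_def by blast
  obtain z x where eq: "u = (z, x)" by fastforce
  have v: "v = (t *\<^sub>R z, (1 - t) + t * x)" using t(3) by (simp add: eq zero_prod_def[symmetric])
  have x: "x \<ge> 0" using snd_Rtilde_nonneg[OF u] by (simp add: eq)
  show "v \<in> Rtilde"
  proof (cases "t = 1")
    case True
    then show ?thesis using u by (simp add: v eq)
  next
    case False
    then have "(1 - t) + t * x > 0" using t x by (simp add: add_pos_nonneg)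
    then show ?thesis by (simp add: v Rtilde_def)
  qed
qed

lemma connected_Rtilde: "connected Rtilde"
  using starlike_imp_connected[OF starlike_Rtilde] .

lemma locally_path_connected_Rtilde: "locally path_connected Rtilde"
proof (rule locally_open_subset)
  show "locally path_connected (UNIV \<times> {0..} :: point set)"
    by (intro convex_imp_locally_path_connected convex_Times) auto
  have "Rtilde = (UNIV \<times> {0..}) \<inter> - {((0, 0), 0)}" by (auto simp: Rtilde_def)
  then show "openin (top_of_set (UNIV \<times> {0..})) Rtilde"
    by (metis open_Compl closed_singleton openin_open_Int)
qed

lemma smooth_map_local_lift:
  assumes "smooth_map \<pi> f" "u \<in> Rtilde" "v \<in> Rtilde" "\<pi> v = f (\<pi> u)"
  obtains U F where "open U" "u \<in> U" "smooth_on (U \<inter> Rtilde) F" "F u = v"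
    "\<forall>w\<in>U \<inter> Rtilde. F w \<in> Rtilde \<and> \<pi> (F w) = f (\<pi> w)"
proof -
  have "\<exists>U F. open U \<and> u \<in> U \<and> smooth_on (U \<inter> Rtilde) F \<and> F u = v \<and>
           (\<forall>u'\<in>U \<inter> Rtilde. F u' \<in> Rtilde \<and> \<pi> (F u') = f (\<pi> u'))"
    using assms(1)[unfolded smooth_map_def, rule_format, OF assms(2-4)] .
  then show thesis by (elim exE conjE) (rule that)
qed

context Reeb_data
begin

lemma lifts_agree_locally:
  fixes A B :: "'a::topological_space \<Rightarrow> point"
  assumes cont: "continuous_on X A" "continuous_on X B" and img: "A ` X \<subseteq> Rtilde" "B ` X \<subseteq> Rtilde"
    and orb: "\<And>u. u \<in> X \<Longrightarrow> orbit T (A u) = orbit T (B u)"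
    and u0: "u0 \<in> X" "A u0 = B u0"
  shows "\<exists>V. open V \<and> u0 \<in> V \<and> (\<forall>u\<in>X \<inter> V. A u = B u)"
proof -
  have "A u0 \<in> Rtilde" using img u0 by blast
  then obtain W where W: "open W" "A u0 \<in> W"
      "\<forall>a\<in>W \<inter> Rtilde. \<forall>b\<in>W \<inter> Rtilde. orbit T a = orbit T b \<longrightarrow> a = b"
    by (rule orbit_injective_neighbourhood) (rule that)
  obtain V1 where V1: "open V1" "V1 \<inter> X = A -` W \<inter> X"
    using cont(1) W(1) unfolding continuous_on_open_invariant by blast
  obtain V2 where V2: "open V2" "V2 \<inter> X = B -` W \<inter> X"
    using cont(2) W(1) unfolding continuous_on_open_invariant by blast
  show ?thesis
  proof (intro exI[of _ "V1 \<inter> V2"] conjI)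
    show "open (V1 \<inter> V2)" using V1 V2 by blast
    show "u0 \<in> V1 \<inter> V2" using V1 V2 u0 W(2) by auto
    show "\<forall>u\<in>X \<inter> (V1 \<inter> V2). A u = B u"
    proof
      fix u assume u: "u \<in> X \<inter> (V1 \<inter> V2)"
      then have "A u \<in> W \<inter> Rtilde" "B u \<in> W \<inter> Rtilde" using V1(2) V2(2) img by blast+
      then show "A u = B u" using W(3) orb u by blast
    qed
  qed
qed

text \<open>The set where two lifts agree is open, by proper discontinuity, and closed.\<close>

lemma lift_unique:
  fixes A B :: "'a::topological_space \<Rightarrow> point"
  assumes X: "connected X"
    and cont: "continuous_on X A" "continuous_on X B" and img: "A ` X \<subseteq> Rtilde" "B ` X \<subseteq> Rtilde"
    and orb: "\<And>u. u \<in> X \<Longrightarrow> orbit T (A u) = orbit T (B u)"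
    and u0: "u0 \<in> X" "A u0 = B u0" and u: "u \<in> X"
  shows "A u = B u"
proof -
  let ?S = "{u \<in> X. A u = B u}"
  have "openin (top_of_set X) ?S"
  proof (subst openin_subopen, intro ballI)
    fix w assume "w \<in> ?S"
    then have w: "w \<in> X" "A w = B w" by auto
    obtain V where V: "open V" "w \<in> V" "\<forall>u\<in>X \<inter> V. A u = B u"
      using lifts_agree_locally[OF cont img orb w] by blast
    show "\<exists>V. openin (top_of_set X) V \<and> w \<in> V \<and> V \<subseteq> ?S"
      using V w by (intro exI[of _ "X \<inter> V"]) (auto simp: openin_open_Int)
  qed
  moreover have "closedin (top_of_set X) ?S"
  proof -
    have "continuous_on X (\<lambda>u. A u - B u)" by (intro continuous_intros cont)
    then have "closedin (top_of_set X) {u \<in> X. A u - B u = 0}"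
      by (rule continuous_closedin_preimage_constant)
    then show ?thesis by simp
  qed
  ultimately have "?S = {} \<or> ?S = X" using X unfolding connected_clopen by blast
  then show ?thesis using u0 u by blast
qed

text \<open>
  The pairs \<open>(u, v)\<close> such that \<open>v\<close> lies over the image of \<open>u\<close> form a covering space of \<open>Rtilde\<close>: over
  the domain of a local lift \<open>F\<close> its sheets are the graphs of the maps \<open>T\<^sup>n \<circ> F\<close>. A global lift is
  a section of this covering.
\<close>

definition lift_pairs :: "(point set \<Rightarrow> point set) \<Rightarrow> (point \<times> point) set" where
  "lift_pairs f = {(u, v). u \<in> Rtilde \<and> v \<in> Rtilde \<and> orbit T v = f (orbit T u)}"

lemma covering_space_lift_pairs:
  assumes f: "f ` orbit T ` Rtilde \<subseteq> orbit T ` Rtilde" and sm: "smooth_map (orbit T) f"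
  shows "covering_space (lift_pairs f) fst Rtilde"
  unfolding covering_space_def
proof (intro conjI ballI)
  show "continuous_on (lift_pairs f) fst" by (intro continuous_intros)
  have ex: "\<exists>v\<in>Rtilde. orbit T v = f (orbit T u)" if "u \<in> Rtilde" for u
    using f that by (metis imageE image_eqI image_subset_iff)
  show "fst ` lift_pairs f = Rtilde"
  proof (intro equalityI subsetI)
    fix u assume u: "u \<in> Rtilde"
    then obtain v where "v \<in> Rtilde" "orbit T v = f (orbit T u)" using ex by blast
    then have "(u, v) \<in> lift_pairs f" using u by (simp add: lift_pairs_def)
    then show "u \<in> fst ` lift_pairs f" by (rule image_eqI[rotated]) simp
  qed (auto simp: lift_pairs_def)
  fix u assume u: "u \<in> Rtilde"
  then obtain v where v: "v \<in> Rtilde" "orbit T v = f (orbit T u)" using ex by blast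
  obtain U F where U: "open U" "u \<in> U" and F: "smooth_on (U \<inter> Rtilde) F"
      "\<forall>w\<in>U \<inter> Rtilde. F w \<in> Rtilde \<and> orbit T (F w) = f (orbit T w)"
    by (rule smooth_map_local_lift[OF sm u v]) (rule that)
  let ?U = "U \<inter> Rtilde"
  define S where "S = (\<lambda>n. (\<lambda>w. (w, Tz n (F w))) ` ?U)"
  have cont: "continuous_on ?U (\<lambda>w. Tz n (F w))" for n
    by (rule continuous_on_compose2[OF fibred_affine_continuous[OF fibred_affine_Tz]
          smooth_on_imp_continuous_on[OF F(1)]]) (use F(2) in auto)
  have S_sub: "S n \<subseteq> lift_pairs f" for n
  proof
    fix p assume "p \<in> S n"
    then obtain w where w: "w \<in> ?U" "p = (w, Tz n (F w))" by (auto simp: S_def)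
    then have "F w \<in> Rtilde" "orbit T (F w) = f (orbit T w)" using F(2) by auto
    then show "p \<in> lift_pairs f" using w Tz_mem orbit_Tz by (simp add: lift_pairs_def)
  qed
  show "\<exists>V. u \<in> V \<and> openin (top_of_set Rtilde) V \<and>
      (\<exists>v. \<Union> v = lift_pairs f \<inter> fst -` V \<and> (\<forall>u\<in>v. openin (top_of_set (lift_pairs f)) u) \<and>
        pairwise disjnt v \<and> (\<forall>u\<in>v. \<exists>q. homeomorphism u V fst q))"
  proof (intro exI[of _ ?U] conjI exI[of _ "range S"] ballI)
    show "u \<in> ?U" using u U by simp
    show "openin (top_of_set Rtilde) ?U" using U(1) by (simp add: Int_commute openin_open_Int)
    show "\<Union> (range S) = lift_pairs f \<inter> fst -` ?U"
    proof (intro equalityI subsetI)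
      fix p assume "p \<in> lift_pairs f \<inter> fst -` ?U"
      then obtain w y where p: "p = (w, y)" "w \<in> ?U" "y \<in> Rtilde" "orbit T y = f (orbit T w)"
        by (auto simp: lift_pairs_def)
      then have "orbit T (F w) = orbit T y" "F w \<in> Rtilde" using F(2) by auto
      then obtain n where "y = Tz n (F w)" using orbit_eq_iff p(3) by blast
      then have "p \<in> S n" using p by (auto simp: S_def)
      then show "p \<in> \<Union> (range S)" by blast
    next
      fix p assume "p \<in> \<Union> (range S)"
      then obtain n where "p \<in> S n" by blast
      then show "p \<in> lift_pairs f \<inter> fst -` ?U" using S_sub[of n] by (auto simp: S_def)
    qed
    show "openin (top_of_set (lift_pairs f)) s" if s_in: "s \<in> range S" for s
    proof -
      obtain n where s: "s = S n" using s_in by blast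
      show ?thesis
        unfolding s
      proof (subst openin_subopen, intro ballI)
        fix p assume "p \<in> S n"
        then obtain w where w: "w \<in> ?U" "p = (w, Tz n (F w))" by (auto simp: S_def)
        have "Tz n (F w) \<in> Rtilde" using Tz_mem F(2) w by blast
        then obtain W where W: "open W" "Tz n (F w) \<in> W"
            "\<forall>a\<in>W \<inter> Rtilde. \<forall>b\<in>W \<inter> Rtilde. orbit T a = orbit T b \<longrightarrow> a = b"
          by (rule orbit_injective_neighbourhood) (rule that)
        obtain O' where O': "open O'" "O' \<inter> ?U = (\<lambda>w. Tz n (F w)) -` W \<inter> ?U"
          using cont[of n] W(1) unfolding continuous_on_open_invariant by blast
        let ?Q = "(O' \<inter> U) \<times> W"
        have "lift_pairs f \<inter> ?Q \<subseteq> S n"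
        proof
          fix q assume "q \<in> lift_pairs f \<inter> ?Q"
          then obtain a b where q: "q = (a, b)" "a \<in> ?U" "a \<in> O'" "b \<in> W" "b \<in> Rtilde"
              "orbit T b = f (orbit T a)"
            by (auto simp: lift_pairs_def)
          have Fa: "F a \<in> Rtilde" "orbit T (F a) = f (orbit T a)" using F(2) q(2) by auto
          have "Tz n (F a) \<in> W" using O'(2) q(2,3) by blast
          then have "b = Tz n (F a)"
            using W(3) q(4-6) Tz_mem[OF Fa(1), of n] orbit_Tz[OF Fa(1), of n] Fa(2) by auto
          then show "q \<in> S n" using q by (auto simp: S_def)
        qed
        moreover have "p \<in> ?Q" using w W(2) O'(2) by auto
        moreover have "open ?Q" using O'(1) U(1) W(1) by (intro open_Times) auto
        ultimately show "\<exists>V. openin (top_of_set (lift_pairs f)) V \<and> p \<in> V \<and> V \<subseteq> S n"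
          using S_sub[of n] \<open>p \<in> S n\<close>
          by (intro exI[of _ "lift_pairs f \<inter> ?Q"]) (auto intro: openin_open_Int)
      qed
    qed
    show "pairwise disjnt (range S)"
    proof (rule pairwiseI)
      fix s t assume "s \<in> range S" "t \<in> range S" "s \<noteq> t"
      then obtain m n where mn: "s = S m" "t = S n" "m \<noteq> n" by blast
      show "disjnt s t"
        unfolding disjnt_def
      proof (rule ccontr)
        assume "s \<inter> t \<noteq> {}"
        then obtain p where "p \<in> S m" "p \<in> S n" unfolding mn by blast
        then obtain w w' where ww: "w \<in> ?U" "p = (w, Tz m (F w))" "p = (w', Tz n (F w'))"
          unfolding S_def by blast
        have "(w, Tz m (F w)) = (w', Tz n (F w'))" using ww(2,3) by metis
        then have "Tz m (F w) = Tz n (F w)" by auto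
        then show False using Tz_free F(2) mn(3) ww(1) by blast
      qed
    qed
    show "\<exists>q. homeomorphism s ?U fst q" if s_in: "s \<in> range S" for s
    proof -
      obtain n where s: "s = S n" using s_in by blast
      have "homeomorphism (S n) ?U fst (\<lambda>w. (w, Tz n (F w)))"
        unfolding homeomorphism_def S_def
        by (intro conjI continuous_intros cont) (auto simp: image_image)
      then show ?thesis unfolding s by blast
    qed
  qed
qed

lemma lift_exists:
  assumes f: "f ` orbit T ` Rtilde \<subseteq> orbit T ` Rtilde" and sm: "smooth_map (orbit T) f"
    and u0: "u0 \<in> Rtilde" "v0 \<in> Rtilde" "orbit T v0 = f (orbit T u0)"
  obtains F where "continuous_on Rtilde F" "F ` Rtilde \<subseteq> Rtilde" "F u0 = v0"
    "\<forall>u\<in>Rtilde. orbit T (F u) = f (orbit T u)"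
proof -
  have "(u0, v0) \<in> lift_pairs f" using u0 by (simp add: lift_pairs_def)
  then have "\<exists>g. continuous_on Rtilde g \<and> g \<in> Rtilde \<rightarrow> lift_pairs f \<and> g u0 = (u0, v0) \<and>
      (\<forall>y\<in>Rtilde. fst (g y) = y)"
    by (rule covering_space_lift_strong[OF covering_space_lift_pairs[OF f sm] _ u0(1)
          starlike_imp_simply_connected[OF starlike_Rtilde] locally_path_connected_Rtilde
          continuous_on_id]) (auto simp only: fst_conv Pi_iff)
  then obtain g where g: "continuous_on Rtilde g" "g \<in> Rtilde \<rightarrow> lift_pairs f" "g u0 = (u0, v0)"
      "\<forall>y\<in>Rtilde. fst (g y) = y"
    by (elim exE conjE) (rule that)
  have mem: "g u \<in> lift_pairs f" if "u \<in> Rtilde" for u using g(2) that by blast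
  show thesis
  proof
    show "continuous_on Rtilde (\<lambda>u. snd (g u))" by (intro continuous_intros g(1))
    show "(\<lambda>u. snd (g u)) ` Rtilde \<subseteq> Rtilde" using mem by (force simp: lift_pairs_def)
    show "snd (g u0) = v0" using g(3) by simp
    show "\<forall>u\<in>Rtilde. orbit T (snd (g u)) = f (orbit T u)"
      using mem g(4) by (fastforce simp: lift_pairs_def)
  qed
qed

text \<open>
  The normalised lift of a map that fixes the boundary leaf. It commutes with \<open>T\<close> because \<open>T \<circ> F\<close> and
  \<open>F \<circ> T\<close> are lifts of the same map that agree on the boundary.
\<close>

lemma normalised_lift_exists:
  assumes f: "f ` orbit T ` Rtilde \<subseteq> orbit T ` Rtilde" and sm: "smooth_map (orbit T) f"
    and fix_bd: "\<And>q. q \<in> boundary_leaf T \<Longrightarrow> f q = q"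
  obtains F where "continuous_on Rtilde F" "F ` Rtilde \<subseteq> Rtilde"
    "\<forall>u\<in>Rtilde. orbit T (F u) = f (orbit T u)" "\<forall>u\<in>leaf_tilde 0. F u = u"
    "\<forall>u\<in>Rtilde. F (T u) = T (F u)"
proof -
  define u0 :: point where "u0 = ((1, 0), 0)"
  have u0: "u0 \<in> leaf_tilde 0" by (simp add: u0_def leaf_tilde_0)
  have u0R: "u0 \<in> Rtilde" using u0 leaf_tilde_subset by blast
  have bd: "f (orbit T u) = orbit T u" if "u \<in> leaf_tilde 0" for u
    using fix_bd that by (simp add: boundary_leaf_def)
  obtain F where F: "continuous_on Rtilde F" "F ` Rtilde \<subseteq> Rtilde" "F u0 = u0"
      "\<forall>u\<in>Rtilde. orbit T (F u) = f (orbit T u)"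
    by (rule lift_exists[OF f sm u0R u0R bd[OF u0, symmetric]]) (rule that)
  have id: "F u = u" if u: "u \<in> leaf_tilde 0" for u
  proof (rule lift_unique[of "leaf_tilde 0" F "\<lambda>w. w" u0 u])
    show "continuous_on (leaf_tilde 0) F" using F(1) leaf_tilde_subset continuous_on_subset by blast
    show "F ` leaf_tilde 0 \<subseteq> Rtilde" using F(2) leaf_tilde_subset by blast
    show "orbit T (F w) = orbit T w" if "w \<in> leaf_tilde 0" for w
      using F(4) bd[OF that] that leaf_tilde_subset by auto
  qed (use leaf_tilde_subset connected_leaf_tilde_0 u0 F(3) u in auto)
  have FT: "F (T u) = T (F u)" if u: "u \<in> Rtilde" for u
  proof (rule lift_unique[of Rtilde "\<lambda>u. F (T u)" "\<lambda>u. T (F u)" u0 u])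
    have T: "continuous_on Rtilde T" by (rule fibred_affine_continuous[OF fibred_affine_T])
    have TR: "T ` Rtilde \<subseteq> Rtilde" using T_mem by blast
    show "continuous_on Rtilde (\<lambda>u. F (T u))" by (rule continuous_on_compose2[OF F(1) T TR])
    show "continuous_on Rtilde (\<lambda>u. T (F u))" by (rule continuous_on_compose2[OF T F(1,2)])
    show "(\<lambda>u. F (T u)) ` Rtilde \<subseteq> Rtilde" using TR F(2) by blast
    show "(\<lambda>u. T (F u)) ` Rtilde \<subseteq> Rtilde" using TR F(2) by blast
    show "orbit T (F (T w)) = orbit T (T (F w))" if "w \<in> Rtilde" for w
      using F(2,4) T_mem[OF that] orbit_T that by (simp add: image_subset_iff)
    have "T u0 \<in> leaf_tilde 0" using lam_nonzero by (simp add: u0_def T_apply leaf_tilde_0 phi_0)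
    then show "F (T u0) = T (F u0)" using id F(3) by simp
  qed (fact connected_Rtilde u0R u)+
  show thesis using that F id FT by blast
qed

lemma normalised_lift_unique:
  assumes "continuous_on Rtilde A" "A ` Rtilde \<subseteq> Rtilde" "continuous_on Rtilde B" "B ` Rtilde \<subseteq> Rtilde"
    and "\<And>u. u \<in> Rtilde \<Longrightarrow> orbit T (A u) = orbit T (B u)"
    and "\<And>u. u \<in> leaf_tilde 0 \<Longrightarrow> A u = B u"
    and "u \<in> Rtilde"
  shows "A u = B u"
proof (rule lift_unique[OF connected_Rtilde assms(1,3,2,4,5) _ _ assms(7)])
  show "((1, 0), 0) \<in> Rtilde" by (simp add: Rtilde_def)
  show "A ((1, 0), 0) = B ((1, 0), 0)" by (rule assms(6)) (simp add: leaf_tilde_0)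
qed

end

section \<open>Rigidity of leafwise holomorphic equivariant maps\<close>

definition complex_linear2 :: "(complex \<times> complex \<Rightarrow> complex \<times> complex) \<Rightarrow> bool" where
  "complex_linear2 D \<longleftrightarrow> (\<forall>c v. D (c * fst v, c * snd v) = (c * fst (D v), c * snd (D v)))"

lemma norm_complex_scale: "norm (t * a, t * b) = norm t * norm (a, b)" for t a b :: complex
proof -
  have "(norm (t * a))\<^sup>2 + (norm (t * b))\<^sup>2 = (norm t)\<^sup>2 * ((norm a)\<^sup>2 + (norm b)\<^sup>2)"
    by (simp add: norm_mult power_mult_distrib algebra_simps)
  then show ?thesis by (simp add: norm_Pair real_sqrt_mult)
qed

lemma norm_shear:
  fixes a b c s :: complex
  assumes s: "norm s \<le> n"
  shows "norm (c * (a + s * b), c * b) \<le> norm c * (n + 2) * norm (a, b)"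
proof -
  have n: "0 \<le> n" using order_trans[OF norm_ge_zero s] .
  have "norm (a + s * b) \<le> norm a + norm s * norm b"
    using norm_triangle_ineq[of a "s * b"] by (simp add: norm_mult)
  also have "\<dots> \<le> norm (a, b) + n * norm (a, b)"
    by (intro add_mono mult_mono norm_fst_le norm_snd_le s n) simp
  finally have "norm (a + s * b, b) \<le> (n + 2) * norm (a, b)"
    using norm_Pair_le[of "a + s * b" b] norm_snd_le[of b a] by (simp add: algebra_simps)
  from mult_left_mono[OF this, of "norm c"] show ?thesis
    by (simp add: norm_complex_scale mult.assoc)
qed

text \<open>
  The estimates below take place on complex lines through the origin, which reduces them to
  functions of one complex variable.
\<close>

lemma holomorphic_on_complex_line:
  assumes "\<And>z. \<exists>D. (g has_derivative D) (at z) \<and> complex_linear2 D"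
    and D: "(g has_derivative D) (at (0, 0))" "complex_linear2 D"
  shows "(\<lambda>t. fst (g (t * a, t * b))) holomorphic_on UNIV" (is "?f holomorphic_on _")
    and "(\<lambda>t. snd (g (t * a, t * b))) holomorphic_on UNIV" (is "?h holomorphic_on _")
    and "deriv (\<lambda>t. fst (g (t * a, t * b))) 0 = fst (D (a, b))"
    and "deriv (\<lambda>t. snd (g (t * a, t * b))) 0 = snd (D (a, b))"
proof -
  have *: "(?f has_field_derivative fst (D (a, b))) (at t) \<and> (?h has_field_derivative snd (D (a, b))) (at t)"
    if D: "(g has_derivative D) (at (t * a, t * b))" "complex_linear2 D" for t D
  proof -
    have "((\<lambda>t. (t * a, t * b)) has_derivative (\<lambda>s. (s * a, s * b))) (at t)"
      by (auto intro!: derivative_eq_intros)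
    then have "((\<lambda>t. g (t * a, t * b)) has_derivative (\<lambda>s. D (s * a, s * b))) (at t)"
      by (rule has_derivative_compose) (rule D(1))
    moreover have "D (s * a, s * b) = (s * fst (D (a, b)), s * snd (D (a, b)))" for s
      using D(2)[unfolded complex_linear2_def, rule_format, of s "(a, b)"] by simp
    ultimately have d: "((\<lambda>t. g (t * a, t * b)) has_derivative (\<lambda>s. (s * fst (D (a, b)), s * snd (D (a, b))))) (at t)"
      by simp
    show ?thesis
      using has_derivative_imp_has_field_derivative[OF has_derivative_fst[OF d]]
        has_derivative_imp_has_field_derivative[OF has_derivative_snd[OF d]] by simp
  qed
  have **: "\<exists>d. (?f has_field_derivative d) (at t)" "\<exists>d. (?h has_field_derivative d) (at t)" for t
    using assms(1)[of "(t * a, t * b)"] * by blast+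
  show "?f holomorphic_on UNIV" "?h holomorphic_on UNIV"
    using ** by (auto simp: holomorphic_on_def field_differentiable_def)
  show "deriv ?f 0 = fst (D (a, b))" "deriv ?h 0 = snd (D (a, b))"
    using *[of D 0] D by (auto intro: DERIV_imp_deriv)
qed

lemma affine_of_higher_derivatives_zero:
  assumes "f holomorphic_on UNIV" and zero: "\<And>m. m \<ge> 2 \<Longrightarrow> (deriv ^^ m) f 0 = 0"
  shows "f t = f 0 + t * deriv f 0"
proof -
  have "f holomorphic_on ball 0 (norm t + 1)" using assms(1) holomorphic_on_subset by blast
  then have "(\<lambda>n. (deriv ^^ n) f 0 / fact n * (t - 0) ^ n) sums f t"
    by (rule holomorphic_power_series) simp
  moreover have "(\<lambda>n. (deriv ^^ n) f 0 / fact n * (t - 0) ^ n) sums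
      (\<Sum>n\<in>{0, 1}. (deriv ^^ n) f 0 / fact n * (t - 0) ^ n)"
  proof (rule sums_finite)
    show "(deriv ^^ n) f 0 / fact n * (t - 0) ^ n = 0" if "n \<notin> {0, 1}" for n
      using zero[of n] that by simp
  qed simp
  ultimately show ?thesis
    using sums_unique2 by fastforce
qed

lemma polynomial_times_geometric_tendsto_0:
  fixes q :: real
  assumes "0 < q" "q < 1"
  shows "(\<lambda>n. (real n + 2) ^ k * q ^ n) \<longlonglongrightarrow> 0"
  using assms by real_asymp

context Reeb_data
begin

definition G_pow :: "nat \<Rightarrow> complex \<times> complex \<Rightarrow> complex \<times> complex" where
  "G_pow n z = (lam ^ n * (fst z + of_nat n / lam * snd z), lam ^ n * snd z)"

definition G_inv_pow :: "nat \<Rightarrow> complex \<times> complex \<Rightarrow> complex \<times> complex" where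
  "G_inv_pow n z = (inverse lam ^ n * (fst z - of_nat n / lam * snd z), inverse lam ^ n * snd z)"

lemma T_pow_eq: "(T ^^ n) (z, x) = (G_pow n z, (\<phi> ^^ n) x)"
proof (induction n)
  case 0
  then show ?case by (simp add: G_pow_def)
next
  case (Suc n)
  then show ?case using lam_nonzero by (cases z) (simp add: G_pow_def T_apply field_simps)
qed

lemma G_pow_inverse: "G_pow n (G_inv_pow n z) = z" "G_inv_pow n (G_pow n z) = z"
  using lam_nonzero by (simp_all add: G_pow_def G_inv_pow_def prod_eq_iff field_simps power_inverse)

lemma G_inv_pow_scale: "G_inv_pow n (t * a, t * b) = (t * fst (G_inv_pow n (a, b)), t * snd (G_inv_pow n (a, b)))"
  by (simp add: G_inv_pow_def algebra_simps)

lemma norm_of_nat_div_lam: "norm (of_nat n / lam) \<le> real n"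
  using divide_left_mono[of 1 "norm lam" "real n"] lam lam_nonzero by (simp add: norm_divide)

lemma norm_G_pow: "norm (G_pow n z) \<le> norm lam ^ n * (real n + 2) * norm z"
  using norm_shear[OF norm_of_nat_div_lam, of "lam ^ n" "fst z" n "snd z"]
  by (simp add: G_pow_def norm_power)

lemma norm_G_inv_pow: "norm (G_inv_pow n z) \<le> inverse (norm lam) ^ n * (real n + 2) * norm z"
proof -
  have "norm (- (of_nat n / lam)) \<le> real n" using norm_of_nat_div_lam by (simp only: norm_minus_cancel)
  from norm_shear[OF this, of "inverse lam ^ n" "fst z" "snd z"] show ?thesis
    by (simp add: G_inv_pow_def norm_power norm_inverse)
qed

lemma equivariant_pow:
  assumes "\<forall>u\<in>Rtilde. F (T u) = T (F u)" "u \<in> Rtilde"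
  shows "F ((T ^^ n) u) = (T ^^ n) (F u)"
  by (induction n) (use assms T_pow_mem in auto)

text \<open>
  Write \<open>\<xi>\<close> for the leaf component of \<open>F\<close>. Equivariance compares \<open>\<xi>(\<cdot>, x)\<close> on a sphere of radius of order \<open>|\<lambda>|\<^sup>n\<close> with \<open>\<xi>(\<cdot>, \<psi>\<^sup>n x)\<close> on the unit
  sphere, where \<open>F\<close> is bounded because it extends continuously to the boundary leaf. So \<open>\<xi>(\<cdot>, x)\<close> grows
  at most like \<open>|z|\<close> up to powers of \<open>log |z|\<close>, and the Cauchy estimates leave only the affine part.
\<close>

lemma affine_on_leaf:
  assumes cont: "continuous_on Rtilde F" and equi: "\<forall>u\<in>Rtilde. F (T u) = T (F u)"
    and hol: "\<And>x z. x > 0 \<Longrightarrow> \<exists>D. ((\<lambda>z. fst (F (z, x))) has_derivative D) (at z) \<and> complex_linear2 D"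
    and x: "x > 0"
  obtains D where "linear D" "complex_linear2 D" "\<forall>z. fst (F (z, x)) = fst (F ((0, 0), x)) + D z"
proof -
  let ?g = "\<lambda>z. fst (F (z, x))"
  obtain D where D: "(?g has_derivative D) (at (0, 0))" "complex_linear2 D"
    using hol[OF x] by blast
  \<comment> \<open>This set reaches the boundary leaf but avoids the missing point.\<close>
  let ?K = "sphere (0 :: complex \<times> complex) 1 \<times> {0..1::real}"
  have K: "?K \<subseteq> Rtilde" by (auto simp: Rtilde_def zero_prod_def)
  have "compact ((\<lambda>u. fst (F u)) ` ?K)"
    by (intro compact_continuous_image continuous_intros continuous_on_subset[OF cont K] compact_Times)
       auto
  then obtain M where "\<forall>y\<in>(\<lambda>u. fst (F u)) ` ?K. norm y \<le> M"
    using compact_imp_bounded bounded_iff by blast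
  then have M: "norm (fst (F (z, y))) \<le> M" if "norm z = 1" "0 \<le> y" "y \<le> 1" for z y
    using that by auto
  have "norm ((1, 0) :: complex \<times> complex) = 1" by (simp add: norm_Pair)
  then have M0: "M \<ge> 0" using order_trans[OF norm_ge_zero M[of "(1, 0)" 0]] by simp
  obtain N where N: "\<forall>n\<ge>N. (\<psi> ^^ n) x < 1"
    using psi_pow_eventually_less[OF x zero_less_one] by blast
  define q where "q = inverse (norm lam)"
  have q: "0 < q" "q < 1" using lam by (auto simp: q_def inverse_less_1_iff)
  have main: "?g (a, b) = ?g (0, 0) + D (a, b)" if ab: "(a, b) \<noteq> (0, 0)" for a b
  proof -
    let ?nz = "norm (a, b)"
    \<comment> \<open>The radius is chosen such that \<open>G\<^sup>-\<^sup>n\<close> maps the circle \<open>{(t a, t b)}\<close> into the unit sphere.\<close>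
    have bound: "norm (?g (t * a, t * b)) \<le> norm lam ^ n * (real n + 2) * M"
      if n: "n \<ge> N" and t: "norm t = 1 / norm (G_inv_pow n (a, b))" for n t
    proof -
      let ?w = "G_inv_pow n (a, b)" and ?xn = "(\<psi> ^^ n) x"
      let ?tw = "(t * fst ?w, t * snd ?w)"
      have w: "?w \<noteq> (0, 0)"
      proof
        assume "?w = (0, 0)"
        then have "G_pow n ?w = (0, 0)" by (simp add: G_pow_def)
        then show False using G_pow_inverse(1)[of n "(a, b)"] ab by simp
      qed
      have ntw: "norm ?tw = 1" using w t norm_complex_scale[of t "fst ?w" "snd ?w"] by (simp add: zero_prod_def)
      have xn: "0 < ?xn" "?xn < 1" using psi_pow_pos[OF x] N n by auto
      have tw: "(?tw, ?xn) \<in> Rtilde" using xn by (simp add: Rtilde_def)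
      have "?tw = G_inv_pow n (t * a, t * b)" by (simp add: G_inv_pow_scale)
      then have "(T ^^ n) (?tw, ?xn) = ((t * a, t * b), x)"
        using phi_psi_pow[of x n] x G_pow_inverse(1) by (simp add: T_pow_eq)
      then have "F ((t * a, t * b), x) = (T ^^ n) (F (?tw, ?xn))"
        using equivariant_pow[OF equi tw, of n] by simp
      then have "?g (t * a, t * b) = G_pow n (fst (F (?tw, ?xn)))"
        by (cases "F (?tw, ?xn)") (simp add: T_pow_eq)
      then have "norm (?g (t * a, t * b)) \<le> norm lam ^ n * (real n + 2) * norm (fst (F (?tw, ?xn)))"
        using norm_G_pow by simp
      also have "\<dots> \<le> norm lam ^ n * (real n + 2) * M"
        by (intro mult_left_mono M ntw) (use xn in auto)
      finally show ?thesis .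
    qed
    have zero: "(deriv ^^ m) f 0 = 0"
      if f: "f holomorphic_on UNIV" "\<And>t. norm (f t) \<le> norm (?g (t * a, t * b))" and m: "m \<ge> 2" for f m
    proof -
      let ?B = "\<lambda>n. fact m * M * ?nz ^ m * ((real n + 2) ^ Suc m * q ^ n)"
      have "norm ((deriv ^^ m) f 0) \<le> ?B n" if n: "n \<ge> N" for n
      proof -
        let ?w = "G_inv_pow n (a, b)"
        have w: "norm ?w > 0"
        proof -
          have "?w \<noteq> 0"
          proof
            assume "?w = 0"
            then have "G_pow n ?w = (0, 0)" by (simp add: G_pow_def)
            then show False using G_pow_inverse(1)[of n "(a, b)"] ab by simp
          qed
          then show ?thesis by simp
        qed
        have "norm ((deriv ^^ m) f 0) \<le> fact m * (norm lam ^ n * (real n + 2) * M) / (1 / norm ?w) ^ m"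
        proof (rule Cauchy_inequality)
          show "f holomorphic_on ball 0 (1 / norm ?w)" using f(1) holomorphic_on_subset by blast
          show "continuous_on (cball 0 (1 / norm ?w)) f"
            using f(1) holomorphic_on_imp_continuous_on continuous_on_subset by blast
          show "norm (f t) \<le> norm lam ^ n * (real n + 2) * M" if "norm (0 - t) = 1 / norm ?w" for t
            using order_trans[OF f(2) bound[OF n, of t]] that by simp
        qed (use w in simp)
        also have "\<dots> = fact m * (norm lam ^ n * (real n + 2) * M) * norm ?w ^ m"
          by (simp add: power_divide)
        also have "\<dots> \<le> fact m * (norm lam ^ n * (real n + 2) * M) * (q ^ n * (real n + 2) * ?nz) ^ m"
          using norm_G_inv_pow[of n "(a, b)"] M0 unfolding q_def
          by (intro mult_left_mono power_mono) auto
        also have "\<dots> = fact m * M * ?nz ^ m * (real n + 2) ^ Suc m * (norm lam ^ n * (q ^ n) ^ m)"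
          by (simp only: power_mult_distrib power_Suc mult_ac)
        also have "\<dots> \<le> fact m * M * ?nz ^ m * (real n + 2) ^ Suc m * q ^ n"
        proof (rule mult_left_mono)
          have "norm lam ^ n * (q ^ n) ^ m = (norm lam * q) ^ n * (q ^ n) ^ (m - 1)"
            using m by (cases m) (auto simp: power_mult_distrib)
          also have "\<dots> = (q ^ n) ^ (m - 1)" using lam_nonzero by (simp add: q_def)
          also have "\<dots> \<le> (q ^ n) ^ 1" using q m by (intro power_decreasing) (auto simp: power_le_one)
          finally show "norm lam ^ n * (q ^ n) ^ m \<le> q ^ n" by simp
        qed (use M0 in simp)
        finally show ?thesis by (simp only: mult_ac)
      qed
      moreover have "?B \<longlonglongrightarrow> fact m * M * ?nz ^ m * 0"
        by (intro tendsto_mult tendsto_const polynomial_times_geometric_tendsto_0 q)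
      ultimately have "norm ((deriv ^^ m) f 0) \<le> 0"
        by (intro LIMSEQ_le_const[of ?B]) auto
      then show ?thesis by simp
    qed
    have n1: "norm (fst p) \<le> norm p" and n2: "norm (snd p) \<le> norm p" for p :: "complex \<times> complex"
      using norm_fst_le[of "fst p" "snd p"] norm_snd_le[of "snd p" "fst p"] by simp_all
    note line = holomorphic_on_complex_line[OF hol[OF x] D, of a b]
    have "fst (?g (1 * a, 1 * b)) = fst (?g (0 * a, 0 * b)) + 1 * fst (D (a, b))"
      using affine_of_higher_derivatives_zero[OF line(1) zero[OF line(1) n1], of 1] line(3) by simp
    moreover have "snd (?g (1 * a, 1 * b)) = snd (?g (0 * a, 0 * b)) + 1 * snd (D (a, b))"
      using affine_of_higher_derivatives_zero[OF line(2) zero[OF line(2) n2], of 1] line(4) by simp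
    ultimately show ?thesis by (simp add: prod_eq_iff)
  qed
  have lin: "linear D" using has_derivative_linear[OF D(1)] .
  then have "D (0, 0) = 0" using linear_0[of D] by (simp add: zero_prod_def)
  then have aff: "?g (a, b) = ?g (0, 0) + D (a, b)" for a b
    using main[of a b] by (cases "(a, b) = (0, 0)") (auto simp only: Pair_inject add_0_right)
  have "\<forall>z. ?g z = ?g (0, 0) + D z"
  proof
    fix z show "?g z = ?g (0, 0) + D z" using aff[of "fst z" "snd z"] by (simp only: prod.collapse)
  qed
  then show thesis using that lin D(2) by blast
qed

text \<open>
  As \<open>F\<close> is the identity on the boundary leaf, the linear part \<open>D\<close> satisfies \<open>G\<^sup>-\<^sup>n D G\<^sup>n \<rightarrow> 1\<close>. As \<open>G = \<lambda> (1 + N)\<close> with \<open>N\<close> nilpotent, the conjugates are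
  polynomial in \<open>n\<close>, and a polynomial in \<open>n\<close> that converges is constant; so \<open>D\<close> is the identity.
\<close>

lemma translation_on_leaf:
  assumes cont: "continuous_on Rtilde F" and equi: "\<forall>u\<in>Rtilde. F (T u) = T (F u)"
    and bd: "\<forall>u\<in>leaf_tilde 0. F u = u"
    and hol: "\<And>x z. x > 0 \<Longrightarrow> \<exists>D. ((\<lambda>z. fst (F (z, x))) has_derivative D) (at z) \<and> complex_linear2 D"
    and x: "x > 0"
  shows "fst (F (z, x)) = fst (F ((0, 0), x)) + z"
proof -
  obtain D where D: "linear D" "complex_linear2 D" "\<forall>z. fst (F (z, x)) = fst (F ((0, 0), x)) + D z"
    by (rule affine_on_leaf[OF cont equi hol x]) (assumption, rule that)
  have scale: "D (c * a, c * b) = (c * fst (D (a, b)), c * snd (D (a, b)))" for c a b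
    using D(2)[unfolded complex_linear2_def, rule_format, of c "(a, b)"] by simp
  have lim: "(\<lambda>n. G_inv_pow n (D (G_pow n e))) \<longlonglongrightarrow> e" if e: "e \<noteq> (0, 0)" for e
  proof -
    have lim1: "(\<lambda>n. fst (F (e, (\<psi> ^^ n) x))) \<longlonglongrightarrow> e" if "e \<noteq> (0, 0)" for e
    proof -
      have mem: "(e, 0) \<in> leaf_tilde 0" using that by (simp add: leaf_tilde_0)
      have mems: "(e, (\<psi> ^^ n) x) \<in> Rtilde" for n
        using psi_pow_pos[OF x, of n] by (simp add: Rtilde_def)
      have "(\<lambda>n. (e, (\<psi> ^^ n) x)) \<longlonglongrightarrow> (e, 0)"
        by (intro tendsto_Pair tendsto_const psi_pow_tendsto_0 x)
      then have "(\<lambda>n. F (e, (\<psi> ^^ n) x)) \<longlonglongrightarrow> F (e, 0)"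
        by (rule continuous_on_tendsto_compose[OF cont])
           (use mem leaf_tilde_subset mems in auto)
      then have "(\<lambda>n. fst (F (e, (\<psi> ^^ n) x))) \<longlonglongrightarrow> fst (F (e, 0))" by (rule tendsto_fst)
      then show ?thesis using bd mem by simp
    qed
    have eq: "fst (F (e, (\<psi> ^^ n) x)) = G_inv_pow n (fst (F ((0, 0), x)) + D (G_pow n e))" for e n
    proof -
      let ?u = "(e, (\<psi> ^^ n) x)"
      have u: "?u \<in> Rtilde" using psi_pow_pos[OF x, of n] by (simp add: Rtilde_def)
      have "(T ^^ n) ?u = (G_pow n e, x)" using phi_psi_pow[of x n] x by (simp add: T_pow_eq)
      then have "F (G_pow n e, x) = (T ^^ n) (F ?u)" using equivariant_pow[OF equi u, of n] by simp
      then have "fst (F (G_pow n e, x)) = G_pow n (fst (F ?u))"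
        by (cases "F ?u") (simp add: T_pow_eq)
      then show ?thesis using D(3) G_pow_inverse(2) by metis
    qed
    have neg: "D (G_pow n (- e)) = - D (G_pow n e)" for n
    proof -
      have "G_pow n (- e) = - G_pow n e" by (simp add: G_pow_def prod_eq_iff algebra_simps)
      then show ?thesis using linear_neg[OF D(1)] by simp
    qed
    \<comment> \<open>Subtracting the values at \<open>e\<close> and \<open>- e\<close> removes the constant part of the affine map.\<close>
    have "(1/2) *\<^sub>R (G_inv_pow n (p + v) - G_inv_pow n (p - v)) = G_inv_pow n v" for n p v
      by (simp add: G_inv_pow_def prod_eq_iff scaleR_conv_of_real algebra_simps)
    then have "(1/2) *\<^sub>R (fst (F (e, (\<psi> ^^ n) x)) - fst (F (- e, (\<psi> ^^ n) x))) = G_inv_pow n (D (G_pow n e))" for n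
      unfolding eq neg by (metis add_uminus_conv_diff)
    moreover have "(\<lambda>n. (1/2) *\<^sub>R (fst (F (e, (\<psi> ^^ n) x)) - fst (F (- e, (\<psi> ^^ n) x)))) \<longlonglongrightarrow> (1/2) *\<^sub>R (e - (- e))"
      by (intro tendsto_scaleR tendsto_const tendsto_diff lim1) (use e in \<open>auto simp: prod_eq_iff\<close>)
    moreover have "(1/2) *\<^sub>R (e - (- e)) = e" by (simp add: prod_eq_iff scaleR_conv_of_real)
    ultimately show ?thesis by simp
  qed
  obtain p r where pr: "D (1, 0) = (p, r)" by fastforce
  obtain q s where qs: "D (0, 1) = (q, s)" by fastforce
  have Dab: "D (a, b) = (a * p + b * q, a * r + b * s)" for a b
  proof -
    have "D (a, b) = D (a * 1, a * 0) + D (b * 0, b * 1)"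
      using linear_add[OF D(1), of "(a, 0)" "(0, b)"] by simp
    then show ?thesis unfolding scale pr qs by simp
  qed
  have e1: "G_inv_pow n (D (G_pow n (1, 0))) = (p - of_nat n / lam * r, r)" for n
    using lam_nonzero by (simp add: G_pow_def G_inv_pow_def Dab field_simps power_inverse)
  have lim_e1: "(\<lambda>n. (p - of_nat n / lam * r, r)) \<longlonglongrightarrow> (1, 0)"
    using lim[of "(1, 0)"] unfolding e1 by simp
  then have "(\<lambda>n::nat. r) \<longlonglongrightarrow> 0" using tendsto_snd by fastforce
  then have r: "r = 0" using LIMSEQ_unique tendsto_const by blast
  have "(\<lambda>n::nat. p) \<longlonglongrightarrow> 1" using tendsto_fst[OF lim_e1] r by simp
  then have p: "p = 1" using LIMSEQ_unique tendsto_const by blast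
  have e2: "G_inv_pow n (D (G_pow n (0, 1))) = (of_nat n / lam + q - of_nat n / lam * s, s)" for n
    using lam_nonzero by (simp add: G_pow_def G_inv_pow_def Dab p r field_simps power_inverse)
  have lim_e2: "(\<lambda>n. (of_nat n / lam + q - of_nat n / lam * s, s)) \<longlonglongrightarrow> (0, 1)"
    using lim[of "(0, 1)"] unfolding e2 by simp
  then have "(\<lambda>n::nat. s) \<longlonglongrightarrow> 1" using tendsto_snd by fastforce
  then have s: "s = 1" using LIMSEQ_unique tendsto_const by blast
  have "(\<lambda>n::nat. q) \<longlonglongrightarrow> 0" using tendsto_fst[OF lim_e2] s by simp
  then have q: "q = 0" using LIMSEQ_unique tendsto_const by blast
  have "D z = z" using Dab[of "fst z" "snd z"] by (simp add: p q r s)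
  then show ?thesis using D(3)[rule_format, of z] by (simp only:)
qed

end

section \<open>The centralizer and the semidirect product\<close>

lemma BijGroup_mult: "f \<in> Bij S \<Longrightarrow> g \<in> Bij S \<Longrightarrow> f \<otimes>\<^bsub>BijGroup S\<^esub> g = compose S f g"
  by (simp add: BijGroup_def)

context Reeb_data
begin

abbreviation "Z \<equiv> Z_centralizer \<phi>"

lemma Z_one: "\<one>\<^bsub>Z\<^esub> = (\<lambda>x\<in>{0..}. x)"
  by (simp add: Z_centralizer_def Diff_half_def BijGroup_def)

lemma phi_Bij: "\<phi> \<in> Bij {0..}"
  using phi_Diff by (simp add: Diff_half_def)

lemma Z_memI:
  assumes "\<eta> \<in> extensional {0..}" "smooth_on {0..} \<eta>" "smooth_on {0..} \<eta>'"
    and "\<And>x. x \<ge> 0 \<Longrightarrow> \<eta> x \<ge> 0" "\<And>x. x \<ge> 0 \<Longrightarrow> \<eta>' x \<ge> 0"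
    and "\<And>x. x \<ge> 0 \<Longrightarrow> \<eta>' (\<eta> x) = x" "\<And>x. x \<ge> 0 \<Longrightarrow> \<eta> (\<eta>' x) = x"
    and "\<And>x. x \<ge> 0 \<Longrightarrow> \<eta> (\<phi> x) = \<phi> (\<eta> x)"
  shows "\<eta> \<in> carrier Z"
proof -
  have bij: "bij_betw \<eta> {0..} {0..}"
    by (rule bij_betw_byWitness[of _ \<eta>']) (use assms in auto)
  then have Bij: "\<eta> \<in> Bij {0..}" using assms(1) by (simp add: Bij_def)
  have "inv_into {0..} \<eta> x = \<eta>' x" if "x \<ge> 0" for x
    using bij assms(5,7) that by (intro inv_into_f_eq) (auto simp: bij_betw_def)
  then have "smooth_on {0..} (inv_into {0..} \<eta>)"
    by (intro smooth_on_cong[OF assms(3)]) auto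
  moreover have "compose {0..} \<eta> \<phi> = compose {0..} \<phi> \<eta>"
    using assms(8) by (auto simp: compose_def fun_eq_iff)
  ultimately show ?thesis
    using Bij assms(2) phi_Bij
    by (simp add: Z_centralizer_def Diff_half_def BijGroup_def)
qed

lemma Z_memD:
  assumes "\<eta> \<in> carrier Z"
  shows "\<eta> \<in> Bij {0..}" "\<eta> \<in> extensional {0..}" "smooth_on {0..} \<eta>" "smooth_on {0..} (inv_into {0..} \<eta>)"
    "\<And>x. x \<ge> 0 \<Longrightarrow> \<eta> x \<ge> 0" "\<And>x. x \<ge> 0 \<Longrightarrow> inv_into {0..} \<eta> x \<ge> 0"
    "\<And>x. x \<ge> 0 \<Longrightarrow> inv_into {0..} \<eta> (\<eta> x) = x" "\<And>x. x \<ge> 0 \<Longrightarrow> \<eta> (inv_into {0..} \<eta> x) = x"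
    "\<And>x. x \<ge> 0 \<Longrightarrow> \<eta> (\<phi> x) = \<phi> (\<eta> x)"
proof -
  show Bij: "\<eta> \<in> Bij {0..}" and "smooth_on {0..} \<eta>" "smooth_on {0..} (inv_into {0..} \<eta>)"
    using assms by (simp_all add: Z_centralizer_def Diff_half_def)
  then show "\<eta> \<in> extensional {0..}" by (simp add: Bij_def)
  have bij: "bij_betw \<eta> {0..} {0..}" using Bij by (simp add: Bij_def)
  show "\<eta> x \<ge> 0" "inv_into {0..} \<eta> x \<ge> 0" "inv_into {0..} \<eta> (\<eta> x) = x" "\<eta> (inv_into {0..} \<eta> x) = x"
    if "x \<ge> 0" for x
    using that bij bij_betw_inv_into[OF bij]
    by (auto simp: bij_betw_inv_into_left bij_betw_inv_into_right dest: bij_betwE)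
  have "\<eta> \<otimes>\<^bsub>BijGroup {0..}\<^esub> \<phi> = \<phi> \<otimes>\<^bsub>BijGroup {0..}\<^esub> \<eta>"
    using assms by (simp add: Z_centralizer_def Diff_half_def)
  then have eq: "compose {0..} \<eta> \<phi> = compose {0..} \<phi> \<eta>"
    using Bij phi_Bij by (simp add: BijGroup_mult)
  show "\<eta> (\<phi> x) = \<phi> (\<eta> x)" if "x \<ge> 0" for x
    using fun_cong[OF eq, of x] that by (simp add: compose_def)
qed

lemma Z_mult: "\<eta> \<in> carrier Z \<Longrightarrow> \<eta>' \<in> carrier Z \<Longrightarrow> \<eta> \<otimes>\<^bsub>Z\<^esub> \<eta>' = compose {0..} \<eta> \<eta>'"
  using BijGroup_mult[OF Z_memD(1) Z_memD(1), of \<eta> \<eta>'] by (simp add: Z_centralizer_def Diff_half_def)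

lemma Z_mult_apply:
  "\<eta> \<in> carrier Z \<Longrightarrow> \<eta>' \<in> carrier Z \<Longrightarrow> x \<ge> 0 \<Longrightarrow> (\<eta> \<otimes>\<^bsub>Z\<^esub> \<eta>') x = \<eta> (\<eta>' x)"
  by (simp add: Z_mult compose_def)

lemma Z_one_closed: "(\<lambda>x\<in>{0..}. x) \<in> carrier Z"
proof (rule Z_memI[of _ "\<lambda>x. x"])
  have id: "smooth_on {0..} (\<lambda>x::real. x)" by (rule smooth_on_bounded_linear[OF bounded_linear_ident])
  then show "smooth_on {0..} (\<lambda>x::real. x)" .
  show "smooth_on {0..} (\<lambda>x\<in>{0..}. x::real)" by (rule smooth_on_cong[OF id]) simp
qed (use phi_nonneg in auto)

lemma Z_mult_closed:
  assumes "\<eta> \<in> carrier Z" "\<eta>' \<in> carrier Z"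
  shows "compose {0..} \<eta> \<eta>' \<in> carrier Z"
proof (rule Z_memI[of _ "\<lambda>x. inv_into {0..} \<eta>' (inv_into {0..} \<eta> x)"])
  note h = Z_memD[OF assms(1)] and h' = Z_memD[OF assms(2)]
  have "smooth_on {0..} (\<lambda>x. \<eta> (\<eta>' x))"
    by (rule smooth_on_compose[OF h(3) h'(3)]) (use h'(5) in auto)
  then show "smooth_on {0..} (compose {0..} \<eta> \<eta>')"
    by (rule smooth_on_cong) (simp add: compose_def)
  show "smooth_on {0..} (\<lambda>x. inv_into {0..} \<eta>' (inv_into {0..} \<eta> x))"
    by (rule smooth_on_compose[OF h'(4) h(4)]) (use h(6) in auto)
  show "compose {0..} \<eta> \<eta>' (\<phi> x) = \<phi> (compose {0..} \<eta> \<eta>' x)" if "x \<ge> 0" for x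
    using that h(9)[OF h'(5)[OF that]] h'(9)[OF that] phi_nonneg[OF that] by (simp add: compose_def)
qed (use Z_memD(5-8)[OF assms(1)] Z_memD(5-8)[OF assms(2)] in \<open>auto simp: compose_def\<close>)

lemma Z_inv_closed:
  assumes "\<eta> \<in> carrier Z"
  shows "(\<lambda>x\<in>{0..}. inv_into {0..} \<eta> x) \<in> carrier Z"
proof (rule Z_memI[of _ \<eta>])
  note h = Z_memD[OF assms]
  show "smooth_on {0..} \<eta>" by (rule h(3))
  show "smooth_on {0..} (\<lambda>x\<in>{0..}. inv_into {0..} \<eta> x)" by (rule smooth_on_cong[OF h(4)]) simp
  show "(\<lambda>x\<in>{0..}. inv_into {0..} \<eta> x) (\<phi> x) = \<phi> ((\<lambda>x\<in>{0..}. inv_into {0..} \<eta> x) x)" if "x \<ge> 0" for x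
  proof -
    let ?y = "inv_into {0..} \<eta> x"
    have y: "?y \<ge> 0" "\<eta> ?y = x" using h(6,8) that by auto
    have "inv_into {0..} \<eta> (\<phi> x) = inv_into {0..} \<eta> (\<eta> (\<phi> ?y))" using h(9)[OF y(1)] y(2) by simp
    also have "\<dots> = \<phi> ?y" using h(7) phi_nonneg y(1) by simp
    finally show ?thesis using that phi_nonneg by simp
  qed
qed (use Z_memD(5-8)[OF assms] in auto)

lemma Z_inv_mult:
  assumes "\<eta> \<in> carrier Z"
  shows "(\<lambda>x\<in>{0..}. inv_into {0..} \<eta> x) \<otimes>\<^bsub>Z\<^esub> \<eta> = \<one>\<^bsub>Z\<^esub>"
  using Z_mult[OF Z_inv_closed[OF assms] assms] Z_memD(5,7)[OF assms]
  by (auto simp: Z_one compose_def fun_eq_iff)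

lemma group_Z: "group Z"
proof (rule groupI)
  show "\<one>\<^bsub>Z\<^esub> \<in> carrier Z" using Z_one_closed by (simp add: Z_one)
  show "x \<otimes>\<^bsub>Z\<^esub> y \<in> carrier Z" if "x \<in> carrier Z" "y \<in> carrier Z" for x y
    using that by (simp add: Z_mult Z_mult_closed)
  show "\<one>\<^bsub>Z\<^esub> \<otimes>\<^bsub>Z\<^esub> x = x" if "x \<in> carrier Z" for x
    using that Z_one_closed Z_mult[of "\<lambda>x\<in>{0..}. x" x] Z_memD(2,5)[OF that]
    by (auto simp: Z_one compose_def fun_eq_iff extensional_def)
  show "\<exists>y\<in>carrier Z. y \<otimes>\<^bsub>Z\<^esub> x = \<one>\<^bsub>Z\<^esub>" if "x \<in> carrier Z" for x
    using Z_inv_mult[OF that] Z_inv_closed[OF that] by blast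
  show "x \<otimes>\<^bsub>Z\<^esub> y \<otimes>\<^bsub>Z\<^esub> z = x \<otimes>\<^bsub>Z\<^esub> (y \<otimes>\<^bsub>Z\<^esub> z)"
    if "x \<in> carrier Z" "y \<in> carrier Z" "z \<in> carrier Z" for x y z
  proof -
    have "z \<in> {0..} \<rightarrow> {0..}" using Z_memD(5)[OF that(3)] by auto
    then have "compose {0..} x (compose {0..} y z) = compose {0..} (compose {0..} x y) z"
      by (rule compose_assoc)
    then show ?thesis using that by (simp add: Z_mult Z_mult_closed)
  qed
qed

text \<open>The origin is the only fixed point of \<open>\<phi>\<close>, and \<open>\<eta>\<close> permutes the fixed points of \<open>\<phi>\<close>.\<close>

lemma Z_0:
  assumes "\<eta> \<in> carrier Z"
  shows "\<eta> 0 = 0"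
  using Z_memD(5,9)[OF assms, of 0] phi_0 phi_gt[of "\<eta> 0"] by force

lemma Z_pos:
  assumes "\<eta> \<in> carrier Z" "x > 0"
  shows "\<eta> x > 0"
  using Z_memD(5,7)[OF assms(1), of x] Z_memD(7)[OF assms(1), of 0] Z_0[OF assms(1)] assms(2)
  by (cases "\<eta> x = 0") auto

abbreviation "S \<equiv> S_space \<phi> lam"

lemma S_memD:
  assumes "\<beta> \<in> S"
  shows "smooth_on {0..} (fst \<beta>)" "smooth_on {0..} (snd \<beta>)" "\<And>x. x < 0 \<Longrightarrow> fst \<beta> x = 0 \<and> snd \<beta> x = 0"
    "\<And>x. x \<ge> 0 \<Longrightarrow> fst \<beta> (\<phi> x) = lam * fst \<beta> x + snd \<beta> x" "\<And>x. x \<ge> 0 \<Longrightarrow> snd \<beta> (\<phi> x) = lam * snd \<beta> x"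
  using assms by (auto simp: S_space_def)

lemma S_memI:
  assumes "smooth_on {0..} (fst \<beta>)" "smooth_on {0..} (snd \<beta>)" "\<And>x. x < 0 \<Longrightarrow> fst \<beta> x = 0 \<and> snd \<beta> x = 0"
    "\<And>x. x \<ge> 0 \<Longrightarrow> fst \<beta> (\<phi> x) = lam * fst \<beta> x + snd \<beta> x" "\<And>x. x \<ge> 0 \<Longrightarrow> snd \<beta> (\<phi> x) = lam * snd \<beta> x"
  shows "\<beta> \<in> S"
  using assms by (auto simp: S_space_def split: prod.splits)

lemma S_at_0:
  assumes "\<beta> \<in> S"
  shows "fst \<beta> 0 = 0" "snd \<beta> 0 = 0"
proof -
  have "lam \<noteq> 1" using lam by auto
  have "snd \<beta> 0 = lam * snd \<beta> 0" using S_memD(5)[OF assms, of 0] phi_0 by simp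
  then show 2: "snd \<beta> 0 = 0" using \<open>lam \<noteq> 1\<close> by simp
  have "fst \<beta> 0 = lam * fst \<beta> 0" using S_memD(4)[OF assms, of 0] phi_0 2 by simp
  then show "fst \<beta> 0 = 0" using \<open>lam \<noteq> 1\<close> by simp
qed

lemma S_zero: "0 \<in> S" and S_add: "\<beta> \<in> S \<Longrightarrow> \<beta>' \<in> S \<Longrightarrow> \<beta> + \<beta>' \<in> S" and S_neg: "\<beta> \<in> S \<Longrightarrow> - \<beta> \<in> S"
proof -
  show "0 \<in> S" and "\<beta> \<in> S \<Longrightarrow> \<beta>' \<in> S \<Longrightarrow> \<beta> + \<beta>' \<in> S"
    using S_space_subspace pairs.subspace_0 pairs.subspace_add by blast+
  show "\<beta> \<in> S \<Longrightarrow> - \<beta> \<in> S"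
    using S_space_subspace pairs.subspace_neg by blast
qed

lemma S_act_apply: "x \<ge> 0 \<Longrightarrow> fst (S_act \<eta> \<beta>) x = fst \<beta> (\<eta> x)" "x \<ge> 0 \<Longrightarrow> snd (S_act \<eta> \<beta>) x = snd \<beta> (\<eta> x)"
  "x < 0 \<Longrightarrow> fst (S_act \<eta> \<beta>) x = 0" "x < 0 \<Longrightarrow> snd (S_act \<eta> \<beta>) x = 0"
  by (auto simp: S_act_def)

lemma S_act_closed:
  assumes b: "\<beta> \<in> S" and e: "\<eta> \<in> carrier Z"
  shows "S_act \<eta> \<beta> \<in> S"
proof (rule S_memI)
  note e' = Z_memD[OF e]
  have img: "\<eta> ` {0..} \<subseteq> {0..}" using e'(5) by auto
  show "smooth_on {0..} (fst (S_act \<eta> \<beta>))"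
    by (rule smooth_on_cong[OF smooth_on_compose[OF S_memD(1)[OF b] e'(3) img]]) (simp add: S_act_apply)
  show "smooth_on {0..} (snd (S_act \<eta> \<beta>))"
    by (rule smooth_on_cong[OF smooth_on_compose[OF S_memD(2)[OF b] e'(3) img]]) (simp add: S_act_apply)
  show "fst (S_act \<eta> \<beta>) (\<phi> x) = lam * fst (S_act \<eta> \<beta>) x + snd (S_act \<eta> \<beta>) x"
    "snd (S_act \<eta> \<beta>) (\<phi> x) = lam * snd (S_act \<eta> \<beta>) x" if "x \<ge> 0" for x
    using that phi_nonneg[OF that] e'(9)[OF that] S_memD(4,5)[OF b e'(5)[OF that]]
    by (simp_all add: S_act_apply)
qed (simp add: S_act_apply)

lemma prod_fun_eqI:
  fixes \<beta> \<beta>' :: "(real \<Rightarrow> complex) \<times> (real \<Rightarrow> complex)"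
  assumes "\<And>x. fst \<beta> x = fst \<beta>' x" "\<And>x. snd \<beta> x = snd \<beta>' x"
  shows "\<beta> = \<beta>'"
  using assms by (auto simp: prod_eq_iff fun_eq_iff)

lemma S_act_add: "S_act \<eta> (\<beta> + \<beta>') = S_act \<eta> \<beta> + S_act \<eta> \<beta>'"
  by (rule prod_fun_eqI) (auto simp: S_act_def)

lemma S_act_neg: "S_act \<eta> (- \<beta>) = - S_act \<eta> \<beta>"
  by (rule prod_fun_eqI) (auto simp: S_act_def)

lemma S_act_zero: "S_act \<eta> 0 = 0"
  by (rule prod_fun_eqI) (auto simp: S_act_def)

lemma S_act_one:
  assumes "\<beta> \<in> S"
  shows "S_act \<one>\<^bsub>Z\<^esub> \<beta> = \<beta>"
  using S_memD(3)[OF assms] by (intro prod_fun_eqI) (auto simp: S_act_def Z_one)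

lemma S_act_mult:
  assumes "\<eta> \<in> carrier Z" "\<eta>' \<in> carrier Z"
  shows "S_act (\<eta> \<otimes>\<^bsub>Z\<^esub> \<eta>') \<beta> = S_act \<eta>' (S_act \<eta> \<beta>)"
  using Z_memD(5)[OF assms(2)] by (intro prod_fun_eqI) (auto simp: S_act_def Z_mult_apply[OF assms])

abbreviation "SZ \<equiv> S_semidirect_Z \<phi> lam"

lemma SZ_carrier: "carrier SZ = S \<times> carrier Z"
  by (simp add: S_semidirect_Z_def)

lemma SZ_mult: "(\<beta>, \<eta>) \<otimes>\<^bsub>SZ\<^esub> (\<beta>', \<eta>') = (\<beta>' + S_act \<eta>' \<beta>, \<eta> \<otimes>\<^bsub>Z\<^esub> \<eta>')"
  by (simp add: S_semidirect_Z_def)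

lemma SZ_one: "\<one>\<^bsub>SZ\<^esub> = (0, \<one>\<^bsub>Z\<^esub>)"
  by (simp add: S_semidirect_Z_def)

lemma SZ_cases:
  assumes "g \<in> carrier SZ"
  obtains \<beta> \<eta> where "g = (\<beta>, \<eta>)" "\<beta> \<in> S" "\<eta> \<in> carrier Z"
  using that[of "fst g" "snd g"] assms unfolding SZ_carrier mem_Times_iff by simp

lemma group_SZ: "group SZ"
proof -
  interpret Z: group Z by (rule group_Z)
  show ?thesis
  proof (rule groupI)
    show "\<one>\<^bsub>SZ\<^esub> \<in> carrier SZ" by (simp add: SZ_one SZ_carrier S_zero)
    show "x \<otimes>\<^bsub>SZ\<^esub> y \<in> carrier SZ" if "x \<in> carrier SZ" "y \<in> carrier SZ" for x y
      using that by (cases x; cases y) (auto simp: SZ_carrier SZ_mult S_add S_act_closed)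
    show "\<one>\<^bsub>SZ\<^esub> \<otimes>\<^bsub>SZ\<^esub> x = x" if "x \<in> carrier SZ" for x
      using that by (cases x) (auto simp: SZ_carrier SZ_mult SZ_one S_act_zero)
    show "x \<otimes>\<^bsub>SZ\<^esub> y \<otimes>\<^bsub>SZ\<^esub> z = x \<otimes>\<^bsub>SZ\<^esub> (y \<otimes>\<^bsub>SZ\<^esub> z)"
      if "x \<in> carrier SZ" "y \<in> carrier SZ" "z \<in> carrier SZ" for x y z
      using that by (cases x; cases y; cases z)
        (auto simp: SZ_carrier SZ_mult S_act_add S_act_mult Z.m_assoc add.assoc)
    show "\<exists>y\<in>carrier SZ. y \<otimes>\<^bsub>SZ\<^esub> x = \<one>\<^bsub>SZ\<^esub>" if x_in: "x \<in> carrier SZ" for x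
    proof -
      obtain \<beta> \<eta> where x: "x = (\<beta>, \<eta>)" "\<beta> \<in> S" "\<eta> \<in> carrier Z" using SZ_cases[OF x_in] .
      define y where "y = (- S_act (inv\<^bsub>Z\<^esub> \<eta>) \<beta>, inv\<^bsub>Z\<^esub> \<eta>)"
      have "y \<in> carrier SZ" using x by (simp add: y_def SZ_carrier S_neg S_act_closed)
      moreover have "S_act \<eta> (S_act (inv\<^bsub>Z\<^esub> \<eta>) \<beta>) = \<beta>"
        using x S_act_mult[of "inv\<^bsub>Z\<^esub> \<eta>" \<eta> \<beta>] S_act_one by simp
      then have "y \<otimes>\<^bsub>SZ\<^esub> x = \<one>\<^bsub>SZ\<^esub>" using x by (simp add: y_def SZ_mult SZ_one S_act_neg)
      ultimately show ?thesis by blast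
    qed
  qed
qed

lemma group_S: "group (S_group \<phi> lam)"
  by (rule groupI) (auto simp: S_group_def S_zero S_add add.assoc intro: bexI[OF _ S_neg])

end

section \<open>Automorphisms given by skew products\<close>

lemma has_fibred_affine_lifts_cong:
  assumes "has_fibred_affine_lifts \<pi> f" "\<And>q. q \<in> \<pi> ` Rtilde \<Longrightarrow> f q = g q"
  shows "has_fibred_affine_lifts \<pi> g"
proof -
  have "f (\<pi> u) = g (\<pi> u)" if "u \<in> Rtilde" for u using assms(2) that by blast
  then show ?thesis using assms(1) unfolding has_fibred_affine_lifts_def by simp
qed

text \<open>
  The projection \<open>\<pi>\<close> is arbitrary because the criterion serves both for the automorphisms of the
  quotient and for their lifts.
\<close>

lemma Aut_fol_memI:
  assumes ext: "f \<in> extensional (\<pi> ` Rtilde)"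
    and f: "\<And>u. u \<in> Rtilde \<Longrightarrow> f (\<pi> u) = \<pi> (B u)" and h: "\<And>u. u \<in> Rtilde \<Longrightarrow> h (\<pi> u) = \<pi> (B' u)"
    and mem: "\<And>u. u \<in> Rtilde \<Longrightarrow> B u \<in> Rtilde" "\<And>u. u \<in> Rtilde \<Longrightarrow> B' u \<in> Rtilde"
    and inv: "\<And>u. u \<in> Rtilde \<Longrightarrow> B' (B u) = u" "\<And>u. u \<in> Rtilde \<Longrightarrow> B (B' u) = u"
    and snd: "\<And>u. u \<in> Rtilde \<Longrightarrow> snd (B u) = \<eta> (snd u)" "\<And>u. u \<in> Rtilde \<Longrightarrow> snd (B' u) = \<eta>' (snd u)"
    and lifts: "has_fibred_affine_lifts \<pi> f" "has_fibred_affine_lifts \<pi> h"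
  shows "f \<in> carrier (Aut_fol \<pi>)"
proof -
  have bij: "bij_betw f (\<pi> ` Rtilde) (\<pi> ` Rtilde)"
    by (rule bij_betw_byWitness[of _ h]) (use f h mem inv in auto)
  have hq: "h q \<in> \<pi> ` Rtilde" "f (h q) = q" if q: "q \<in> \<pi> ` Rtilde" for q
  proof -
    obtain u where u: "u \<in> Rtilde" "q = \<pi> u" using q by blast
    show "h q \<in> \<pi> ` Rtilde" using h[OF u(1)] mem(2)[OF u(1)] u(2) by simp
    show "f (h q) = q" using h[OF u(1)] f[OF mem(2)[OF u(1)]] inv(2)[OF u(1)] u(2) by simp
  qed
  have "inv_into (\<pi> ` Rtilde) f q = h q" if "q \<in> \<pi> ` Rtilde" for q
    using bij hq[OF that] by (intro inv_into_f_eq) (auto simp: bij_betw_def)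
  then have lifts': "has_fibred_affine_lifts \<pi> (inv_into (\<pi> ` Rtilde) f)"
    using has_fibred_affine_lifts_cong[OF lifts(2)] by simp
  have leaf: "f ` L \<in> leaves \<pi>" if L: "L \<in> leaves \<pi>" for L
  proof -
    obtain x where x: "x \<ge> 0" "L = \<pi> ` leaf_tilde x" using L by (auto simp: leaves_def)
    let ?u = "((1, 0), x) :: point"
    have u: "?u \<in> Rtilde" using x by (simp add: Rtilde_def)
    have \<eta>x: "\<eta> x \<ge> 0" using snd(1)[OF u] snd_Rtilde_nonneg[OF mem(1)[OF u]] by simp
    have \<eta>\<eta>: "\<eta>' (\<eta> x) = x" using snd(2)[OF mem(1)[OF u]] snd(1)[OF u] inv(1)[OF u] by simp
    have "B ` leaf_tilde x = leaf_tilde (\<eta> x)"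
    proof (intro equalityI subsetI)
      fix v assume "v \<in> B ` leaf_tilde x"
      then show "v \<in> leaf_tilde (\<eta> x)" using mem snd by (auto simp: leaf_tilde_def)
    next
      fix v assume "v \<in> leaf_tilde (\<eta> x)"
      then have v: "v \<in> Rtilde" "snd v = \<eta> x" by (auto simp: leaf_tilde_def)
      then have "B' v \<in> leaf_tilde x" using mem snd \<eta>\<eta> by (simp add: leaf_tilde_def)
      then show "v \<in> B ` leaf_tilde x" using inv(2)[OF v(1)] by (metis image_eqI)
    qed
    moreover have "f ` L = \<pi> ` B ` leaf_tilde x"
    proof -
      have "f (\<pi> v) = \<pi> (B v)" if "v \<in> leaf_tilde x" for v using f that leaf_tilde_subset by blast
      then show ?thesis unfolding x(2) image_image by (rule image_cong[OF refl])
    qed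
    ultimately show ?thesis using \<eta>x by (auto simp: leaves_def)
  qed
  show ?thesis
    using bij ext leaf has_fibred_affine_lifts_smooth_map[OF lifts(1)] has_fibred_affine_lifts_smooth_map[OF lifts']
      has_fibred_affine_lifts_holomorphic[OF lifts(1)] has_fibred_affine_lifts_holomorphic[OF lifts']
    by (simp add: Aut_fol_def Bij_def)
qed

text \<open>
  Translating by \<open>\<beta> x\<close> before moving \<open>x\<close> to \<open>\<eta> x\<close> makes the composition of two such maps reproduce the
  multiplication of the semidirect product.
\<close>

definition skew :: "((real \<Rightarrow> complex) \<times> (real \<Rightarrow> complex)) \<times> (real \<Rightarrow> real) \<Rightarrow> point \<Rightarrow> point" where
  "skew g = (\<lambda>((z1, z2), x). ((z1 + fst (fst g) x, z2 + snd (fst g) x), snd g x))"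

lemma skew_apply: "skew (\<beta>, \<eta>) ((z1, z2), x) = ((z1 + fst \<beta> x, z2 + snd \<beta> x), \<eta> x)"
  by (simp add: skew_def)

lemma snd_skew: "snd (skew g u) = snd g (snd u)"
  by (simp add: skew_def split: prod.splits)

lemma point_cases:
  assumes "u \<in> Rtilde"
  obtains z1 z2 x where "u = ((z1, z2), x)" "x \<ge> 0"
  using snd_Rtilde_nonneg[OF assms] that by (metis prod.exhaust snd_conv)

context Reeb_data
begin

lemma skew_mult:
  assumes "g \<in> carrier SZ" "h \<in> carrier SZ" "u \<in> Rtilde"
  shows "skew (g \<otimes>\<^bsub>SZ\<^esub> h) u = skew g (skew h u)"
proof -
  obtain \<beta> \<eta> where g: "g = (\<beta>, \<eta>)" "\<beta> \<in> S" "\<eta> \<in> carrier Z" using SZ_cases[OF assms(1)] .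
  obtain \<beta>' \<eta>' where h: "h = (\<beta>', \<eta>')" "\<beta>' \<in> S" "\<eta>' \<in> carrier Z" using SZ_cases[OF assms(2)] .
  obtain z1 z2 x where u: "u = ((z1, z2), x)" "x \<ge> 0" using point_cases[OF assms(3)] .
  show ?thesis
    unfolding g(1) h(1) u(1) SZ_mult skew_apply
    using u(2) g h by (simp add: S_act_apply Z_mult_apply)
qed

lemma skew_one:
  assumes "u \<in> Rtilde"
  shows "skew \<one>\<^bsub>SZ\<^esub> u = u"
proof -
  obtain z1 z2 x where u: "u = ((z1, z2), x)" "x \<ge> 0" using point_cases[OF assms] .
  then show ?thesis by (simp add: SZ_one Z_one skew_apply)
qed

lemma skew_mem:
  assumes "g \<in> carrier SZ" "u \<in> Rtilde"
  shows "skew g u \<in> Rtilde"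
proof -
  obtain \<beta> \<eta> where g: "g = (\<beta>, \<eta>)" "\<beta> \<in> S" "\<eta> \<in> carrier Z" using SZ_cases[OF assms(1)] .
  obtain z1 z2 x where u: "u = ((z1, z2), x)" "x \<ge> 0" using point_cases[OF assms(2)] .
  show ?thesis
  proof (cases "x = 0")
    case True
    then show ?thesis
      using assms(2) S_at_0[OF g(2)] Z_0[OF g(3)] unfolding g(1) u(1) skew_apply mem_Rtilde by simp
  next
    case False
    then have "\<eta> x > 0" using Z_pos[OF g(3)] u(2) by simp
    then show ?thesis unfolding g(1) u(1) skew_apply mem_Rtilde by simp
  qed
qed

lemma skew_T:
  assumes "g \<in> carrier SZ" "u \<in> Rtilde"
  shows "skew g (T u) = T (skew g u)"
proof -
  obtain \<beta> \<eta> where g: "g = (\<beta>, \<eta>)" "\<beta> \<in> S" "\<eta> \<in> carrier Z" using SZ_cases[OF assms(1)] .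
  obtain z1 z2 x where u: "u = ((z1, z2), x)" "x \<ge> 0" using point_cases[OF assms(2)] .
  show ?thesis
    unfolding g(1) u(1) skew_apply T_apply
    using S_memD(4,5)[OF g(2) u(2)] Z_memD(9)[OF g(3) u(2)] by (simp add: algebra_simps)
qed

lemma skew_bd:
  assumes "g \<in> carrier SZ" "u \<in> leaf_tilde 0"
  shows "skew g u = u"
proof -
  obtain \<beta> \<eta> where g: "g = (\<beta>, \<eta>)" "\<beta> \<in> S" "\<eta> \<in> carrier Z" using SZ_cases[OF assms(1)] .
  obtain z1 z2 where u: "u = ((z1, z2), 0)" using assms(2) by (auto simp: leaf_tilde_0)
  show ?thesis unfolding g(1) u skew_apply using S_at_0[OF g(2)] Z_0[OF g(3)] by simp
qed

lemma skew_Tz: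
  assumes g: "g \<in> carrier SZ" and u: "u \<in> Rtilde"
  shows "skew g (Tz n u) = Tz n (skew g u)"
proof (induction n rule: int_induct[of _ 0])
  case base
  show ?case by (simp add: Tz_0)
next
  case (step1 i)
  then show ?case
    using Tz_plus_1[OF u, of i] Tz_plus_1[OF skew_mem[OF g u], of i] skew_T[OF g Tz_mem[OF u]] by simp
next
  case (step2 i)
  have mem: "Tz (i - 1) u \<in> Rtilde" using Tz_mem[OF u] .
  have "T (skew g (Tz (i - 1) u)) = skew g (Tz i u)"
    using skew_T[OF g mem] Tz_plus_1[OF u, of "i - 1"] by simp
  then have "skew g (Tz (i - 1) u) = T_inv (Tz i (skew g u))"
    using T_inv_T[OF skew_mem[OF g mem]] step2 by metis
  then show ?case using Tz_minus_1[OF skew_mem[OF g u]] by simp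
qed

lemma fibred_affine_skew:
  assumes "g \<in> carrier SZ"
  shows "fibred_affine (skew g)"
proof -
  obtain \<beta> \<eta> where g: "g = (\<beta>, \<eta>)" "\<beta> \<in> S" "\<eta> \<in> carrier Z" using SZ_cases[OF assms] .
  show ?thesis
    by (rule fibred_affineI[of "fst \<beta>" "snd \<beta>" \<eta> _ 1 0])
       (use S_memD(1,2)[OF g(2)] Z_memD(3,5)[OF g(3)] in \<open>auto simp: g(1) skew_apply\<close>)
qed

lemma skew_inverse:
  assumes "g \<in> carrier SZ" "u \<in> Rtilde"
  shows "skew (inv\<^bsub>SZ\<^esub> g) (skew g u) = u" "skew g (skew (inv\<^bsub>SZ\<^esub> g) u) = u"
  using skew_mult[of "inv\<^bsub>SZ\<^esub> g" g u] skew_mult[of g "inv\<^bsub>SZ\<^esub> g" u] skew_one[OF assms(2)] assms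
  by (simp_all add: group.inv_closed[OF group_SZ] group.l_inv[OF group_SZ] group.r_inv[OF group_SZ])

definition skew_aut :: "((real \<Rightarrow> complex) \<times> (real \<Rightarrow> complex)) \<times> (real \<Rightarrow> real) \<Rightarrow> point set \<Rightarrow> point set" where
  "skew_aut g = induced T (skew g)"

lemma skew_aut_orbit:
  assumes "g \<in> carrier SZ" "u \<in> Rtilde"
  shows "skew_aut g (orbit T u) = orbit T (skew g u)"
proof -
  have "skew_aut g (orbit T u) = skew g ` range (\<lambda>n. Tz n u)"
    using assms(2) orbit_eq_range by (simp add: skew_aut_def induced_def)
  also have "\<dots> = range (\<lambda>n. Tz n (skew g u))"
    unfolding image_image using skew_Tz[OF assms] by simp
  also have "\<dots> = orbit T (skew g u)" using orbit_eq_range skew_mem[OF assms] by simp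
  finally show ?thesis .
qed

text \<open>A lift through a given point is the skew product followed by a power of \<open>T\<close>.\<close>

lemma skew_aut_lifts:
  assumes g: "g \<in> carrier SZ"
  shows "has_fibred_affine_lifts (orbit T) (skew_aut g)"
  unfolding has_fibred_affine_lifts_def
proof (intro ballI impI)
  fix u v assume u: "u \<in> Rtilde" and v: "v \<in> Rtilde" "orbit T v = skew_aut g (orbit T u)"
  then have "orbit T (skew g u) = orbit T v" using skew_aut_orbit[OF g u] by simp
  then obtain n where n: "v = Tz n (skew g u)" using orbit_eq_iff skew_mem[OF g u] v(1) by blast
  show "\<exists>\<Phi>. fibred_affine \<Phi> \<and> \<Phi> u = v \<and>
      (\<forall>w\<in>Rtilde. \<Phi> w \<in> Rtilde \<and> orbit T (\<Phi> w) = skew_aut g (orbit T w))"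
    using n fibred_affine_comp[OF fibred_affine_Tz[of n] fibred_affine_skew[OF g]] g
    by (intro exI[of _ "\<lambda>w. Tz n (skew g w)"])
       (simp add: Tz_mem skew_mem skew_aut_orbit orbit_Tz)
qed

lemma skew_restrict_lifts:
  assumes g: "g \<in> carrier SZ"
  shows "has_fibred_affine_lifts id (restrict (skew g) Rtilde)"
  unfolding has_fibred_affine_lifts_def
proof (intro ballI impI)
  fix u v assume "u \<in> Rtilde" "v \<in> Rtilde" "id v = restrict (skew g) Rtilde (id u)"
  then show "\<exists>\<Phi>. fibred_affine \<Phi> \<and> \<Phi> u = v \<and>
      (\<forall>w\<in>Rtilde. \<Phi> w \<in> Rtilde \<and> id (\<Phi> w) = restrict (skew g) Rtilde (id w))"
    using fibred_affine_skew[OF g] skew_mem[OF g] by (intro exI[of _ "skew g"]) simp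
qed

lemma skew_aut_mem:
  assumes g: "g \<in> carrier SZ"
  shows "skew_aut g \<in> carrier (Aut_RH T)"
proof -
  have i: "inv\<^bsub>SZ\<^esub> g \<in> carrier SZ" using group.inv_closed[OF group_SZ g] .
  have "skew_aut g \<in> carrier (Aut_R T)"
    by (rule Aut_fol_memI[of _ _ "skew g" "skew_aut (inv\<^bsub>SZ\<^esub> g)" "skew (inv\<^bsub>SZ\<^esub> g)"
          "snd g" "snd (inv\<^bsub>SZ\<^esub> g)"])
       (simp_all add: skew_aut_orbit skew_mem skew_inverse snd_skew skew_aut_lifts g i,
        simp add: skew_aut_def induced_def)
  moreover have "skew_aut g q = q" if q: "q \<in> boundary_leaf T" for q
  proof -
    obtain u where u: "q = orbit T u" "u \<in> leaf_tilde 0" using q by (auto simp: boundary_leaf_def)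
    then have "u \<in> Rtilde" using leaf_tilde_subset by blast
    then show ?thesis using skew_aut_orbit[OF g] skew_bd[OF g u(2)] u(1) by simp
  qed
  ultimately show ?thesis by (simp add: Aut_RH_def)
qed

lemma skew_restrict_mem:
  assumes g: "g \<in> carrier SZ"
  shows "restrict (skew g) Rtilde \<in> carrier (Aut_fol id)"
proof -
  have i: "inv\<^bsub>SZ\<^esub> g \<in> carrier SZ" using group.inv_closed[OF group_SZ g] .
  show ?thesis
    by (rule Aut_fol_memI[of _ _ "skew g" "restrict (skew (inv\<^bsub>SZ\<^esub> g)) Rtilde" "skew (inv\<^bsub>SZ\<^esub> g)"
          "snd g" "snd (inv\<^bsub>SZ\<^esub> g)"])
       (simp_all add: skew_mem skew_inverse snd_skew skew_restrict_lifts g i)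
qed

lemma skew_aut_eq_iff:
  assumes g: "g \<in> carrier SZ" and h: "h \<in> carrier SZ" and eq: "skew_aut g = skew_aut h"
  shows "g = h"
proof -
  have "skew g u = skew h u" if "u \<in> Rtilde" for u
  proof (rule normalised_lift_unique[OF _ _ _ _ _ _ that])
    show "continuous_on Rtilde (skew g)" "continuous_on Rtilde (skew h)"
      using fibred_affine_continuous fibred_affine_skew g h by blast+
    show "orbit T (skew g u) = orbit T (skew h u)" if "u \<in> Rtilde" for u
      using skew_aut_orbit[OF g that] skew_aut_orbit[OF h that] eq by simp
    show "skew g ` Rtilde \<subseteq> Rtilde" by (rule image_subsetI) (rule skew_mem[OF g])
    show "skew h ` Rtilde \<subseteq> Rtilde" by (rule image_subsetI) (rule skew_mem[OF h])
    show "skew g w = skew h w" if "w \<in> leaf_tilde 0" for w by (simp add: skew_bd g h that)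
  qed
  then have *: "skew g ((1, 0), x) = skew h ((1, 0), x)" if "x \<ge> 0" for x
    using that by (simp add: Rtilde_def)
  obtain \<beta> \<eta> where g': "g = (\<beta>, \<eta>)" "\<beta> \<in> S" "\<eta> \<in> carrier Z" using SZ_cases[OF g] .
  obtain \<beta>' \<eta>' where h': "h = (\<beta>', \<eta>')" "\<beta>' \<in> S" "\<eta>' \<in> carrier Z" using SZ_cases[OF h] .
  have eq: "fst \<beta> x = fst \<beta>' x" "snd \<beta> x = snd \<beta>' x" "\<eta> x = \<eta>' x" if "x \<ge> 0" for x
    using *[OF that] by (simp_all add: g'(1) h'(1) skew_apply)
  have "\<beta> = \<beta>'"
  proof (rule prod_fun_eqI)
    fix x
    show "fst \<beta> x = fst \<beta>' x"
      using eq(1)[of x] S_memD(3)[OF g'(2), of x] S_memD(3)[OF h'(2), of x] by (cases "x \<ge> 0") auto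
    show "snd \<beta> x = snd \<beta>' x"
      using eq(2)[of x] S_memD(3)[OF g'(2), of x] S_memD(3)[OF h'(2), of x] by (cases "x \<ge> 0") auto
  qed
  moreover have "\<eta> = \<eta>'"
    using Z_memD(2)[OF g'(3)] Z_memD(2)[OF h'(3)] eq(3) by (intro extensionalityI) auto
  ultimately show ?thesis using g' h' by simp
qed

lemma Aut_RH_Bij: "f \<in> carrier (Aut_RH T) \<Longrightarrow> f \<in> Bij (orbit T ` Rtilde)"
  by (simp add: Aut_RH_def Aut_fol_def)

lemma Aut_RH_mult:
  assumes "f \<in> carrier (Aut_RH T)" "h \<in> carrier (Aut_RH T)"
  shows "f \<otimes>\<^bsub>Aut_RH T\<^esub> h = compose (orbit T ` Rtilde) f h"
  using BijGroup_mult[OF Aut_RH_Bij[OF assms(1)] Aut_RH_Bij[OF assms(2)]]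
  by (simp add: Aut_RH_def Aut_fol_def)

lemma skew_aut_mult:
  assumes g: "g \<in> carrier SZ" and h: "h \<in> carrier SZ"
  shows "skew_aut (g \<otimes>\<^bsub>SZ\<^esub> h) = skew_aut g \<otimes>\<^bsub>Aut_RH T\<^esub> skew_aut h"
proof (rule extensionalityI)
  have gh: "g \<otimes>\<^bsub>SZ\<^esub> h \<in> carrier SZ" using group.is_monoid[OF group_SZ] g h by (rule monoid.m_closed)
  show "skew_aut (g \<otimes>\<^bsub>SZ\<^esub> h) \<in> extensional (orbit T ` Rtilde)"
    using Aut_RH_Bij[OF skew_aut_mem[OF gh]] by (rule Bij_imp_extensional)
  show "skew_aut g \<otimes>\<^bsub>Aut_RH T\<^esub> skew_aut h \<in> extensional (orbit T ` Rtilde)"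
    by (simp add: Aut_RH_mult skew_aut_mem g h)
  fix q assume q: "q \<in> orbit T ` Rtilde"
  then obtain u where u: "u \<in> Rtilde" "q = orbit T u" by blast
  have "(skew_aut g \<otimes>\<^bsub>Aut_RH T\<^esub> skew_aut h) q = skew_aut g (skew_aut h q)"
    using q by (simp add: Aut_RH_mult skew_aut_mem g h compose_def)
  then show "skew_aut (g \<otimes>\<^bsub>SZ\<^esub> h) q = (skew_aut g \<otimes>\<^bsub>Aut_RH T\<^esub> skew_aut h) q"
    using u by (simp add: skew_aut_orbit gh g h skew_mem skew_mult)
qed


section \<open>Every automorphism fixing the boundary leaf is a skew product\<close>

text \<open>
  Being locally a smooth and leafwise holomorphic lift, the normalised lift is smooth, maps leaves to
  leaves and is holomorphic on them, so by rigidity it is a translation on each leaf. The translation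
  vector and \<open>\<eta>\<close> are read off along the line \<open>x \<mapsto> ((1, 0), x)\<close>, which crosses every leaf including the
  boundary leaf; this makes them smooth up to \<open>x = 0\<close>. The hypotheses on \<open>f\<close> are part of being an
  automorphism and are passed on to the inverse of \<open>f\<close>.
\<close>

lemma skew_product_form:
  assumes f: "f ` orbit T ` Rtilde \<subseteq> orbit T ` Rtilde" and sm: "smooth_map (orbit T) f"
    and hol: "\<And>q. q \<in> orbit T ` Rtilde \<Longrightarrow> \<exists>L. q \<in> L \<and> holomorphic_on_leaf (orbit T) f L"
    and fix_bd: "\<And>q. q \<in> boundary_leaf T \<Longrightarrow> f q = q"
  obtains \<beta> \<eta> where "\<beta> \<in> S" "smooth_on {0..} \<eta>" "\<forall>x\<ge>0. \<eta> x \<ge> 0" "\<forall>x\<ge>0. \<eta> (\<phi> x) = \<phi> (\<eta> x)"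
    "continuous_on Rtilde (skew (\<beta>, \<eta>))" "skew (\<beta>, \<eta>) ` Rtilde \<subseteq> Rtilde"
    "\<forall>u\<in>leaf_tilde 0. skew (\<beta>, \<eta>) u = u" "\<forall>u\<in>Rtilde. orbit T (skew (\<beta>, \<eta>) u) = f (orbit T u)"
proof -
  obtain F where cont: "continuous_on Rtilde F" and mem: "F ` Rtilde \<subseteq> Rtilde"
    and orb: "\<forall>u\<in>Rtilde. orbit T (F u) = f (orbit T u)" and bd: "\<forall>u\<in>leaf_tilde 0. F u = u"
    and equi: "\<forall>u\<in>Rtilde. F (T u) = T (F u)"
    by (rule normalised_lift_exists[OF f sm fix_bd]) (assumption, rule that)
  have smooth: "smooth_on Rtilde F"
  proof (rule smooth_on_local)
    fix u assume u: "u \<in> Rtilde"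
    then have Fu: "F u \<in> Rtilde" "orbit T (F u) = f (orbit T u)" using mem orb by auto
    obtain U F' where U: "open U" "u \<in> U" "smooth_on (U \<inter> Rtilde) F'" "F' u = F u"
      "\<forall>w\<in>U \<inter> Rtilde. F' w \<in> Rtilde \<and> orbit T (F' w) = f (orbit T w)"
      by (rule smooth_map_local_lift[OF sm u Fu]) (rule that)
    have "\<exists>V. open V \<and> u \<in> V \<and> (\<forall>w\<in>(U \<inter> Rtilde) \<inter> V. F w = F' w)"
    proof (rule lifts_agree_locally[of "U \<inter> Rtilde" F F' u])
      show "continuous_on (U \<inter> Rtilde) F" using cont continuous_on_subset by blast
      show "continuous_on (U \<inter> Rtilde) F'" using U(3) smooth_on_imp_continuous_on by blast
      show "orbit T (F w) = orbit T (F' w)" if "w \<in> U \<inter> Rtilde" for w using orb U(5) that by auto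
      show "F ` (U \<inter> Rtilde) \<subseteq> Rtilde" using mem by blast
      show "F' ` (U \<inter> Rtilde) \<subseteq> Rtilde" using U(5) by blast
      show "u \<in> U \<inter> Rtilde" "F u = F' u" using U u by simp_all
    qed
    then obtain V where V: "open V" "u \<in> V" "\<forall>w\<in>(U \<inter> Rtilde) \<inter> V. F w = F' w" by blast
    have "smooth_on (Rtilde \<inter> (U \<inter> V)) F'" by (rule smooth_on_subset[OF U(3)]) auto
    then have "smooth_on (Rtilde \<inter> (U \<inter> V)) F" by (rule smooth_on_cong) (use V(3) in auto)
    then show "\<exists>W. open W \<and> u \<in> W \<and> smooth_on (Rtilde \<inter> W) F"
      using U(1,2) V(1,2) by (intro exI[of _ "U \<inter> V"]) auto
  qed
  have leaf: "\<exists>V h. open V \<and> z \<in> V \<and> holomorphic2_on h V \<and>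
      (\<forall>z'\<in>V. F (z', x) = (h z', snd (F (z, x))))" if zx: "(z, x) \<in> Rtilde" for z x
  proof -
    obtain w y where wy: "F (z, x) = (w, y)" by fastforce
    have "orbit T (z, x) \<in> orbit T ` Rtilde" using zx by blast
    then obtain L where L: "orbit T (z, x) \<in> L" "holomorphic_on_leaf (orbit T) f L" using hol by blast
    have wyR: "(w, y) \<in> Rtilde" "orbit T (w, y) = f (orbit T (z, x))"
      using mem orb zx wy by force+
    obtain U h where U: "open U" "z \<in> U" "holomorphic2_on h U" "h z = w"
      "\<forall>z'\<in>U. (z', x) \<in> Rtilde \<and> (h z', y) \<in> Rtilde \<and> orbit T (h z', y) = f (orbit T (z', x))"
      using L(2)[unfolded holomorphic_on_leaf_def, rule_format, OF zx wyR(1) L(1) wyR(2)]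
      by (elim exE conjE) (rule that)
    have conth: "continuous_on U h"
      using U(3) has_derivative_continuous unfolding holomorphic2_on_def
      by (intro continuous_at_imp_continuous_on) blast
    have "\<exists>V. open V \<and> z \<in> V \<and> (\<forall>z'\<in>U \<inter> V. F (z', x) = (h z', y))"
    proof (rule lifts_agree_locally[of U "\<lambda>z'. F (z', x)" "\<lambda>z'. (h z', y)" z])
      show "continuous_on U (\<lambda>z'. F (z', x))"
        by (rule continuous_on_compose2[OF cont]) (use U(5) in \<open>auto intro!: continuous_intros\<close>)
      show "continuous_on U (\<lambda>z'. (h z', y))" by (intro continuous_intros conth)
      show "(\<lambda>z'. F (z', x)) ` U \<subseteq> Rtilde" using U(5) mem by blast
      show "orbit T (F (z', x)) = orbit T (h z', y)" if "z' \<in> U" for z' using U(5) orb that by auto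
      show "(\<lambda>z'. (h z', y)) ` U \<subseteq> Rtilde" using U(5) by blast
      show "z \<in> U" "F (z, x) = (h z, y)" using U(2,4) wy by simp_all
    qed
    then obtain V where V: "open V" "z \<in> V" "\<forall>z'\<in>U \<inter> V. F (z', x) = (h z', y)" by blast
    show ?thesis
      using U V wy unfolding holomorphic2_on_def
      by (intro exI[of _ "U \<inter> V"] exI[of _ h]) auto
  qed
  define \<eta> where "\<eta> = (\<lambda>x. snd (F ((1, 0), x)))"
  have base: "((1, 0), x) \<in> Rtilde" if "x \<ge> 0" for x using that by (simp add: Rtilde_def)
  have F0: "F (z, 0) = (z, 0)" if "z \<noteq> (0, 0)" for z using bd that by (simp add: leaf_tilde_0)
  have sndF: "snd (F (z, x)) = \<eta> x" if zx: "(z, x) \<in> Rtilde" for z x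
  proof (cases "x = 0")
    case True
    then show ?thesis using zx F0[of z] F0[of "(1, 0)"] by (auto simp: Rtilde_def \<eta>_def)
  next
    case False
    then have x: "x > 0" using snd_Rtilde_nonneg[OF zx] by simp
    show ?thesis
      unfolding \<eta>_def
    proof (rule connected_local_const[of UNIV z "(1, 0)" "\<lambda>z. snd (F (z, x))"])
      show "\<forall>a\<in>UNIV. eventually (\<lambda>b. snd (F (a, x)) = snd (F (b, x))) (at a within UNIV)"
      proof
        fix a :: "complex \<times> complex"
        have "(a, x) \<in> Rtilde" using x by (simp add: Rtilde_def)
        then obtain V h where V: "open V" "a \<in> V" "\<forall>z'\<in>V. F (z', x) = (h z', snd (F (a, x)))"
          using leaf by blast
        have "snd (F (a, x)) = snd (F (b, x))" if "b \<in> V" for b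
          using arg_cong[OF bspec[OF V(3) that], of snd] by (simp only: snd_conv)
        then show "eventually (\<lambda>b. snd (F (a, x)) = snd (F (b, x))) (at a within UNIV)"
          unfolding eventually_at_topological using V(1,2) by (intro exI[of _ V]) blast
      qed
    qed auto
  qed
  have hol': "\<exists>D. ((\<lambda>z. fst (F (z, x))) has_derivative D) (at z) \<and> complex_linear2 D" if x: "x > 0" for x z
  proof -
    have "(z, x) \<in> Rtilde" using x by (simp add: Rtilde_def)
    then obtain V h where V: "open V" "z \<in> V" "holomorphic2_on h V" "\<forall>z'\<in>V. F (z', x) = (h z', snd (F (z, x)))"
      using leaf by blast
    then obtain D where D: "(h has_derivative D) (at z)" "complex_linear2 D"
      unfolding holomorphic2_on_def complex_linear2_def by blast
    have "((\<lambda>z. fst (F (z, x))) has_derivative D) (at z)"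
    proof (rule has_derivative_transform_within_open[OF D(1) V(1,2)])
      show "h z' = fst (F (z', x))" if "z' \<in> V" for z'
        using arg_cong[OF bspec[OF V(4) that], of fst] by (simp only: fst_conv)
    qed
    then show ?thesis using D(2) by blast
  qed
  define b where "b = (\<lambda>x. fst (F ((1, 0), x)) - (1, 0))"
  have F_eq: "F (z, x) = (z + b x, \<eta> x)" if zx: "(z, x) \<in> Rtilde" for z x
  proof (cases "x = 0")
    case True
    then have "z \<noteq> (0, 0)" using zx by (auto simp: Rtilde_def)
    then show ?thesis using True F0[of z] F0[of "(1, 0)"] by (simp add: b_def \<eta>_def zero_prod_def)
  next
    case False
    then have x: "x > 0" using snd_Rtilde_nonneg[OF zx] by simp
    have "fst (F (z, x)) = fst (F ((0, 0), x)) + z" "fst (F ((1, 0), x)) = fst (F ((0, 0), x)) + (1, 0)"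
      using translation_on_leaf[OF cont equi bd hol' x] by blast+
    then have "fst (F (z, x)) = z + b x" by (simp add: b_def)
    then show ?thesis using sndF[OF zx] by (simp add: prod_eq_iff)
  qed
  define \<beta> where "\<beta> = (\<lambda>x. if x \<ge> 0 then fst (b x) else 0, \<lambda>x. if x \<ge> 0 then snd (b x) else 0)"
  have skew_eq: "F u = skew (\<beta>, \<eta>) u" if u: "u \<in> Rtilde" for u
  proof -
    obtain z1 z2 x where u': "u = ((z1, z2), x)" "x \<ge> 0" using point_cases[OF u] .
    have "F ((z1, z2), x) = ((z1, z2) + b x, \<eta> x)" using F_eq u u'(1) by blast
    moreover have "(z1, z2) + b x = (z1 + fst (b x), z2 + snd (b x))" by (simp add: prod_eq_iff)
    ultimately show ?thesis unfolding u'(1) skew_apply using u'(2) by (simp add: \<beta>_def)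
  qed
  have "smooth_on {0..} (\<lambda>x. F (((1, 0), 0) + ((0, 0), x)))"
    by (rule smooth_on_affine_compose[OF smooth])
       (auto simp: Rtilde_def intro!: bounded_linear_Pair bounded_linear_zero bounded_linear_ident)
  then have line: "smooth_on {0..} (\<lambda>x. F ((1, 0), x))" by simp
  have sm_eta: "smooth_on {0..} \<eta>"
    unfolding \<eta>_def by (rule smooth_on_bounded_linear_compose[OF line bounded_linear_snd])
  have sm_b: "smooth_on {0..} b"
    unfolding b_def diff_conv_add_uminus
    by (rule smooth_on_add[OF smooth_on_bounded_linear_compose[OF line bounded_linear_fst] smooth_on_const])
  have eta_nonneg: "\<eta> x \<ge> 0" if "x \<ge> 0" for x
    using mem base[OF that] snd_Rtilde_nonneg unfolding \<eta>_def by blast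
  have TF: "\<eta> (\<phi> x) = \<phi> (\<eta> x) \<and> fst (b (\<phi> x)) = lam * fst (b x) + snd (b x) \<and> snd (b (\<phi> x)) = lam * snd (b x)"
    if x: "x \<ge> 0" for x
  proof -
    have "F (T ((1, 0), x)) = T (F ((1, 0), x))" using equi base[OF x] by blast
    moreover have "T ((1, 0), x) = ((lam, 0), \<phi> x)" by (simp add: T_apply)
    moreover have "((lam, 0), \<phi> x) \<in> Rtilde" using phi_nonneg[OF x] lam_nonzero by (simp add: Rtilde_def)
    then have "F ((lam, 0), \<phi> x) = ((lam, 0) + b (\<phi> x), \<eta> (\<phi> x))" by (rule F_eq)
    moreover have "F ((1, 0), x) = ((1 + fst (b x), snd (b x)), \<eta> x)"
      using F_eq[OF base[OF x]] by (simp add: prod_eq_iff)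
    ultimately show ?thesis by (simp add: T_apply prod_eq_iff algebra_simps)
  qed
  show thesis
  proof (rule that)
    show "\<beta> \<in> S"
    proof (rule S_memI)
      show "smooth_on {0..} (fst \<beta>)"
        by (rule smooth_on_cong[OF smooth_on_bounded_linear_compose[OF sm_b bounded_linear_fst]])
           (simp add: \<beta>_def)
      show "smooth_on {0..} (snd \<beta>)"
        by (rule smooth_on_cong[OF smooth_on_bounded_linear_compose[OF sm_b bounded_linear_snd]])
           (simp add: \<beta>_def)
    qed (use TF phi_nonneg in \<open>auto simp: \<beta>_def\<close>)
    show "continuous_on Rtilde (skew (\<beta>, \<eta>))"
      using cont skew_eq by (simp cong: continuous_on_cong)
    show "skew (\<beta>, \<eta>) ` Rtilde \<subseteq> Rtilde" using mem skew_eq by (simp cong: image_cong)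
    show "\<forall>u\<in>leaf_tilde 0. skew (\<beta>, \<eta>) u = u" using bd skew_eq leaf_tilde_subset by (metis subsetD)
    show "\<forall>u\<in>Rtilde. orbit T (skew (\<beta>, \<eta>) u) = f (orbit T u)" using orb skew_eq by simp
  qed (use sm_eta eta_nonneg TF in auto)
qed


text \<open>
  The parameters \<open>\<eta>\<close> and \<open>\<eta>'\<close> of an automorphism and of its inverse are mutually inverse, because the
  composition of the normalised lifts is a lift of the identity. This puts \<open>\<eta>\<close> into the centralizer.
\<close>

lemma skew_aut_surj:
  assumes f: "f \<in> carrier (Aut_RH T)"
  shows "\<exists>g\<in>carrier SZ. skew_aut g = f"
proof -
  let ?Q = "orbit T ` Rtilde"
  let ?h = "inv_into ?Q f"
  have bdf: "f q = q" if "q \<in> boundary_leaf T" for q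
    using f that by (simp add: Aut_RH_def)
  have fR: "f \<in> carrier (Aut_R T)" using f by (simp add: Aut_RH_def)
  have bij: "bij_betw f ?Q ?Q" and ext: "f \<in> extensional ?Q"
    using Aut_RH_Bij[OF f] by (auto simp: Bij_def)
  have sm: "smooth_map (orbit T) f" "smooth_map (orbit T) ?h"
    and leaf: "\<forall>L\<in>leaves (orbit T). f ` L \<in> leaves (orbit T) \<and> holomorphic_on_leaf (orbit T) f L \<and>
       holomorphic_on_leaf (orbit T) ?h (f ` L)"
    using fR by (simp_all add: Aut_fol_def)
  have in_leaf: "\<exists>L\<in>leaves (orbit T). q \<in> L" if q: "q \<in> ?Q" for q
  proof -
    obtain z x where zx: "(z, x) \<in> Rtilde" "q = orbit T (z, x)" using q by fast
    then have "q \<in> orbit T ` leaf_tilde x" "x \<ge> 0"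
      using snd_Rtilde_nonneg[OF zx(1)] by (auto simp: leaf_tilde_def)
    then show ?thesis by (auto simp: leaves_def)
  qed
  have hf: "?h (f q) = q" and fh: "f (?h q) = q" and hQ: "?h q \<in> ?Q" and fQ: "f q \<in> ?Q" if "q \<in> ?Q" for q
    using that bij bij_betw_inv_into[OF bij]
    by (simp_all only: bij_betw_inv_into_left bij_betw_inv_into_right bij_betwE)
  have bdQ: "boundary_leaf T \<subseteq> ?Q" using leaf_tilde_subset by (auto simp: boundary_leaf_def)
  obtain \<beta> \<eta> where 1: "\<beta> \<in> S" "smooth_on {0..} \<eta>" "\<forall>x\<ge>0. \<eta> x \<ge> 0" "\<forall>x\<ge>0. \<eta> (\<phi> x) = \<phi> (\<eta> x)"
    "continuous_on Rtilde (skew (\<beta>, \<eta>))" "skew (\<beta>, \<eta>) ` Rtilde \<subseteq> Rtilde"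
    "\<forall>u\<in>leaf_tilde 0. skew (\<beta>, \<eta>) u = u" "\<forall>u\<in>Rtilde. orbit T (skew (\<beta>, \<eta>) u) = f (orbit T u)"
  proof (rule skew_product_form[of f])
    show "\<exists>L. q \<in> L \<and> holomorphic_on_leaf (orbit T) f L" if "q \<in> ?Q" for q
      using in_leaf[OF that] leaf by blast
  qed (use fQ sm bdf in \<open>blast+\<close>)
  obtain \<beta>' \<eta>' where 2: "\<beta>' \<in> S" "smooth_on {0..} \<eta>'" "\<forall>x\<ge>0. \<eta>' x \<ge> 0" "\<forall>x\<ge>0. \<eta>' (\<phi> x) = \<phi> (\<eta>' x)"
    "continuous_on Rtilde (skew (\<beta>', \<eta>'))" "skew (\<beta>', \<eta>') ` Rtilde \<subseteq> Rtilde"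
    "\<forall>u\<in>leaf_tilde 0. skew (\<beta>', \<eta>') u = u" "\<forall>u\<in>Rtilde. orbit T (skew (\<beta>', \<eta>') u) = ?h (orbit T u)"
  proof (rule skew_product_form[of ?h])
    show "\<exists>L. q \<in> L \<and> holomorphic_on_leaf (orbit T) ?h L" if q: "q \<in> ?Q" for q
    proof -
      obtain L where L: "L \<in> leaves (orbit T)" "?h q \<in> L" using in_leaf[OF hQ[OF q]] by blast
      then have "q \<in> f ` L" using fh[OF q] by (metis image_eqI)
      then show ?thesis using leaf L(1) by blast
    qed
    show "?h q = q" if "q \<in> boundary_leaf T" for q
      using hf[of q] bdf[OF that] that bdQ by auto
  qed (use hQ sm in \<open>blast+\<close>)
  have comp: "A (B u) = u"
    if A: "continuous_on Rtilde A" "A ` Rtilde \<subseteq> Rtilde" "\<forall>u\<in>leaf_tilde 0. A u = u"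
        "\<forall>u\<in>Rtilde. orbit T (A u) = a (orbit T u)"
      and B: "continuous_on Rtilde B" "B ` Rtilde \<subseteq> Rtilde" "\<forall>u\<in>leaf_tilde 0. B u = u"
        "\<forall>u\<in>Rtilde. orbit T (B u) = b (orbit T u)"
      and ab: "\<And>q. q \<in> ?Q \<Longrightarrow> a (b q) = q" and u: "u \<in> Rtilde" for A B a b u
  proof (rule normalised_lift_unique[of "\<lambda>u. A (B u)" "\<lambda>u. u"])
    show "continuous_on Rtilde (\<lambda>u. A (B u))" by (rule continuous_on_compose2[OF A(1) B(1,2)])
    show "(\<lambda>u. A (B u)) ` Rtilde \<subseteq> Rtilde" using A(2) B(2) by blast
    show "orbit T (A (B w)) = orbit T w" if w: "w \<in> Rtilde" for w
    proof -
      have "B w \<in> Rtilde" using B(2) w by blast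
      then have "orbit T (A (B w)) = a (b (orbit T w))" using A(4) B(4) w by simp
      then show ?thesis using ab w by simp
    qed
    show "A (B w) = w" if "w \<in> leaf_tilde 0" for w using A(3) B(3) that by simp
  qed (use u in auto)
  have base: "((1, 0), x) \<in> Rtilde" if "x \<ge> 0" for x using that by (simp add: Rtilde_def)
  have e1: "\<eta>' (\<eta> x) = x" if "x \<ge> 0" for x
    using comp[OF 2(5-8) 1(5-8) hf base[OF that]] snd_skew[of "(\<beta>', \<eta>')"] snd_skew[of "(\<beta>, \<eta>)"]
    by (metis snd_conv)
  have e2: "\<eta> (\<eta>' x) = x" if "x \<ge> 0" for x
    using comp[OF 1(5-8) 2(5-8) fh base[OF that]] snd_skew[of "(\<beta>', \<eta>')"] snd_skew[of "(\<beta>, \<eta>)"]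
    by (metis snd_conv)
  have "restrict \<eta> {0..} \<in> carrier Z"
  proof (rule Z_memI[of _ \<eta>'])
    show "smooth_on {0..} (restrict \<eta> {0..})" by (rule smooth_on_cong[OF 1(2)]) simp
  qed (use 1(3,4) 2(2,3) e1 e2 phi_nonneg in auto)
  then have g: "(\<beta>, restrict \<eta> {0..}) \<in> carrier SZ" using 1(1) by (simp add: SZ_carrier)
  have "skew_aut (\<beta>, restrict \<eta> {0..}) = f"
  proof (rule extensionalityI[OF Bij_imp_extensional[OF Aut_RH_Bij[OF skew_aut_mem[OF g]]] ext])
    fix q assume "q \<in> ?Q"
    then obtain u where u: "u \<in> Rtilde" "q = orbit T u" by blast
    have "skew (\<beta>, restrict \<eta> {0..}) u = skew (\<beta>, \<eta>) u"
      by (rule point_cases[OF u(1)]) (simp add: skew_apply)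
    then show "skew_aut (\<beta>, restrict \<eta> {0..}) q = f q"
      using skew_aut_orbit[OF g u(1)] 1(8) u by simp
  qed
  then show ?thesis using g by blast
qed


section \<open>The exact sequence\<close>

lemma is_lift_skew:
  assumes g: "g \<in> carrier SZ"
  shows "is_lift T (skew_aut g) (restrict (skew g) Rtilde)"
  unfolding is_lift_def
  using skew_restrict_mem[OF g] skew_aut_orbit[OF g] skew_T[OF g] T_mem skew_bd[OF g] leaf_tilde_subset[of 0]
  by auto

lemma is_lift_continuous:
  assumes "is_lift T f F"
  shows "continuous_on Rtilde F" "F ` Rtilde \<subseteq> Rtilde" "F \<in> extensional Rtilde"
proof -
  have F: "F \<in> Bij Rtilde" "smooth_map id F"
    using assms by (simp_all add: is_lift_def Aut_fol_def)
  then show mem: "F ` Rtilde \<subseteq> Rtilde" and "F \<in> extensional Rtilde"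
    by (auto simp: Bij_def bij_betw_def)
  have "smooth_on Rtilde F"
  proof (rule smooth_on_local)
    fix u assume u: "u \<in> Rtilde"
    then have "F u \<in> Rtilde" using mem by blast
    then obtain U F' where U: "open U" "u \<in> U" "smooth_on (U \<inter> Rtilde) F'" "F' u = F u"
        "\<forall>w\<in>U \<inter> Rtilde. F' w \<in> Rtilde \<and> id (F' w) = F (id w)"
      by (rule smooth_map_local_lift[OF F(2) u]) (simp, rule that)
    have "smooth_on (Rtilde \<inter> U) F"
      by (rule smooth_on_cong[OF smooth_on_subset[OF U(3)]]) (use U(5) in auto)
    then show "\<exists>U. open U \<and> u \<in> U \<and> smooth_on (Rtilde \<inter> U) F" using U(1,2) by blast
  qed
  then show "continuous_on Rtilde F" by (rule smooth_on_imp_continuous_on)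
qed

lemma the_lift_skew:
  assumes g: "g \<in> carrier SZ"
  shows "the_lift T (skew_aut g) = restrict (skew g) Rtilde"
  unfolding the_lift_def
proof (rule the_equality)
  let ?B = "restrict (skew g) Rtilde"
  show B: "is_lift T (skew_aut g) ?B" by (rule is_lift_skew[OF g])
  fix F assume F: "is_lift T (skew_aut g) F"
  note cF = is_lift_continuous[OF F] and cB = is_lift_continuous[OF B]
  show "F = ?B"
  proof (rule extensionalityI[OF cF(3) cB(3)])
    show "F u = ?B u" if "u \<in> Rtilde" for u
    proof (rule normalised_lift_unique[OF cF(1,2) cB(1,2) _ _ that])
      show "orbit T (F w) = orbit T (?B w)" if "w \<in> Rtilde" for w
        using F B that unfolding is_lift_def by metis
      show "F w = ?B w" if "w \<in> leaf_tilde 0" for w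
        using F B that unfolding is_lift_def by metis
    qed
  qed
qed

lemma P_hom_skew:
  assumes g: "g \<in> carrier SZ"
  shows "P_hom T (skew_aut g) = snd g"
  unfolding P_hom_def the_lift_skew[OF g]
proof (rule the_equality)
  have ext: "snd g \<in> extensional {0..}"
    using g Z_memD(2) by (auto simp: SZ_carrier)
  then show "snd g \<in> extensional {0..} \<and> (\<forall>u\<in>Rtilde. snd (restrict (skew g) Rtilde u) = snd g (snd u))"
    by (simp add: snd_skew)
  fix \<eta> assume \<eta>: "\<eta> \<in> extensional {0..} \<and> (\<forall>u\<in>Rtilde. snd (restrict (skew g) Rtilde u) = \<eta> (snd u))"
  show "\<eta> = snd g"
  proof (rule extensionalityI[OF conjunct1[OF \<eta>] ext])
    fix x :: real assume "x \<in> {0..}"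
    then have u: "((1, 0), x) \<in> Rtilde" by (simp add: Rtilde_def)
    then show "\<eta> x = snd g x" using bspec[OF conjunct2[OF \<eta>] u] by (simp add: snd_skew)
  qed
qed

lemma skew_aut_iso: "skew_aut \<in> iso SZ (Aut_RH T)"
proof (rule isoI)
  show "skew_aut \<in> hom SZ (Aut_RH T)"
    by (rule homI) (auto simp: skew_aut_mem skew_aut_mult)
  show "bij_betw skew_aut (carrier SZ) (carrier (Aut_RH T))"
    unfolding bij_betw_def
  proof
    show "inj_on skew_aut (carrier SZ)" by (rule inj_onI) (rule skew_aut_eq_iff)
    show "skew_aut ` carrier SZ = carrier (Aut_RH T)" using skew_aut_mem skew_aut_surj by blast
  qed
qed

lemma one_Aut_RH: "skew_aut \<one>\<^bsub>SZ\<^esub> = \<one>\<^bsub>Aut_RH T\<^esub>"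
proof -
  have one: "\<one>\<^bsub>SZ\<^esub> \<in> carrier SZ" using group.is_monoid[OF group_SZ] by (rule monoid.one_closed)
  have "skew_aut \<one>\<^bsub>SZ\<^esub> = (\<lambda>q\<in>orbit T ` Rtilde. q)"
  proof (rule extensionalityI[OF Bij_imp_extensional[OF Aut_RH_Bij[OF skew_aut_mem[OF one]]]])
    fix q assume "q \<in> orbit T ` Rtilde"
    then obtain u where "u \<in> Rtilde" "q = orbit T u" by blast
    then show "skew_aut \<one>\<^bsub>SZ\<^esub> q = (\<lambda>q\<in>orbit T ` Rtilde. q) q"
      using skew_aut_orbit[OF one] skew_one by simp
  qed simp
  then show ?thesis by (simp add: Aut_RH_def Aut_fol_def BijGroup_def)
qed

text \<open>The group axioms are transported from the semidirect product.\<close>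

lemma group_Aut_RH: "group (Aut_RH T)"
proof -
  have hom: "skew_aut \<in> hom SZ (Aut_RH T)" using skew_aut_iso by (simp add: iso_def)
  have "skew_aut ` carrier SZ = carrier (Aut_RH T)" using skew_aut_iso by (auto simp: iso_def bij_betw_def)
  then show ?thesis
    using group.hom_imp_img_group[OF group_SZ hom] one_Aut_RH by simp
qed

lemma induced_translation:
  assumes b: "\<beta> \<in> S"
  shows "induced T (translation \<beta>) = skew_aut (\<beta>, \<one>\<^bsub>Z\<^esub>)"
proof -
  have "translation \<beta> u = skew (\<beta>, \<one>\<^bsub>Z\<^esub>) u" if "u \<in> Rtilde" for u
    by (rule point_cases[OF that]) (simp add: translation_def skew_apply Z_one)
  then have img: "translation \<beta> ` orbit T u = skew (\<beta>, \<one>\<^bsub>Z\<^esub>) ` orbit T u" if "u \<in> Rtilde" for u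
    by (intro image_cong) (auto simp: orbit_def)
  show ?thesis
  proof (rule ext)
    fix q
    show "induced T (translation \<beta>) q = skew_aut (\<beta>, \<one>\<^bsub>Z\<^esub>) q"
    proof (cases "q \<in> orbit T ` Rtilde")
      case True
      then obtain u where "u \<in> Rtilde" "q = orbit T u" by blast
      then show ?thesis using img by (simp add: skew_aut_def induced_def)
    next
      case False
      then show ?thesis by (simp add: skew_aut_def induced_def)
    qed
  qed
qed

lemma short_exact_Aut_RH:
  "short_exact (S_group \<phi> lam) (\<lambda>\<beta>. induced T (translation \<beta>)) (Aut_RH T) (P_hom T) Z"
proof -
  interpret Z: group Z by (rule group_Z)
  have SZ_I: "(\<beta>, \<eta>) \<in> carrier SZ" if "\<beta> \<in> S" "\<eta> \<in> carrier Z" for \<beta> \<eta> using that by (simp add: SZ_carrier)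
  have carS: "carrier (S_group \<phi> lam) = S" by (simp add: S_group_def)
  have P: "P_hom T (skew_aut g) = snd g" if "g \<in> carrier SZ" for g by (rule P_hom_skew[OF that])
  have Aut_cases: "\<exists>\<beta>\<in>S. \<exists>\<eta>\<in>carrier Z. f = skew_aut (\<beta>, \<eta>)" if "f \<in> carrier (Aut_RH T)" for f
    using skew_aut_surj[OF that] by (auto simp: SZ_carrier)
  show ?thesis
    unfolding short_exact_def
  proof (intro conjI)
    show "group_hom (S_group \<phi> lam) (Aut_RH T) (\<lambda>\<beta>. induced T (translation \<beta>))"
    proof (intro group_hom.intro group_hom_axioms.intro group_S group_Aut_RH homI)
      fix \<beta> assume "\<beta> \<in> carrier (S_group \<phi> lam)"
      then show "induced T (translation \<beta>) \<in> carrier (Aut_RH T)"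
        by (simp add: carS induced_translation skew_aut_mem SZ_I)
      fix \<beta>' assume "\<beta>' \<in> carrier (S_group \<phi> lam)"
      with \<open>\<beta> \<in> carrier (S_group \<phi> lam)\<close> have b: "\<beta> \<in> S" "\<beta>' \<in> S" by (simp_all add: carS)
      have "(\<beta>, \<one>\<^bsub>Z\<^esub>) \<otimes>\<^bsub>SZ\<^esub> (\<beta>', \<one>\<^bsub>Z\<^esub>) = (\<beta> + \<beta>', \<one>\<^bsub>Z\<^esub>)"
        by (simp add: SZ_mult S_act_one[OF b(1)] add.commute)
      then show "induced T (translation (\<beta> \<otimes>\<^bsub>S_group \<phi> lam\<^esub> \<beta>')) =
          induced T (translation \<beta>) \<otimes>\<^bsub>Aut_RH T\<^esub> induced T (translation \<beta>')"
        using b skew_aut_mult[OF SZ_I[OF b(1) Z.one_closed] SZ_I[OF b(2) Z.one_closed]]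
        by (simp add: S_group_def induced_translation S_add)
    qed
    show "group_hom (Aut_RH T) Z (P_hom T)"
    proof (intro group_hom.intro group_hom_axioms.intro group_Z group_Aut_RH homI)
      fix f assume f: "f \<in> carrier (Aut_RH T)"
      then obtain \<beta> \<eta> where f': "\<beta> \<in> S" "\<eta> \<in> carrier Z" "f = skew_aut (\<beta>, \<eta>)" using Aut_cases by blast
      then show "P_hom T f \<in> carrier Z" by (simp add: P SZ_I)
      fix h assume "h \<in> carrier (Aut_RH T)"
      then obtain \<beta>' \<eta>' where h': "\<beta>' \<in> S" "\<eta>' \<in> carrier Z" "h = skew_aut (\<beta>', \<eta>')" using Aut_cases by blast
      have "(\<beta>, \<eta>) \<otimes>\<^bsub>SZ\<^esub> (\<beta>', \<eta>') \<in> carrier SZ"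
        using f' h' by (simp add: SZ_mult SZ_I S_add S_act_closed)
      then have "P_hom T (f \<otimes>\<^bsub>Aut_RH T\<^esub> h) = snd ((\<beta>, \<eta>) \<otimes>\<^bsub>SZ\<^esub> (\<beta>', \<eta>'))"
        using f' h' by (simp add: skew_aut_mult[symmetric] SZ_I P)
      then show "P_hom T (f \<otimes>\<^bsub>Aut_RH T\<^esub> h) = P_hom T f \<otimes>\<^bsub>Z\<^esub> P_hom T h"
        using f' h' by (simp add: SZ_mult P SZ_I)
    qed
    show "inj_on (\<lambda>\<beta>. induced T (translation \<beta>)) (carrier (S_group \<phi> lam))"
    proof (rule inj_onI)
      fix \<beta> \<beta>' assume b: "\<beta> \<in> carrier (S_group \<phi> lam)" "\<beta>' \<in> carrier (S_group \<phi> lam)"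
        and "induced T (translation \<beta>) = induced T (translation \<beta>')"
      then have "skew_aut (\<beta>, \<one>\<^bsub>Z\<^esub>) = skew_aut (\<beta>', \<one>\<^bsub>Z\<^esub>)" by (simp add: carS induced_translation)
      then have "(\<beta>, \<one>\<^bsub>Z\<^esub>) = (\<beta>', \<one>\<^bsub>Z\<^esub>)"
        using b by (intro skew_aut_eq_iff) (simp_all add: carS SZ_I)
      then show "\<beta> = \<beta>'" by simp
    qed
    show "(\<lambda>\<beta>. induced T (translation \<beta>)) ` carrier (S_group \<phi> lam) = kernel (Aut_RH T) Z (P_hom T)"
    proof (intro equalityI subsetI)
      fix f assume "f \<in> (\<lambda>\<beta>. induced T (translation \<beta>)) ` carrier (S_group \<phi> lam)"
      then obtain \<beta> where "\<beta> \<in> S" "f = skew_aut (\<beta>, \<one>\<^bsub>Z\<^esub>)"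
        by (auto simp only: carS induced_translation)
      then show "f \<in> kernel (Aut_RH T) Z (P_hom T)" by (simp add: kernel_def skew_aut_mem SZ_I P)
    next
      fix f assume "f \<in> kernel (Aut_RH T) Z (P_hom T)"
      then have f: "f \<in> carrier (Aut_RH T)" "P_hom T f = \<one>\<^bsub>Z\<^esub>" by (simp_all add: kernel_def)
      then obtain \<beta> \<eta> where f': "\<beta> \<in> S" "\<eta> \<in> carrier Z" "f = skew_aut (\<beta>, \<eta>)" using Aut_cases by blast
      then have "\<eta> = \<one>\<^bsub>Z\<^esub>" using f(2) by (simp add: P SZ_I)
      then show "f \<in> (\<lambda>\<beta>. induced T (translation \<beta>)) ` carrier (S_group \<phi> lam)"
        using f' by (auto simp: carS induced_translation)
    qed
    show "P_hom T ` carrier (Aut_RH T) = carrier Z"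
    proof (intro equalityI subsetI)
      fix \<eta> assume "\<eta> \<in> P_hom T ` carrier (Aut_RH T)"
      then obtain f where f: "f \<in> carrier (Aut_RH T)" "\<eta> = P_hom T f" by blast
      obtain \<beta> \<eta>' where "\<beta> \<in> S" "\<eta>' \<in> carrier Z" "f = skew_aut (\<beta>, \<eta>')" using Aut_cases[OF f(1)] by blast
      then show "\<eta> \<in> carrier Z" using f(2) by (simp add: P SZ_I)
    next
      fix \<eta> assume \<eta>: "\<eta> \<in> carrier Z"
      have "P_hom T (skew_aut (0, \<eta>)) = \<eta>" using P[OF SZ_I[OF S_zero \<eta>]] by simp
      then show "\<eta> \<in> P_hom T ` carrier (Aut_RH T)"
        using skew_aut_mem[OF SZ_I[OF S_zero \<eta>]] by (metis image_eqI)
    qed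
  qed
qed

end

theorem theorem3p12:
  fixes lam :: complex and \<phi> :: "real \<Rightarrow> real" and T :: "point \<Rightarrow> point"
  assumes "norm lam > 1"
    and "\<phi> \<in> carrier Diff_half"
    and "\<And>x. x > 0 \<Longrightarrow> \<phi> x > x"
    and "tangent_id_infinite_order \<phi>"
    and "T = LC_T lam lam 1 1 \<phi>"
  shows "infinite_dimensional_subspace (S_space \<phi> lam) \<and>
    short_exact (S_group \<phi> lam) (\<lambda>\<beta>. induced T (translation \<beta>)) (Aut_RH T) (P_hom T) (Z_centralizer \<phi>) \<and>
    group (S_semidirect_Z \<phi> lam) \<and>
    (\<exists>\<Psi> \<in> iso (S_semidirect_Z \<phi> lam) (Aut_RH T).
       (\<forall>\<beta>\<in>S_space \<phi> lam. \<Psi> (\<beta>, \<one>\<^bsub>Z_centralizer \<phi>\<^esub>) = induced T (translation \<beta>)) \<and>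
       (\<forall>\<beta>\<in>S_space \<phi> lam. \<forall>\<eta>\<in>carrier (Z_centralizer \<phi>). P_hom T (\<Psi> (\<beta>, \<eta>)) = \<eta>))"
proof -
  interpret Reeb_data lam \<phi>
    using assms(1-4) by unfold_locales
  have T: "T = Reeb_data.T lam \<phi>" by (simp add: T_def assms(5))
  have "\<forall>\<beta>\<in>S. skew_aut (\<beta>, \<one>\<^bsub>Z\<^esub>) = induced T (translation \<beta>)"
    unfolding T using induced_translation by simp
  moreover have "\<forall>\<beta>\<in>S. \<forall>\<eta>\<in>carrier Z. P_hom T (skew_aut (\<beta>, \<eta>)) = \<eta>"
    unfolding T by (simp add: P_hom_skew SZ_carrier)
  ultimately show ?thesis
    using S_space_infinite_dimensional short_exact_Aut_RH group_SZ skew_aut_iso unfolding T by blast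
qed

end
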